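(* Let $1<p,q<\infty$, let $w$ be a Lorentz weight, and let $n=cd(\ell_p,d(w,q))$. Consider the conditions (I) $\frac pq\le n<\frac pq+1$ and $w\notin\ell_{\left(\frac p{(n-1)q}\right)^*}$; (II) $n<\frac pq$ and $w\in\ell_{\left(\frac p{nq}\right)^*}\setminus\ell_{\left(\frac p{(n-1)q}\right)^*}$. Then: (a) If $n$ and $w$ satisfy (I), then $\mathcal P_w(^n\ell_p,d(w,q))$ is an $M$-ideal in $\mathcal P(^n\ell_p,d(w,q))$, and $\mathcal P_w(^k\ell_p,d(w,q))$ is not a semi $M$-ideal in $\mathcal P(^k\ell_p,d(w,q))$ for all $k>n$. (b) If $n$ and $w$ satisfy (II), then $\mathcal P_w(^k\ell_p,d(w,q))$ is not a semi $M$-ideal in $\mathcal P(^k\ell_p,d(w,q))$ for all $k\ge n$.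
   Context: $r^*$ denotes the conjugate exponent, $\frac1r+\frac1{r^*}=1$; for $n=1$, $\frac p{(n-1)q}$ is read as $\infty$ and $\infty^*=1$. A Lorentz weight is a non-increasing sequence $w=(w_j)_j$ of positive reals with $w_1=1$ and $w\in c_0\setminus\ell_1$; $d(w,q)$ is the space of scalar sequences $x$ with $\|x\|_{d(w,q)}=\sup_\sigma\big(\sum_{j=1}^\infty w_j|x_{\sigma(j)}|^q\big)^{1/q}<\infty$, $\sigma$ ranging over permutations of $\mathbb N$. $\mathcal P(^nE,F)$ is the Banach space of continuous $n$-homogeneous polynomials $P:E\to F$ with norm $\|P\|=\sup_{\|x\|\le1}\|P(x)\|$. $\mathcal P_w(^nE,F)$ is the subspace of polynomials that are weakly continuous on bounded sets: $\|P(x_\alpha)-P(x)\|\to0$ for every bounded net $(x_\alpha)$ converging weakly to $x\in E$. The critical degree $cd(E,F)$ is the smallest $k\ge1$ such that $\mathcal P_w(^kE,F)\ne\mathcal P(^kE,F)$ (it exists for the pair $(\ell_p,d(w,q))$). A closed subspace $J$ of a Banach space $X$ is an $M$-ideal if there is a linear projection $\pi$ on $X^*$ with kernel $J^\perp$ such that $\|x^*\|=\|\pi(x^* )\|+\|x^*-\pi(x^* )\|$ for all $x^*\in X^*$. $J$ is a semi $M$-ideal if it satisfies the 2-ball property: for all $x_1,x_2\in X$ and $r_1,r_2>0$ with $B(x_1,r_1)\cap B(x_2,r_2)\ne\emptyset$ and $B(x_j,r_j)\cap J\neq\emptyset$ ($j=1,2$), one has $B(x_1,r_1+\varepsilon)\cap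 B(x_2,r_2+\varepsilon)\cap J\neq\emptyset$ for all $\varepsilon>0$, where $B(x,r)$ is the closed ball. *)

theory Defs
  imports "HOL-Analysis.Analysis" "HOL-Library.Function_Algebras"
begin

section \<open>Scalars\<close>

text \<open>
  The scalar field is the real or the complex numbers. For \<open>i = 0\<close> the axiom says that every scalar
  is real; otherwise \<open>i\<close> is an imaginary unit. Multiplicativity of the norm then forces the usual
  absolute value.
\<close>

class real_or_complex = real_normed_field +
  assumes scalar_form: "\<exists>i. (i = 0 \<or> i * i = - 1) \<and> (\<forall>z. \<exists>a b. z = a *\<^sub>R 1 + b *\<^sub>R i)"

instance real :: real_or_complex
  by standard (rule exI[of _ 0], auto)

instance complex :: real_or_complex
proof
  show "\<exists>i::complex. (i = 0 \<or> i * i = - 1) \<and> (\<forall>z. \<exists>a b. z = a *\<^sub>R 1 + b *\<^sub>R i)"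
    by (rule exI[of _ \<i>]) (auto simp: complex_eq_iff)
qed


section \<open>Normed spaces on a carrier\<close>

text \<open>
  Since \<open>\<ell>\<^sub>p\<close> and \<open>d(w,q)\<close> depend on parameters, normed spaces are given by a
  carrier inside an additive group, a scalar multiplication and a norm. The additive structure on
  spaces of functions is the pointwise one.
\<close>

record ('k, 'v) nspace =
  vecs :: "'v set"
  scl :: "'k \<Rightarrow> 'v \<Rightarrow> 'v"
  nrm :: "'v \<Rightarrow> real"

text \<open>
  The locale \<^locale>\<open>Metric_space\<close> wants a nonnegative symmetric distance on the whole type, while
  \<^term>\<open>nrm X\<close> is arbitrary off the carrier; hence the case distinction.
\<close>

definition ndist :: "('k, 'v::ab_group_add) nspace \<Rightarrow> 'v \<Rightarrow> 'v \<Rightarrow> real" where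
  "ndist X x y = (if x \<in> vecs X \<and> y \<in> vecs X then nrm X (x - y) else 0)"

definition ntop :: "('k, 'v::ab_group_add) nspace \<Rightarrow> 'v topology" where
  "ntop X = Metric_space.mtopology (vecs X) (ndist X)"

definition ncball :: "('k, 'v::ab_group_add) nspace \<Rightarrow> 'v \<Rightarrow> real \<Rightarrow> 'v set" where
  "ncball X x r = Metric_space.mcball (vecs X) (ndist X) x r"

definition banach_on :: "('k::real_or_complex, 'v::ab_group_add) nspace \<Rightarrow> bool" where
  "banach_on X \<longleftrightarrow>
     vector_space (scl X) \<and> module.subspace (scl X) (vecs X) \<and>
     (\<forall>x\<in>vecs X. 0 \<le> nrm X x \<and> (nrm X x = 0 \<longleftrightarrow> x = 0)) \<and>
     (\<forall>c. \<forall>x\<in>vecs X. nrm X (scl X c x) = norm c * nrm X x) \<and>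
     (\<forall>x\<in>vecs X. \<forall>y\<in>vecs X. nrm X (x + y) \<le> nrm X x + nrm X y) \<and>
     Metric_space.mcomplete (vecs X) (ndist X)"

text \<open>
  Maps between such spaces are normalised to vanish off the carrier, so that two maps agreeing on
  the carrier are equal.
\<close>

definition dual :: "('k::real_or_complex, 'v::ab_group_add) nspace \<Rightarrow> ('k, 'v \<Rightarrow> 'k) nspace" where
  "dual X =
     \<lparr>vecs = {f. (\<forall>x\<in>vecs X. \<forall>y\<in>vecs X. f (x + y) = f x + f y) \<and>
                (\<forall>c. \<forall>x\<in>vecs X. f (scl X c x) = c * f x) \<and>
                continuous_map (ntop X) euclidean f \<and>
                (\<forall>x. x \<notin> vecs X \<longrightarrow> f x = 0)},
      scl = (\<lambda>c f x. c * f x),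
      nrm = (\<lambda>f. SUP x\<in>{x \<in> vecs X. nrm X x \<le> 1}. norm (f x))\<rparr>"


section \<open>Sequence spaces\<close>

text \<open>Sequences are indexed from \<open>0\<close>.\<close>

definition ell :: "ereal \<Rightarrow> (nat \<Rightarrow> 'a::real_normed_vector) set" where
  "ell r = {x. if r = \<infinity> then bounded (range x)
               else summable (\<lambda>i. norm (x i) powr real_of_ereal r)}"

text \<open>The solution of \<open>1/r + 1/r* = 1\<close>; in particular the conjugate of \<open>\<infinity>\<close> is \<open>1\<close>.\<close>

definition conj_exp :: "ereal \<Rightarrow> ereal" where
  "conj_exp r = inverse (1 - inverse r)"

definition lp_space :: "real \<Rightarrow> ('k::real_or_complex, nat \<Rightarrow> 'k) nspace" where
  "lp_space p =
     \<lparr>vecs = ell (ereal p),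
      scl = (\<lambda>c x i. c * x i),
      nrm = (\<lambda>x. (\<Sum>i. norm (x i) powr p) powr (1 / p))\<rparr>"

definition lorentz_weight :: "(nat \<Rightarrow> real) \<Rightarrow> bool" where
  "lorentz_weight w \<longleftrightarrow> (\<forall>j. 0 < w j) \<and> decseq w \<and> w 0 = 1 \<and> w \<longlonglongrightarrow> 0 \<and> w \<notin> ell 1"

definition lorentz_space :: "(nat \<Rightarrow> real) \<Rightarrow> real \<Rightarrow> ('k::real_or_complex, nat \<Rightarrow> 'k) nspace" where
  "lorentz_space w q =
     \<lparr>vecs = {x. (\<forall>\<sigma>. bij \<sigma> \<longrightarrow> summable (\<lambda>j. w j * norm (x (\<sigma> j)) powr q)) \<and>
                bdd_above ((\<lambda>\<sigma>. (\<Sum>j. w j * norm (x (\<sigma> j)) powr q) powr (1 / q)) ` {\<sigma>. bij \<sigma>})},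
      scl = (\<lambda>c x i. c * x i),
      nrm = (\<lambda>x. SUP \<sigma>\<in>{\<sigma>. bij \<sigma>}. (\<Sum>j. w j * norm (x (\<sigma> j)) powr q) powr (1 / q))\<rparr>"


section \<open>Homogeneous polynomials\<close>

text \<open>An \<open>n\<close>-tuple of vectors is a list of length \<open>n\<close>.\<close>

definition multilinear_on ::
  "nat \<Rightarrow> ('k::real_or_complex, 'v::ab_group_add) nspace \<Rightarrow> ('k, 'w::ab_group_add) nspace \<Rightarrow> ('v list \<Rightarrow> 'w) \<Rightarrow> bool"
where
  "multilinear_on n X Y A \<longleftrightarrow>
     (\<forall>xs. length xs = n \<and> set xs \<subseteq> vecs X \<longrightarrow>
        A xs \<in> vecs Y \<and>
        (\<forall>i<n. \<forall>a\<in>vecs X.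
           (\<forall>b\<in>vecs X. A (xs[i := a + b]) = A (xs[i := a]) + A (xs[i := b])) \<and>
           (\<forall>c. A (xs[i := scl X c a]) = scl Y c (A (xs[i := a])))))"

definition homogeneous_poly ::
  "nat \<Rightarrow> ('k::real_or_complex, 'v::ab_group_add) nspace \<Rightarrow> ('k, 'w::ab_group_add) nspace \<Rightarrow> ('v \<Rightarrow> 'w) \<Rightarrow> bool"
where
  "homogeneous_poly n X Y P \<longleftrightarrow>
     (\<exists>A. multilinear_on n X Y A \<and> (\<forall>x\<in>vecs X. P x = A (replicate n x)))"

definition poly_space ::
  "nat \<Rightarrow> ('k::real_or_complex, 'v::ab_group_add) nspace \<Rightarrow> ('k, 'w::ab_group_add) nspace \<Rightarrow> ('k, 'v \<Rightarrow> 'w) nspace"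
where
  "poly_space n X Y =
     \<lparr>vecs = {P. homogeneous_poly n X Y P \<and> continuous_map (ntop X) (ntop Y) P \<and>
                (\<forall>x. x \<notin> vecs X \<longrightarrow> P x = 0)},
      scl = (\<lambda>c P x. scl Y c (P x)),
      nrm = (\<lambda>P. SUP x\<in>{x \<in> vecs X. nrm X x \<le> 1}. nrm Y (P x))\<rparr>"

text \<open>
  Nets are rendered by filters: a net in \<open>X\<close> corresponds to the filter of its tails.
\<close>

definition weakly_continuous_on_bounded ::
  "('k::real_or_complex, 'v::ab_group_add) nspace \<Rightarrow> ('k, 'w::ab_group_add) nspace \<Rightarrow> ('v \<Rightarrow> 'w) \<Rightarrow> bool"
where
  "weakly_continuous_on_bounded X Y P \<longleftrightarrow>
     (\<forall>F r. \<forall>x\<in>vecs X.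
        (\<forall>\<^sub>F y in F. y \<in> vecs X \<and> nrm X y \<le> r) \<and> (\<forall>f\<in>vecs (dual X). (f \<longlongrightarrow> f x) F) \<longrightarrow>
        ((\<lambda>y. nrm Y (P y - P x)) \<longlongrightarrow> 0) F)"

definition weak_polys ::
  "nat \<Rightarrow> ('k::real_or_complex, 'v::ab_group_add) nspace \<Rightarrow> ('k, 'w::ab_group_add) nspace \<Rightarrow> ('v \<Rightarrow> 'w) set"
where
  "weak_polys n X Y = {P \<in> vecs (poly_space n X Y). weakly_continuous_on_bounded X Y P}"

definition critical_degree ::
  "('k::real_or_complex, 'v::ab_group_add) nspace \<Rightarrow> ('k, 'w::ab_group_add) nspace \<Rightarrow> nat"
where
  "critical_degree X Y = (LEAST k. 1 \<le> k \<and> weak_polys k X Y \<noteq> vecs (poly_space k X Y))"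


section \<open>M-ideals\<close>

definition annihilator :: "('k::real_or_complex, 'v::ab_group_add) nspace \<Rightarrow> 'v set \<Rightarrow> ('v \<Rightarrow> 'k) set" where
  "annihilator X J = {f \<in> vecs (dual X). \<forall>x\<in>J. f x = 0}"

definition linear_projection :: "('k::real_or_complex, 'v::ab_group_add) nspace \<Rightarrow> ('v \<Rightarrow> 'v) \<Rightarrow> bool" where
  "linear_projection X \<pi> \<longleftrightarrow>
     (\<forall>x\<in>vecs X. \<pi> x \<in> vecs X \<and> \<pi> (\<pi> x) = \<pi> x) \<and>
     (\<forall>x\<in>vecs X. \<forall>y\<in>vecs X. \<pi> (x + y) = \<pi> x + \<pi> y) \<and>
     (\<forall>c. \<forall>x\<in>vecs X. \<pi> (scl X c x) = scl X c (\<pi> x))"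

definition M_ideal :: "('k::real_or_complex, 'v::ab_group_add) nspace \<Rightarrow> 'v set \<Rightarrow> bool" where
  "M_ideal X J \<longleftrightarrow>
     banach_on X \<and> J \<subseteq> vecs X \<and> module.subspace (scl X) J \<and> closedin (ntop X) J \<and>
     (\<exists>\<pi>. linear_projection (dual X) \<pi> \<and>
          {f \<in> vecs (dual X). \<pi> f = 0} = annihilator X J \<and>
          (\<forall>f\<in>vecs (dual X). nrm (dual X) f = nrm (dual X) (\<pi> f) + nrm (dual X) (f - \<pi> f)))"

text \<open>
  This is the 2-ball property alone. Completeness of the space and closedness of the subspace are
  left out so that the negation refers to nothing but the ball property.
\<close>

definition semi_M_ideal :: "('k::real_or_complex, 'v::ab_group_add) nspace \<Rightarrow> 'v set \<Rightarrow> bool" where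
  "semi_M_ideal X J \<longleftrightarrow>
     (\<forall>x1\<in>vecs X. \<forall>x2\<in>vecs X. \<forall>r1>0. \<forall>r2>0.
        ncball X x1 r1 \<inter> ncball X x2 r2 \<noteq> {} \<and>
        ncball X x1 r1 \<inter> J \<noteq> {} \<and> ncball X x2 r2 \<inter> J \<noteq> {} \<longrightarrow>
        (\<forall>\<epsilon>>0. ncball X x1 (r1 + \<epsilon>) \<inter> ncball X x2 (r2 + \<epsilon>) \<inter> J \<noteq> {}))"

end

theory Submission
  imports Defs "HOL-Real_Asymp.Real_Asymp"
begin

text \<open>
  A polynomial of critical degree \<open>n\<close> is, up to weakly continuous terms, unaffected by dropping finitely
  many coordinates of its argument, because the intermediate terms have lower degree. So \<open>Q\<close> differs
  from \<open>Q \<circ> (I - \<pi>\<^sub>m)\<close> by a weakly continuous polynomial, where \<open>\<pi>\<^sub>m\<close> is the projection of \<open>\<ell>\<^sub>p\<close> onto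
  the first \<open>m\<close> coordinates, while a weakly continuous \<open>R\<close> is nearly \<open>\<Pi>\<^sub>l R \<pi>\<^sub>l\<close> with \<open>\<Pi>\<^sub>l\<close> the
  projection of \<open>d(w,q)\<close>. If \<open>n q \<ge> p\<close>, the upper \<open>q\<close>-estimate of \<open>d(w,q)\<close> shows that
  \<open>R + Q \<circ> (I - \<pi>\<^sub>m)\<close> has norm at most \<open>1 + \<epsilon>\<close> for \<open>R\<close> and \<open>Q\<close> in the unit balls and \<open>m\<close> large
  (for \<open>n < p\<close> after removing the first coordinates of \<open>Q \<circ> (I - \<pi>\<^sub>m)\<close>, which are small; for
  \<open>n \<ge> p\<close> the triangle inequality suffices). This gives the M-ideal: the projection is
  \<open>f \<mapsto> lim f(\<Pi>\<^sub>m \<cdot> \<pi>\<^sub>m)\<close> along an ultrafilter.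

  Conversely, apply the 2-ball property to \<open>Q \<plusminus> P\<close> with \<open>P x = x\<^sub>0\<^sup>k e\<^sub>0\<close> and
  \<open>Q x = c x\<^sub>0\<^bsup>k-n\<^esup> (x\<^sub>j\<^sup>n)\<^sub>j\<close>. Testing on \<open>t e\<^sub>0 + s e\<^sub>j\<close> with \<open>t\<^sup>p + s\<^sup>p = 1\<close> and \<open>j \<rightarrow> \<infinity>\<close> bounds the
  norm of \<open>t\<^sup>k e\<^sub>0 + c t\<^bsup>k-n\<^esup> s\<^sup>n e\<^sub>1\<close> in \<open>d(w,q)\<close> by \<open>1\<close>. This fails for small \<open>s\<close> if \<open>n q < p\<close>,
  and if \<open>k > n\<close> at the point where \<open>Q\<close> attains its norm.
\<close>

section \<open>Scalars\<close>

text \<open>The condition n q \<ge> p matches the two norms: for disjointly supported values the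
  q-th powers of the norms in d(w,q) are subadditive, a value of degree n is at most the n-th power
  of the norm of its block, and a number in [0,1] raised to n q is at most its p-th power, while
  p-th powers of blocks add up exactly in the domain. The obstacle is that Q after a tail projection
  may still take values in the coordinates where R lives. For n < p a gliding hump excludes this.
  For n \<ge> p it can happen, as for the sum of all \<open>x\<^sub>j\<^sup>n\<close> times
  \<open>e\<^sub>0\<close>, but then already the norms are at most p-th powers of the blocks. In the
  converse, c makes the norm of Q at most 1. A weakly continuous R does not see
  \<open>s e\<^sub>j\<close> for large j, so it cannot cancel coordinate j of Q, and in coordinate 0
  it misses one of the two signs by at least 1. If n q < p, a small s gains the order
  \<open>s^(n q)\<close> and loses only the order \<open>s^p\<close>. If k > n, the maximum of Q on
  the arc lies at some t > 0, where the peak adds a positive term; for k = n it lies at t = 0 and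
  the contradiction disappears.\<close>

lemma scalar_decomposition_bounded:
  obtains i :: "'k::real_or_complex" where
    "\<And>z. \<exists>a b. z = a *\<^sub>R 1 + b *\<^sub>R i \<and> \<bar>a\<bar> \<le> 2 * norm z \<and> \<bar>b\<bar> \<le> 2 * norm z"
proof -
  obtain i :: 'k where i: "i = 0 \<or> i * i = - 1" and dec: "\<And>z. \<exists>a b. z = a *\<^sub>R 1 + b *\<^sub>R i"
    using scalar_form by blast
  have "\<exists>a b. z = a *\<^sub>R 1 + b *\<^sub>R i \<and> \<bar>a\<bar> \<le> 2 * norm z \<and> \<bar>b\<bar> \<le> 2 * norm z" for z
  proof (cases "i = 0")
    case True
    obtain a b where "z = a *\<^sub>R 1 + b *\<^sub>R i" using dec by blast
    with True have "z = a *\<^sub>R 1 + 0 *\<^sub>R i" "norm z = \<bar>a\<bar>" by auto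
    then show ?thesis by (intro exI[of _ a] exI[of _ 0]) auto
  next
    case False
    with i have ii: "i * i = - 1" by simp
    then have "norm i * norm i = 1" by (metis norm_minus_cancel norm_mult norm_one)
    then have ni: "norm i = 1" by (metis abs_norm_cancel abs_square_eq_1 power2_eq_square)
    obtain a b where z: "z = a *\<^sub>R 1 + b *\<^sub>R i" using dec by blast
    \<comment> \<open>The second factor plays the conjugate of z. Its norm is only estimated, by |a|
      + |b|, so the norm need not be identified with the modulus; this is where the factor 2 comes
      from.\<close>
    have "z * (a *\<^sub>R 1 - b *\<^sub>R i) = (a * a) *\<^sub>R 1 - (b * b) *\<^sub>R (i * i)"
      unfolding z by (simp add: algebra_simps)
    also have "\<dots> = (a * a + b * b) *\<^sub>R 1" by (simp add: ii scaleR_add_left)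
    finally have "norm z * norm (a *\<^sub>R 1 - b *\<^sub>R i) = a * a + b * b"
      by (metis abs_of_nonneg add_nonneg_nonneg norm_mult norm_one norm_scaleR mult.right_neutral zero_le_square)
    moreover have "norm (a *\<^sub>R 1 - b *\<^sub>R i) \<le> \<bar>a\<bar> + \<bar>b\<bar>"
      by (rule norm_triangle_le_diff) (simp add: ni)
    ultimately have 1: "a * a + b * b \<le> norm z * (\<bar>a\<bar> + \<bar>b\<bar>)"
      by (metis mult_left_mono norm_ge_zero)
    have "0 \<le> (\<bar>a\<bar> - \<bar>b\<bar>) * (\<bar>a\<bar> - \<bar>b\<bar>)" by simp
    then have "(\<bar>a\<bar> + \<bar>b\<bar>) * (\<bar>a\<bar> + \<bar>b\<bar>) \<le> 2 * (a * a + b * b)"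
      by (simp add: algebra_simps)
    with 1 have "(\<bar>a\<bar> + \<bar>b\<bar>) * (\<bar>a\<bar> + \<bar>b\<bar>) \<le> (2 * norm z) * (\<bar>a\<bar> + \<bar>b\<bar>)" by simp
    then have "\<bar>a\<bar> + \<bar>b\<bar> \<le> 2 * norm z"
      using mult_right_le_imp_le[of "\<bar>a\<bar> + \<bar>b\<bar>" "\<bar>a\<bar> + \<bar>b\<bar>" "2 * norm z"]
      using norm_ge_zero[of z] by (cases "0 < \<bar>a\<bar> + \<bar>b\<bar>") (blast, linarith)
    with z show ?thesis by (intro exI[of _ a] exI[of _ b]) auto
  qed
  then show ?thesis using that by blast
qed

text \<open>Heine-Borel for both fields at once: bounded coefficients place the ball inside a
  continuous image of a square.\<close>

lemma scalar_compact_cball: "compact (cball (0::'k::real_or_complex) r)"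
proof -
  obtain i :: 'k where
    i: "\<And>z. \<exists>a b. z = a *\<^sub>R 1 + b *\<^sub>R i \<and> \<bar>a\<bar> \<le> 2 * norm z \<and> \<bar>b\<bar> \<le> 2 * norm z"
    using scalar_decomposition_bounded by blast
  let ?K = "(\<lambda>c. fst c *\<^sub>R 1 + snd c *\<^sub>R i) ` ({- (2 * r)..2 * r} \<times> {- (2 * r)..2 * r})"
  have "compact ?K"
    by (intro compact_continuous_image compact_Times compact_Icc continuous_intros)
  moreover have "cball 0 r \<subseteq> ?K"
  proof
    fix z :: 'k assume z: "z \<in> cball 0 r"
    obtain a b where "z = a *\<^sub>R 1 + b *\<^sub>R i" "\<bar>a\<bar> \<le> 2 * norm z" "\<bar>b\<bar> \<le> 2 * norm z"
      using i by blast
    with z show "z \<in> ?K" by (auto intro!: image_eqI[of _ _ "(a, b)"])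
  qed
  ultimately have "compact (?K \<inter> cball 0 r)" "?K \<inter> cball 0 r = cball 0 r"
    by (auto intro: compact_Int_closed)
  then show ?thesis by simp
qed

lemma scalar_Cauchy_convergent:
  fixes s :: "nat \<Rightarrow> 'k::real_or_complex"
  assumes "Cauchy s"
  shows "\<exists>l. s \<longlonglongrightarrow> l"
proof -
  obtain r where "\<forall>x\<in>range s. norm x \<le> r"
    using cauchy_imp_bounded[OF assms] unfolding bounded_iff by blast
  then have "range s \<subseteq> cball 0 r" by auto
  then show ?thesis
    using compact_imp_complete[OF scalar_compact_cball, of r] assms unfolding complete_def by blast
qed

text \<open>
  A substitute for convergence along an ultrafilter: by Tychonoff's theorem, the evaluations at the
  points of the index set have a cluster point among the functionals on bounded functions.
\<close>

lemma ex_subfilter_bounded_functions_converge: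
  fixes F :: "'a filter"
  assumes "F \<noteq> bot"
  shows "\<exists>U\<le>F. U \<noteq> bot \<and> (\<forall>s::'a \<Rightarrow> 'k::real_or_complex. bounded (range s) \<longrightarrow> (\<exists>l. (s \<longlongrightarrow> l) U))"
proof -
  \<comment> \<open>Unbounded functions get the value 0, so that every coordinate of
    \<open>ev a\<close> stays in a compact ball not depending on \<open>a\<close>.\<close>
  define ev :: "'a \<Rightarrow> ('a \<Rightarrow> 'k) \<Rightarrow> 'k" where
    "ev = (\<lambda>a s. if bounded (range s) then s a else 0)"
  have "\<exists>r. \<forall>a. ev a s \<in> cball 0 r" for s
  proof (cases "bounded (range s)")
    case True
    then show ?thesis by (auto simp: ev_def bounded_iff)
  next
    case False
    then have "\<forall>a. ev a s \<in> cball 0 0" by (simp add: ev_def)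
    then show ?thesis by blast
  qed
  then obtain r where r: "\<And>s a. ev a s \<in> cball 0 (r s)" by metis
  let ?K = "PiE UNIV (\<lambda>s. cball (0::'k) (r s))"
  have "compactin (product_topology (\<lambda>_. euclidean) UNIV) ?K"
    by (subst compactin_PiE) (auto simp: scalar_compact_cball)
  then have "compact ?K"
    by (simp add: euclidean_product_topology)
  moreover have "\<forall>\<^sub>F \<phi> in filtermap ev F. \<phi> \<in> ?K"
    using r by (simp add: eventually_filtermap PiE_UNIV_domain)
  moreover have "filtermap ev F \<noteq> bot" using assms by (simp add: filtermap_bot_iff)
  ultimately obtain \<Phi> where \<Phi>: "inf (nhds \<Phi>) (filtermap ev F) \<noteq> bot"
    unfolding compact_filter by blast
  \<comment> \<open>The refinement of \<open>F\<close> by the preimages of the neighbourhoods of the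
    cluster point; it is proper because \<open>\<Phi>\<close> is a cluster point of the image
    filter.\<close>
  define U where "U = inf F (filtercomap ev (nhds \<Phi>))"
  have "U \<noteq> bot"
  proof
    assume "U = bot"
    then have "eventually (\<lambda>_. False) U" by simp
    then obtain P Q where PQ: "eventually P F" "eventually Q (filtercomap ev (nhds \<Phi>))"
      "\<And>a. P a \<Longrightarrow> Q a \<Longrightarrow> False"
      unfolding U_def eventually_inf by blast
    from PQ(2) obtain Q' where Q': "eventually Q' (nhds \<Phi>)" "\<And>a. Q' (ev a) \<Longrightarrow> Q a"
      unfolding eventually_filtercomap by blast
    have "eventually (\<lambda>\<phi>. \<exists>a. \<phi> = ev a \<and> P a) (filtermap ev F)"
      using PQ(1) by (auto simp: eventually_filtermap elim: eventually_mono)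
    with Q'(1) have "eventually (\<lambda>_. False) (inf (nhds \<Phi>) (filtermap ev F))"
      unfolding eventually_inf using PQ(3) Q'(2) by blast
    with \<Phi> show False by (simp add: trivial_limit_def)
  qed
  moreover have "(s \<longlongrightarrow> \<Phi> s) U" if s: "bounded (range s)" for s
  proof -
    have "continuous_on UNIV (\<lambda>\<phi>::('a \<Rightarrow> 'k) \<Rightarrow> 'k. \<phi> s)"
      by (rule continuous_on_product_coordinates)
    then have "((\<lambda>\<phi>::('a \<Rightarrow> 'k) \<Rightarrow> 'k. \<phi> s) \<longlongrightarrow> \<Phi> s) (nhds \<Phi>)"
      unfolding continuous_on_def using tendsto_at_iff_tendsto_nhds[of "\<lambda>\<phi>. \<phi> s" \<Phi>] by blast
    moreover have "filterlim ev (nhds \<Phi>) U"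
      unfolding U_def by (simp add: filterlim_filtercomap filterlim_inf inf.coboundedI2 filterlim_iff_le_filtercomap)
    ultimately have "((\<lambda>a. ev a s) \<longlongrightarrow> \<Phi> s) U"
      by (rule filterlim_compose)
    with s show ?thesis by (simp add: ev_def)
  qed
  ultimately show ?thesis unfolding U_def by (metis inf_le1)
qed

section \<open>Normed spaces on a carrier\<close>

text \<open>The clauses of \<open>banach_on\<close> without completeness, which for polynomial
  spaces is proved only after their norm is known to be one.\<close>

locale normed_on =
  fixes X :: "('k::real_or_complex, 'v::ab_group_add) nspace"
  assumes vector_space_scl: "vector_space (scl X)"
    and subspace_vecs: "module.subspace (scl X) (vecs X)"
    and nrm_ge_0: "x \<in> vecs X \<Longrightarrow> 0 \<le> nrm X x"
    and nrm_eq_0: "x \<in> vecs X \<Longrightarrow> nrm X x = 0 \<longleftrightarrow> x = 0"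
    and nrm_scl: "x \<in> vecs X \<Longrightarrow> nrm X (scl X c x) = norm c * nrm X x"
    and nrm_add: "x \<in> vecs X \<Longrightarrow> y \<in> vecs X \<Longrightarrow> nrm X (x + y) \<le> nrm X x + nrm X y"
begin

sublocale vector_space "scl X" by (rule vector_space_scl)

lemma zero_vecs [simp]: "0 \<in> vecs X"
  and add_vecs [simp]: "x \<in> vecs X \<Longrightarrow> y \<in> vecs X \<Longrightarrow> x + y \<in> vecs X"
  and scl_vecs [simp]: "x \<in> vecs X \<Longrightarrow> scl X c x \<in> vecs X"
  and minus_vecs [simp]: "x \<in> vecs X \<Longrightarrow> - x \<in> vecs X"
  and diff_vecs [simp]: "x \<in> vecs X \<Longrightarrow> y \<in> vecs X \<Longrightarrow> x - y \<in> vecs X"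
  using subspace_vecs by (auto simp: subspace_0 subspace_add subspace_scale subspace_neg subspace_diff)

lemma sum_vecs [simp]: "(\<And>i. i \<in> I \<Longrightarrow> f i \<in> vecs X) \<Longrightarrow> sum f I \<in> vecs X"
  by (rule subspace_sum[OF subspace_vecs])

lemma nrm_0 [simp]: "nrm X 0 = 0"
  using nrm_eq_0 by simp

lemma nrm_minus: "x \<in> vecs X \<Longrightarrow> nrm X (- x) = nrm X x"
  using nrm_scl[of x "- 1"] by simp

lemma nrm_diff: "x \<in> vecs X \<Longrightarrow> y \<in> vecs X \<Longrightarrow> nrm X (x - y) \<le> nrm X x + nrm X y"
  using nrm_add[of x "- y"] nrm_minus by simp

lemma nrm_diff_commute: "x \<in> vecs X \<Longrightarrow> y \<in> vecs X \<Longrightarrow> nrm X (x - y) = nrm X (y - x)"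
  by (metis diff_vecs minus_diff_eq nrm_minus)

lemma nrm_diff_triangle:
  assumes "x \<in> vecs X" "y \<in> vecs X" "z \<in> vecs X"
  shows "nrm X (x - z) \<le> nrm X (x - y) + nrm X (y - z)"
  using nrm_add[of "x - y" "y - z"] assms by simp

lemma nrm_reverse_triangle: "x \<in> vecs X \<Longrightarrow> y \<in> vecs X \<Longrightarrow> \<bar>nrm X x - nrm X y\<bar> \<le> nrm X (x - y)"
  using nrm_add[of y "x - y"] nrm_add[of x "y - x"] nrm_diff_commute[of x y] by simp

lemma nrm_sum: "(\<And>i. i \<in> I \<Longrightarrow> f i \<in> vecs X) \<Longrightarrow> nrm X (sum f I) \<le> (\<Sum>i\<in>I. nrm X (f i))"
proof (induction I rule: infinite_finite_induct)
  case (insert a I)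
  then have "nrm X (f a + sum f I) \<le> nrm X (f a) + nrm X (sum f I)"
    by (intro nrm_add) auto
  with insert show ?case by (auto simp: intro: order_trans)
qed auto

sublocale ms: Metric_space "vecs X" "ndist X"
proof
  fix x y z assume "x \<in> vecs X" "y \<in> vecs X" "z \<in> vecs X"
  then show "ndist X x z \<le> ndist X x y + ndist X y z"
    using nrm_diff_triangle[of x y z] by (simp add: ndist_def)
qed (auto simp: ndist_def nrm_ge_0 nrm_diff_commute nrm_eq_0)

lemma mem_ncball [simp]:
  "y \<in> ncball X x r \<longleftrightarrow> x \<in> vecs X \<and> y \<in> vecs X \<and> nrm X (x - y) \<le> r"
  by (auto simp: ncball_def ndist_def)

lemma normalize_nrm:
  assumes "x \<in> vecs X" "x \<noteq> 0"
  shows "nrm X (scl X (of_real (inverse (nrm X x))) x) = 1"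
    "scl X (of_real (nrm X x)) (scl X (of_real (inverse (nrm X x))) x) = x"
proof -
  have "nrm X x > 0" using assms nrm_ge_0 nrm_eq_0 by (metis less_eq_real_def)
  then show "nrm X (scl X (of_real (inverse (nrm X x))) x) = 1"
    "scl X (of_real (nrm X x)) (scl X (of_real (inverse (nrm X x))) x) = x"
    using assms by (auto simp: nrm_scl norm_inverse simp flip: of_real_mult)
qed

lemma banach_onI: "ms.mcomplete \<Longrightarrow> banach_on X"
  using vector_space_scl subspace_vecs nrm_ge_0 nrm_eq_0 nrm_scl nrm_add
  by (auto simp: banach_on_def)

lemma mcompleteI:
  assumes "\<And>u. (\<And>m. u m \<in> vecs X) \<Longrightarrow>
      (\<And>e. 0 < e \<Longrightarrow> \<exists>N. \<forall>m\<ge>N. \<forall>l\<ge>N. nrm X (u m - u l) < e) \<Longrightarrow>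
      \<exists>x\<in>vecs X. (\<lambda>m. nrm X (u m - x)) \<longlonglongrightarrow> 0"
  shows ms.mcomplete
  unfolding ms.mcomplete_def
proof (intro allI impI)
  fix u assume u: "ms.MCauchy u"
  then have uX: "u m \<in> vecs X" for m
    unfolding ms.MCauchy_def by auto
  have "\<exists>N. \<forall>m\<ge>N. \<forall>l\<ge>N. nrm X (u m - u l) < e" if "0 < e" for e
    using u that uX unfolding ms.MCauchy_def ndist_def by auto
  then obtain x where x: "x \<in> vecs X" "(\<lambda>m. nrm X (u m - x)) \<longlonglongrightarrow> 0"
    using assms uX by blast
  then have "limitin ms.mtopology u x sequentially"
    by (auto simp: ms.limitin_metric_dist_null ndist_def uX)
  then show "\<exists>x. limitin ms.mtopology u x sequentially" by blast
qed

lemma mcomplete_Cauchy: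
  assumes ms.mcomplete "\<And>m. u m \<in> vecs X"
    "\<And>e. 0 < e \<Longrightarrow> \<exists>N. \<forall>m\<ge>N. \<forall>l\<ge>N. nrm X (u m - u l) < e"
  shows "\<exists>x\<in>vecs X. (\<lambda>m. nrm X (u m - x)) \<longlonglongrightarrow> 0"
proof -
  have "ms.MCauchy u"
    using assms(2,3) by (auto simp: ms.MCauchy_def ndist_def)
  then obtain x where "limitin ms.mtopology u x sequentially"
    using assms(1) unfolding ms.mcomplete_def by blast
  then show ?thesis
    using assms(2) by (auto simp: ms.limitin_metric_dist_null ndist_def)
qed

lemma closedin_ntopI:
  assumes "J \<subseteq> vecs X"
    and "\<And>u x. (\<And>m. u m \<in> J) \<Longrightarrow> x \<in> vecs X \<Longrightarrow> (\<lambda>m. nrm X (u m - x)) \<longlonglongrightarrow> 0 \<Longrightarrow> x \<in> J"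
  shows "closedin (ntop X) J"
  unfolding ntop_def
proof (rule ms.metric_closedin_iff_sequentially_closed[THEN iffD2], intro conjI allI impI)
  fix u x assume u: "range u \<subseteq> J \<and> limitin ms.mtopology u x sequentially"
  moreover from this assms(1) have "u m \<in> vecs X" for m by auto
  ultimately have "x \<in> vecs X" "(\<lambda>m. nrm X (u m - x)) \<longlonglongrightarrow> 0"
    by (auto simp: ms.limitin_metric_dist_null ndist_def) 
  with u assms(2) show "x \<in> J" by blast
qed (rule assms(1))

section \<open>Norm convergence along arbitrary filters\<close>

definition nlim :: "('i \<Rightarrow> 'v) \<Rightarrow> 'v \<Rightarrow> 'i filter \<Rightarrow> bool" where
  "nlim u x F \<longleftrightarrow> ((\<lambda>a. nrm X (u a - x)) \<longlongrightarrow> 0) F"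

lemma nlim_add:
  assumes "nlim u x F" "nlim v y F" "x \<in> vecs X" "y \<in> vecs X"
    "\<And>a. u a \<in> vecs X" "\<And>a. v a \<in> vecs X"
  shows "nlim (\<lambda>a. u a + v a) (x + y) F"
  unfolding nlim_def
proof (rule tendsto_sandwich[where f = "\<lambda>_. 0"])
  show "\<forall>\<^sub>F a in F. nrm X (u a + v a - (x + y)) \<le> nrm X (u a - x) + nrm X (v a - y)"
    using assms nrm_add[of "u _ - x" "v _ - y"] by (auto simp: algebra_simps)
  show "((\<lambda>a. nrm X (u a - x) + nrm X (v a - y)) \<longlongrightarrow> 0) F"
    using tendsto_add[of _ 0 F _ 0] assms unfolding nlim_def by fastforce
qed (use assms in \<open>auto intro!: always_eventually nrm_ge_0 diff_vecs add_vecs simp del: diff_vecs\<close>)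

lemma nlim_scl:
  assumes "nlim u x F" "x \<in> vecs X" "\<And>a. u a \<in> vecs X"
  shows "nlim (\<lambda>a. scl X c (u a)) (scl X c x) F"
proof -
  have "nrm X (scl X c (u a) - scl X c x) = norm c * nrm X (u a - x)" for a
    using assms by (metis diff_vecs nrm_scl scale_right_diff_distrib)
  then show ?thesis using assms(1) unfolding nlim_def
    by (auto intro: tendsto_mult_right_zero)
qed

lemma nlim_sum:
  assumes "\<And>i. i \<in> I \<Longrightarrow> nlim (\<lambda>a. u a i) (x i) F" "\<And>i. i \<in> I \<Longrightarrow> x i \<in> vecs X"
    "\<And>a i. i \<in> I \<Longrightarrow> u a i \<in> vecs X"
  shows "nlim (\<lambda>a. \<Sum>i\<in>I. u a i) (\<Sum>i\<in>I. x i) F"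
  using assms
proof (induction I rule: infinite_finite_induct)
  case (insert i I)
  then show ?case by (simp add: nlim_add)
qed (auto simp: nlim_def)

lemma nlim_unique:
  assumes "nlim u x F" "nlim u y F" "F \<noteq> bot" "x \<in> vecs X" "y \<in> vecs X" "\<And>a. u a \<in> vecs X"
  shows "x = y"
proof -
  have "((\<lambda>a. nrm X (u a - x) + nrm X (u a - y)) \<longlongrightarrow> 0) F"
    using tendsto_add[of _ 0 F _ 0] assms unfolding nlim_def by fastforce
  moreover have "nrm X (x - y) \<le> nrm X (u a - x) + nrm X (u a - y)" for a
    using nrm_diff[of "u a - y" "u a - x"] assms by simp
  ultimately have "nrm X (x - y) \<le> 0"
    by (intro tendsto_lowerbound[of _ 0 F]) (auto simp: assms(3))
  then have "nrm X (x - y) = 0" using nrm_ge_0[of "x - y"] assms by simp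
  then show ?thesis using nrm_eq_0[of "x - y"] assms by simp
qed

lemma nlim_nrm:
  assumes "nlim u x F" "x \<in> vecs X" "\<And>a. u a \<in> vecs X"
  shows "((\<lambda>a. nrm X (u a)) \<longlongrightarrow> nrm X x) F"
proof -
  have "((\<lambda>a. nrm X (u a) - nrm X x) \<longlongrightarrow> 0) F"
    using assms(1) unfolding nlim_def
    by (rule Lim_null_comparison[rotated]) (simp add: assms nrm_reverse_triangle)
  then show ?thesis by (simp add: LIM_zero_iff)
qed

end

lemma continuous_map_ntop_iff:
  assumes "normed_on X" "normed_on Y"
  shows "continuous_map (ntop X) (ntop Y) f \<longleftrightarrow>
    f ` vecs X \<subseteq> vecs Y \<and>
    (\<forall>x\<in>vecs X. \<forall>e>0. \<exists>d>0. \<forall>y\<in>vecs X. nrm X (x - y) < d \<longrightarrow> nrm Y (f x - f y) < e)"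
proof -
  interpret X: normed_on X by fact
  interpret Y: normed_on Y by fact
  have *: "Metric_space (vecs Y) (ndist Y)" by (rule Y.ms.Metric_space_axioms)
  show ?thesis
    unfolding ntop_def X.ms.metric_continuous_map[OF *]
    by (fastforce simp: ndist_def image_subset_iff)
qed

lemma continuous_map_ntop_euclidean_iff:
  fixes f :: "'v::ab_group_add \<Rightarrow> 'k::real_or_complex"
  assumes "normed_on X"
  shows "continuous_map (ntop X) euclidean f \<longleftrightarrow>
    (\<forall>x\<in>vecs X. \<forall>e>0. \<exists>d>0. \<forall>y\<in>vecs X. nrm X (x - y) < d \<longrightarrow> norm (f x - f y) < e)"
proof -
  interpret X: normed_on X by fact
  have *: "Metric_space (UNIV :: 'k set) dist" by (rule Met_TC.Metric_space_axioms)
  show ?thesis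
    unfolding ntop_def mtopology_is_euclidean[symmetric] X.ms.metric_continuous_map[OF *]
    by (fastforce simp: ndist_def dist_norm)
qed

section \<open>Multilinear maps and homogeneous polynomials\<close>

lemma multilinear_on_0 [simp]: "multilinear_on 0 X Y A \<longleftrightarrow> A [] \<in> vecs Y"
  by (simp add: multilinear_on_def)

lemma multilinear_on_mem:
  "multilinear_on n X Y A \<Longrightarrow> length xs = n \<Longrightarrow> set xs \<subseteq> vecs X \<Longrightarrow> A xs \<in> vecs Y"
  by (simp add: multilinear_on_def)

text \<open>Splitting off the first slot turns statements about tuples into inductions on the
  degree.\<close>

lemma multilinear_on_Suc:
  "multilinear_on (Suc n) X Y A \<longleftrightarrow>
    (\<forall>a\<in>vecs X. multilinear_on n X Y (\<lambda>r. A (a # r))) \<and>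
    (\<forall>r. length r = n \<and> set r \<subseteq> vecs X \<longrightarrow>
      (\<forall>a\<in>vecs X. (\<forall>b\<in>vecs X. A ((a + b) # r) = A (a # r) + A (b # r)) \<and>
        (\<forall>c. A (scl X c a # r) = scl Y c (A (a # r)))))" (is "?L \<longleftrightarrow> ?M \<and> ?H")
proof (intro iffI conjI)
  assume L: ?L
  show ?M unfolding multilinear_on_def
  proof (intro ballI allI impI, elim conjE)
    fix a r assume "a \<in> vecs X" "length r = n" "set r \<subseteq> vecs X"
    then have ar: "length (a # r) = Suc n" "set (a # r) \<subseteq> vecs X" by auto
    note D = L[unfolded multilinear_on_def, rule_format, OF conjI, OF ar]
    show "A (a # r) \<in> vecs Y \<and> (\<forall>i<n. \<forall>b\<in>vecs X.
        (\<forall>c\<in>vecs X. A (a # r[i := b + c]) = A (a # r[i := b]) + A (a # r[i := c])) \<and>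
        (\<forall>c. A (a # r[i := scl X c b]) = scl Y c (A (a # r[i := b]))))"
    proof (intro conjI allI impI ballI)
      show "A (a # r) \<in> vecs Y" using D by blast
    next
      fix i b c assume "i < n" "b \<in> vecs X" "c \<in> vecs X"
      then show "A (a # r[i := b + c]) = A (a # r[i := b]) + A (a # r[i := c])"
        using conjunct2[OF D, rule_format, of "Suc i" b] by auto
    next
      fix i b c assume "i < n" "b \<in> vecs X"
      then show "A (a # r[i := scl X c b]) = scl Y c (A (a # r[i := b]))"
        using conjunct2[OF D, rule_format, of "Suc i" b] by auto
    qed
  qed
  show ?H
  proof (intro allI impI ballI, elim conjE)
    fix a r assume r: "length r = n" "set r \<subseteq> vecs X" and a: "a \<in> vecs X"
    then have ar: "length (a # r) = Suc n" "set (a # r) \<subseteq> vecs X" by auto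
    note D = L[unfolded multilinear_on_def, rule_format, OF conjI, OF ar]
    show "(\<forall>b\<in>vecs X. A ((a + b) # r) = A (a # r) + A (b # r)) \<and>
        (\<forall>c. A (scl X c a # r) = scl Y c (A (a # r)))"
      using conjunct2[OF D, rule_format, of 0 a] a by auto
  qed
next
  assume MH: "?M \<and> ?H"
  show ?L unfolding multilinear_on_def
  proof (intro allI impI, elim conjE)
    fix xs assume xs: "length xs = Suc n" "set xs \<subseteq> vecs X"
    then obtain a r where ar: "xs = a # r" "a \<in> vecs X" "length r = n" "set r \<subseteq> vecs X"
      by (cases xs) auto
    have M: "multilinear_on n X Y (\<lambda>r. A (a # r))" using MH ar by blast
    have D: "A (a # r) \<in> vecs Y \<and> (\<forall>i<n. \<forall>b\<in>vecs X.
        (\<forall>c\<in>vecs X. A (a # r[i := b + c]) = A (a # r[i := b]) + A (a # r[i := c])) \<and>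
        (\<forall>c. A (a # r[i := scl X c b]) = scl Y c (A (a # r[i := b]))))"
      using M ar unfolding multilinear_on_def by blast
    show "A xs \<in> vecs Y \<and> (\<forall>i<Suc n. \<forall>b\<in>vecs X.
        (\<forall>c\<in>vecs X. A (xs[i := b + c]) = A (xs[i := b]) + A (xs[i := c])) \<and>
        (\<forall>c. A (xs[i := scl X c b]) = scl Y c (A (xs[i := b]))))"
    proof (intro conjI allI impI)
      show "A xs \<in> vecs Y" using D ar by blast
    next
      fix i assume "i < Suc n"
      then show "\<forall>b\<in>vecs X. (\<forall>c\<in>vecs X. A (xs[i := b + c]) = A (xs[i := b]) + A (xs[i := c])) \<and>
        (\<forall>c. A (xs[i := scl X c b]) = scl Y c (A (xs[i := b])))"
        using D MH ar by (cases i) auto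
    qed
  qed
qed

lemma multilinear_on_Cons:
  assumes "multilinear_on (Suc n) X Y A"
  shows "a \<in> vecs X \<Longrightarrow> multilinear_on n X Y (\<lambda>r. A (a # r))"
    and "a \<in> vecs X \<Longrightarrow> b \<in> vecs X \<Longrightarrow> length r = n \<Longrightarrow> set r \<subseteq> vecs X \<Longrightarrow>
      A ((a + b) # r) = A (a # r) + A (b # r)"
    and "a \<in> vecs X \<Longrightarrow> length r = n \<Longrightarrow> set r \<subseteq> vecs X \<Longrightarrow> A (scl X c a # r) = scl Y c (A (a # r))"
  using assms unfolding multilinear_on_Suc by blast+

lemma set_replicate_subset: "x \<in> V \<Longrightarrow> set (replicate n x) \<subseteq> V"
  by auto

text \<open>
  The sum of \<^term>\<open>A r\<close> over all lists \<^term>\<open>r\<close> obtained from \<^term>\<open>zs\<close>, of length \<^term>\<open>k\<close>, by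
  inserting \<^term>\<open>i\<close> copies of \<^term>\<open>e\<close>; the coefficients of \<open>t \<mapsto> A (t e + z, \<dots>, t e + z)\<close>.
\<close>

fun shuf :: "'v \<Rightarrow> nat \<Rightarrow> nat \<Rightarrow> ('v list \<Rightarrow> 'w::ab_group_add) \<Rightarrow> 'v list \<Rightarrow> 'w" where
  "shuf e 0 k A zs = A zs"
| "shuf e (Suc i) 0 A zs = A (replicate (Suc i) e)"
| "shuf e (Suc i) (Suc k) A zs =
    shuf e i (Suc k) (\<lambda>r. A (e # r)) zs + shuf e (Suc i) k (\<lambda>r. A (hd zs # r)) (tl zs)"

text \<open>Multilinearity is known only for tuples from the carrier, so rewriting under
  \<open>shuf\<close> must be restricted to lists of the right length over it.\<close>

lemma shuf_cong:
  assumes "\<And>r. length r = i + k \<Longrightarrow> set r \<subseteq> V \<Longrightarrow> A r = B r"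
    and "e \<in> V" "set zs \<subseteq> V" "length zs = k"
  shows "shuf e i k A zs = shuf e i k B zs"
  using assms
proof (induction i arbitrary: A B k zs)
  case (Suc i)
  note IH1 = Suc.IH
  show ?case using Suc.prems
  proof (induction k arbitrary: A B zs)
    case 0
    have "A (replicate (Suc i) e) = B (replicate (Suc i) e)"
      using 0 by (intro 0(1)) auto
    then show ?case by simp
  next
    case (Suc k)
    from Suc.prems(3,4) obtain z zs' where zs: "zs = z # zs'" by (cases zs) auto
    have "shuf e i (Suc k) (\<lambda>r. A (e # r)) zs = shuf e i (Suc k) (\<lambda>r. B (e # r)) zs"
      by (rule IH1) (use Suc.prems in auto)
    moreover have "shuf e (Suc i) k (\<lambda>r. A (z # r)) zs' = shuf e (Suc i) k (\<lambda>r. B (z # r)) zs'"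
      by (rule Suc.IH) (use Suc.prems zs in auto)
    ultimately show ?case by (simp add: zs)
  qed
qed auto

lemma shuf_add:
  fixes A B :: "'v list \<Rightarrow> 'w::ab_group_add"
  shows "shuf e i k (\<lambda>r. A r + B r) zs = shuf e i k A zs + shuf e i k B zs"
proof (induction e i k A zs arbitrary: B rule: shuf.induct)
  case (3 e i k A zs)
  have swap: "(a + b) + (c + d) = (a + c) + (b + d)" for a b c d :: 'w
    by simp
  show ?case
    unfolding shuf.simps "3.IH"(1)[of "\<lambda>r. B (e # r)"] "3.IH"(2)[of "\<lambda>r. B (hd zs # r)"]
    by (rule swap)
qed simp_all

locale normed_pair = X: normed_on X + Y: normed_on Y
  for X :: "('k::real_or_complex, 'v::ab_group_add) nspace"
    and Y :: "('k, 'w::ab_group_add) nspace"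
begin

lemma multilinear_on_add:
  "multilinear_on n X Y A \<Longrightarrow> multilinear_on n X Y B \<Longrightarrow> multilinear_on n X Y (\<lambda>xs. A xs + B xs)"
  by (induction n arbitrary: A B) (simp_all add: multilinear_on_Suc Y.scale_right_distrib)

lemma multilinear_on_scl:
  "multilinear_on n X Y A \<Longrightarrow> multilinear_on n X Y (\<lambda>xs. scl Y c (A xs))"
  by (induction n arbitrary: A) (simp_all add: multilinear_on_Suc Y.scale_right_distrib mult.commute)

lemma multilinear_on_zero: "multilinear_on n X Y (\<lambda>_. 0)"
  by (induction n) (simp_all add: multilinear_on_Suc)

lemma multilinear_on_limit:
  assumes "\<And>m. multilinear_on n X Y (A m)" "F \<noteq> bot"
    "\<And>xs. length xs = n \<Longrightarrow> set xs \<subseteq> vecs X \<Longrightarrow> B xs \<in> vecs Y \<and> Y.nlim (\<lambda>m. A m xs) (B xs) F"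
  shows "multilinear_on n X Y B"
  using assms(1,3)
proof (induction n arbitrary: A B)
  case (Suc n)
  show ?case unfolding multilinear_on_Suc
  proof (intro conjI ballI allI impI)
    fix a assume "a \<in> vecs X"
    then show "multilinear_on n X Y (\<lambda>r. B (a # r))"
      apply -
      apply (rule Suc.IH[of "\<lambda>m r. A m (a # r)"])
      using Suc.prems(2) by (auto intro: multilinear_on_Cons(1)[OF Suc.prems(1)])
  next
    fix r a b assume r: "length r = n \<and> set r \<subseteq> vecs X" and ab: "a \<in> vecs X" "b \<in> vecs X"
    have *: "B (a # r) \<in> vecs Y \<and> Y.nlim (\<lambda>m. A m (a # r)) (B (a # r)) F"
      "B (b # r) \<in> vecs Y \<and> Y.nlim (\<lambda>m. A m (b # r)) (B (b # r)) F"
      "B ((a + b) # r) \<in> vecs Y \<and> Y.nlim (\<lambda>m. A m ((a + b) # r)) (B ((a + b) # r)) F"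
      using r ab by (intro Suc.prems(2); simp)+
    have mem: "A m (a # r) \<in> vecs Y" "A m (b # r) \<in> vecs Y" for m
      using r ab by (auto intro!: multilinear_on_mem[OF Suc.prems(1)])
    have "A m ((a + b) # r) = A m (a # r) + A m (b # r)" for m
      using r ab by (intro multilinear_on_Cons(2)[OF Suc.prems(1)]) auto
    then have "Y.nlim (\<lambda>m. A m (a # r) + A m (b # r)) (B ((a + b) # r)) F"
      using * by simp
    moreover have "Y.nlim (\<lambda>m. A m (a # r) + A m (b # r)) (B (a # r) + B (b # r)) F"
      using * mem by (intro Y.nlim_add) auto
    ultimately show "B ((a + b) # r) = B (a # r) + B (b # r)"
      using * mem assms(2) by (intro Y.nlim_unique) auto
  next
    fix r a c assume r: "length r = n \<and> set r \<subseteq> vecs X" and ab: "a \<in> vecs X"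
    have *: "B (a # r) \<in> vecs Y \<and> Y.nlim (\<lambda>m. A m (a # r)) (B (a # r)) F"
      "B (scl X c a # r) \<in> vecs Y \<and> Y.nlim (\<lambda>m. A m (scl X c a # r)) (B (scl X c a # r)) F"
      using r ab by (intro Suc.prems(2); simp)+
    have mem: "A m (a # r) \<in> vecs Y" for m
      using r ab by (auto intro!: multilinear_on_mem[OF Suc.prems(1)])
    have "A m (scl X c a # r) = scl Y c (A m (a # r))" for m
      using r ab by (intro multilinear_on_Cons(3)[OF Suc.prems(1)]) auto
    then have "Y.nlim (\<lambda>m. scl Y c (A m (a # r))) (B (scl X c a # r)) F"
      using * by simp
    moreover have "Y.nlim (\<lambda>m. scl Y c (A m (a # r))) (scl Y c (B (a # r))) F"
      using * mem by (intro Y.nlim_scl) auto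
    ultimately show "B (scl X c a # r) = scl Y c (B (a # r))"
      using * mem assms(2) by (intro Y.nlim_unique) auto
  qed
qed auto

lemma shuf_scl: "shuf e i k (\<lambda>r. scl Y c (A r)) zs = scl Y c (shuf e i k A zs)"
  by (induction e i k A zs rule: shuf.induct) (simp_all add: Y.scale_right_distrib)

lemma multilinear_on_shuf:
  assumes "multilinear_on (i + k) X Y A" "e \<in> vecs X"
  shows "multilinear_on k X Y (shuf e i k A)"
  using assms
proof (induction i arbitrary: A k)
  case 0
  then show ?case by (simp add: shuf.simps(1)[abs_def])
next
  case (Suc i)
  note IH1 = Suc.IH
  show ?case using Suc.prems
  proof (induction k arbitrary: A)
    case 0
    then show ?case
      using multilinear_on_mem[of "Suc i" X Y A "replicate (Suc i) e"] set_replicate_subset[of e]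
      by (auto simp del: replicate_Suc)
  next
    case (Suc k)
    have 1: "multilinear_on (Suc k) X Y (shuf e i (Suc k) (\<lambda>r. A (e # r)))"
      using Suc.prems(2) multilinear_on_Cons(1)[of "i + Suc k"] Suc.prems(1) by (rule_tac IH1) auto
    have 2: "multilinear_on (Suc k) X Y (\<lambda>zs. shuf e (Suc i) k (\<lambda>r. A (hd zs # r)) (tl zs))"
      unfolding multilinear_on_Suc list.sel
    proof (intro conjI ballI allI impI)
      fix a assume "a \<in> vecs X"
      then show "multilinear_on k X Y (shuf e (Suc i) k (\<lambda>r. A (a # r)))"
        using Suc.prems(2) multilinear_on_Cons(1)[of "Suc i + k"] Suc.prems(1) by (rule_tac Suc.IH) auto
    next
      fix r a b assume r: "length r = k \<and> set r \<subseteq> vecs X" and ab: "a \<in> vecs X" "b \<in> vecs X"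
      have "shuf e (Suc i) k (\<lambda>r. A ((a + b) # r)) r = shuf e (Suc i) k (\<lambda>r. A (a # r) + A (b # r)) r"
        using r ab Suc.prems
        by (intro shuf_cong[where V = "vecs X"] multilinear_on_Cons(2)) auto
      then show "shuf e (Suc i) k (\<lambda>r. A ((a + b) # r)) r =
          shuf e (Suc i) k (\<lambda>r. A (a # r)) r + shuf e (Suc i) k (\<lambda>r. A (b # r)) r"
        by (simp only: shuf_add)
    next
      fix r a c assume r: "length r = k \<and> set r \<subseteq> vecs X" and ab: "a \<in> vecs X"
      have "shuf e (Suc i) k (\<lambda>r. A (scl X c a # r)) r = shuf e (Suc i) k (\<lambda>r. scl Y c (A (a # r))) r"
        using r ab Suc.prems
        by (intro shuf_cong[where V = "vecs X"] multilinear_on_Cons(3)) auto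
      then show "shuf e (Suc i) k (\<lambda>r. A (scl X c a # r)) r = scl Y c (shuf e (Suc i) k (\<lambda>r. A (a # r)) r)"
        by (simp only: shuf_scl)
    qed
    have "shuf e (Suc i) (Suc k) A =
        (\<lambda>zs. shuf e i (Suc k) (\<lambda>r. A (e # r)) zs + shuf e (Suc i) k (\<lambda>r. A (hd zs # r)) (tl zs))"
      by (simp add: fun_eq_iff)
    then show ?case using multilinear_on_add[OF 1 2] by simp
  qed
qed

text \<open>Each summand contains the inserted vector exactly once and is therefore linear in
  it.\<close>

lemma shuf_1_add:
  assumes "multilinear_on (Suc k) X Y A" "e \<in> vecs X" "f \<in> vecs X" "length zs = k" "set zs \<subseteq> vecs X"
  shows "shuf (e + f) 1 k A zs = shuf e 1 k A zs + shuf f 1 k A zs"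
  using assms
proof (induction k arbitrary: A zs)
  case 0
  then show ?case using multilinear_on_Cons(2)[OF 0(1), of e f "[]"] by simp
next
  case (Suc k)
  then obtain z r where zs: "zs = z # r" "length r = k" "set r \<subseteq> vecs X" "z \<in> vecs X"
    by (cases zs) auto
  have "shuf (e + f) 1 k (\<lambda>r. A (z # r)) r = shuf e 1 k (\<lambda>r. A (z # r)) r + shuf f 1 k (\<lambda>r. A (z # r)) r"
    using Suc.prems(2-) zs multilinear_on_Cons(1)[OF Suc.prems(1)] by (rule_tac Suc.IH) auto
  moreover have "A ((e + f) # zs) = A (e # zs) + A (f # zs)"
    using Suc.prems by (intro multilinear_on_Cons(2)[OF Suc.prems(1)]) auto
  ultimately show ?case by (simp add: zs)
qed

lemma shuf_1_scl:
  assumes "multilinear_on (Suc k) X Y A" "e \<in> vecs X" "length zs = k" "set zs \<subseteq> vecs X"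
  shows "shuf (scl X c e) 1 k A zs = scl Y c (shuf e 1 k A zs)"
  using assms
proof (induction k arbitrary: A zs)
  case 0
  then show ?case using multilinear_on_Cons(3)[OF 0(1), of e "[]"] by simp
next
  case (Suc k)
  then obtain z r where zs: "zs = z # r" "length r = k" "set r \<subseteq> vecs X" "z \<in> vecs X"
    by (cases zs) auto
  have "shuf (scl X c e) 1 k (\<lambda>r. A (z # r)) r = scl Y c (shuf e 1 k (\<lambda>r. A (z # r)) r)"
    using Suc.prems(2-) zs multilinear_on_Cons(1)[OF Suc.prems(1)] by (rule_tac Suc.IH) auto
  moreover have "A (scl X c e # zs) = scl Y c (A (e # zs))"
    using Suc.prems by (intro multilinear_on_Cons(3)[OF Suc.prems(1)]) auto
  ultimately show ?case by (simp add: zs Y.scale_right_distrib)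
qed

text \<open>There are k + 1 places for one more \<open>x\<close> among k copies; this is the factor
  that \<open>slot_deriv\<close> divides out.\<close>

lemma shuf_1_diagonal: "shuf x 1 k A (replicate k x) = scl Y (of_nat (Suc k)) (A (replicate (Suc k) x))"
proof (induction k arbitrary: A)
  case (Suc k)
  have "scl Y 2 v = v + v" for v
    by (metis Y.scale_left_distrib Y.scale_one one_add_one)
  with Suc show ?case by (simp add: Y.scale_left_distrib)
qed simp

text \<open>The binomial formula for a map that need not be symmetric: the words in \<open>e\<close>
  and \<open>z\<close> are grouped by the number of letters \<open>e\<close> and remain otherwise in
  their order.\<close>

lemma multilinear_on_expand:
  assumes "multilinear_on n X Y A" "e \<in> vecs X" "z \<in> vecs X"
  shows "A (replicate n (scl X t e + z)) =
    (\<Sum>i\<le>n. scl Y (t ^ i) (shuf e i (n - i) A (replicate (n - i) z)))"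
  using assms
proof (induction n arbitrary: A)
  case (Suc n)
  let ?R = "replicate n (scl X t e + z)"
  define a where "a i = shuf e i (n - i) (\<lambda>r. A (e # r)) (replicate (n - i) z)" for i
  define b where "b i = shuf e i (n - i) (\<lambda>r. A (z # r)) (replicate (n - i) z)" for i
  define T where "T i = shuf e i (Suc n - i) A (replicate (Suc n - i) z)" for i
  have R: "length ?R = n" "set ?R \<subseteq> vecs X" using Suc.prems by auto
  have "A ((scl X t e + z) # ?R) = scl Y t (A (e # ?R)) + A (z # ?R)"
    using Suc.prems R by (simp add: multilinear_on_Cons(2,3)[OF Suc.prems(1)])
  also have "A (e # ?R) = (\<Sum>i\<le>n. scl Y (t ^ i) (a i))"
    unfolding a_def using Suc.prems(2-) multilinear_on_Cons(1)[OF Suc.prems(1)] by (rule_tac Suc.IH) auto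
  also have "A (z # ?R) = (\<Sum>i\<le>n. scl Y (t ^ i) (b i))"
    unfolding b_def using Suc.prems(2-) multilinear_on_Cons(1)[OF Suc.prems(1)] by (rule_tac Suc.IH) auto
  finally have L: "A (replicate (Suc n) (scl X t e + z)) =
      (\<Sum>i\<le>n. scl Y (t ^ Suc i) (a i)) + (\<Sum>i\<le>n. scl Y (t ^ i) (b i))"
    by (simp add: Y.scale_sum_right)
  have T0: "T 0 = b 0" by (simp add: T_def b_def)
  \<comment> \<open>Pascal's rule: a word starts with \<open>e\<close>, counted by \<open>a\<close>,
    or with \<open>z\<close>, counted by \<open>b\<close>. If all n + 1 letters are
    \<open>e\<close>, the second kind is absent.\<close>
  have TS: "T (Suc i) = a i + (if i < n then b (Suc i) else 0)" if "i \<le> n" for i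
  proof (cases "i < n")
    case True
    then obtain l where l: "n - i = Suc l" "n - Suc i = l"
      by (metis Suc_diff_Suc)
    then show ?thesis using True by (simp add: T_def a_def b_def)
  next
    case False
    with that have "i = n" by simp
    then show ?thesis by (cases n) (simp_all add: T_def a_def)
  qed
  have "(\<Sum>i\<le>Suc n. scl Y (t ^ i) (T i)) = scl Y (t ^ 0) (T 0) + (\<Sum>i\<le>n. scl Y (t ^ Suc i) (T (Suc i)))"
    by (rule sum.atMost_Suc_shift)
  also have "\<dots> = b 0 + (\<Sum>i\<le>n. scl Y (t ^ Suc i) (a i)) +
      (\<Sum>i\<le>n. scl Y (t ^ Suc i) (if i < n then b (Suc i) else 0))"
    by (simp add: T0 TS Y.scale_right_distrib sum.distrib)
  also have "(\<Sum>i\<le>n. scl Y (t ^ Suc i) (if i < n then b (Suc i) else 0)) = (\<Sum>i<n. scl Y (t ^ Suc i) (b (Suc i)))"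
    by (simp add: lessThan_Suc_atMost[symmetric])
  finally show ?case
    unfolding L T_def[symmetric] lessThan_Suc_atMost[symmetric]
    by (simp add: sum.lessThan_Suc_shift[of "\<lambda>i. scl Y (t ^ i) (b i)"] del: power_Suc sum.lessThan_Suc)
qed simp

end

text \<open>
  \<open>p(t) \<mapsto> p(2t) - 2\<^sup>l p(t)\<close> kills the monomial of degree \<open>l\<close>; composing such operators isolates
  one coefficient of a polynomial from its values at powers of \<open>2\<close>.
\<close>

lemma ex_coefficient_extraction:
  assumes "finite S" "m \<notin> S"
  shows "\<exists>N c. (\<Sum>i\<le>N. c i * (2 ^ i) ^ m) = (1::'k::real_or_complex) \<and>
    (\<forall>j\<in>S. (\<Sum>i\<le>N. c i * (2 ^ i) ^ j) = 0)"
  using assms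
proof (induction S)
  case empty
  show ?case by (intro exI[of _ 0] exI[of _ "\<lambda>_. 1"]) simp
next
  case (insert l S)
  then obtain N c where c: "(\<Sum>i\<le>N. c i * (2 ^ i) ^ m) = (1::'k)"
    "\<And>j. j \<in> S \<Longrightarrow> (\<Sum>i\<le>N. c i * (2 ^ i) ^ j) = 0"
    by auto
  define D where "D = (2::'k) ^ m - 2 ^ l"
  \<comment> \<open>The norm of 2 is 2 in either field, so distinct powers of 2 have distinct norms
    and \<open>D\<close> can be inverted.\<close>
  have "norm ((2::'k) ^ m) \<noteq> norm ((2::'k) ^ l)"
    using insert.prems by (auto simp: norm_power)
  then have D: "D \<noteq> 0" unfolding D_def by auto
  \<comment> \<open>The coefficients of p(2t) - \<open>2^l\<close> p(t): shifting the index replaces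
    t by 2t. Division by \<open>D\<close> restores the value 1 at the exponent m.\<close>
  define c' where "c' i = ((if i = 0 then 0 else c (i - 1)) - 2 ^ l * (if i \<le> N then c i else 0)) / D" for i
  have "(\<Sum>i\<le>Suc N. c' i * (2 ^ i) ^ j) = (2 ^ j - 2 ^ l) / D * (\<Sum>i\<le>N. c i * (2 ^ i) ^ j)" for j
  proof -
    have "(\<Sum>i\<le>Suc N. (if i = 0 then 0 else c (i - 1)) * (2 ^ i) ^ j) = (\<Sum>i\<le>N. c i * (2 ^ Suc i) ^ j)"
      by (subst sum.atMost_Suc_shift) simp
    also have "\<dots> = 2 ^ j * (\<Sum>i\<le>N. c i * (2 ^ i) ^ j)"
      by (simp add: sum_distrib_left power_mult_distrib ac_simps)
    finally have 1: "(\<Sum>i\<le>Suc N. (if i = 0 then 0 else c (i - 1)) * (2 ^ i) ^ j) = \<dots>" .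
    have 2: "(\<Sum>i\<le>Suc N. (if i \<le> N then c i else 0) * (2 ^ i) ^ j) = (\<Sum>i\<le>N. c i * (2 ^ i) ^ j)"
      by simp
    have "(\<Sum>i\<le>Suc N. c' i * (2 ^ i) ^ j) =
      ((\<Sum>i\<le>Suc N. (if i = 0 then 0 else c (i - 1)) * (2 ^ i) ^ j) -
        2 ^ l * (\<Sum>i\<le>Suc N. (if i \<le> N then c i else 0) * (2 ^ i) ^ j)) / D"
      unfolding c'_def sum_distrib_left sum_subtractf[symmetric] sum_divide_distrib
      by (intro sum.cong refl) (simp add: algebra_simps diff_divide_distrib)
    then show ?thesis unfolding 1 2 by (simp add: algebra_simps diff_divide_distrib)
  qed
  then have "(\<Sum>i\<le>Suc N. c' i * (2 ^ i) ^ m) = 1 \<and> (\<forall>j\<in>insert l S. (\<Sum>i\<le>Suc N. c' i * (2 ^ i) ^ j) = 0)"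
    using c D by (simp add: D_def)
  then show ?case by blast
qed

section \<open>Coefficients as combinations of values; polarization\<close>

context normed_pair
begin

text \<open>\<open>N\<close> and \<open>c\<close> are chosen before \<open>A\<close>,
  \<open>e\<close> and \<open>z\<close>. This uniformity carries bounds and limits over from the
  values of a polynomial to its coefficients.\<close>

lemma shuf_extract:
  assumes "m \<le> n"
  obtains N c where "\<And>A e z. multilinear_on n X Y A \<Longrightarrow> e \<in> vecs X \<Longrightarrow> z \<in> vecs X \<Longrightarrow>
    shuf e m (n - m) A (replicate (n - m) z) =
      (\<Sum>i\<le>N. scl Y (c i) (A (replicate n (scl X (2 ^ i) e + z))))"
proof -
  obtain N and c :: "nat \<Rightarrow> 'k" where c: "(\<Sum>i\<le>N. c i * (2 ^ i) ^ m) = 1"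
    "\<And>j. j \<in> {..n} - {m} \<Longrightarrow> (\<Sum>i\<le>N. c i * (2 ^ i) ^ j) = 0"
    using ex_coefficient_extraction[of "{..n} - {m}" m, where 'k = 'k] by auto
  show ?thesis
  proof
    fix A e z assume A: "multilinear_on n X Y A" "e \<in> vecs X" "z \<in> vecs X"
    let ?S = "\<lambda>j. shuf e j (n - j) A (replicate (n - j) z)"
    have "(\<Sum>i\<le>N. scl Y (c i) (A (replicate n (scl X (2 ^ i) e + z)))) =
        (\<Sum>i\<le>N. \<Sum>j\<le>n. scl Y (c i * (2 ^ i) ^ j) (?S j))"
      by (simp add: multilinear_on_expand[OF A] Y.scale_sum_right)
    also have "\<dots> = (\<Sum>j\<le>n. scl Y (\<Sum>i\<le>N. c i * (2 ^ i) ^ j) (?S j))"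
      by (subst sum.swap) (simp add: Y.scale_sum_left)
    also have "\<dots> = (\<Sum>j\<le>n. if j = m then ?S j else 0)"
      using c by (intro sum.cong) auto
    also have "\<dots> = ?S m" using assms by simp
    finally show "?S m = (\<Sum>i\<le>N. scl Y (c i) (A (replicate n (scl X (2 ^ i) e + z))))" ..
  qed
qed

lemma multilinear_on_replicate_scl:
  "multilinear_on n X Y A \<Longrightarrow> x \<in> vecs X \<Longrightarrow> A (replicate n (scl X t x)) = scl Y (t ^ n) (A (replicate n x))"
proof (induction n arbitrary: A)
  case (Suc n)
  have "A (scl X t x # replicate n (scl X t x)) = scl Y t (A (x # replicate n (scl X t x)))"
    using Suc.prems by (intro multilinear_on_Cons(3)[OF Suc.prems(1)]) auto
  also have "A (x # replicate n (scl X t x)) = scl Y (t ^ n) (A (x # replicate n x))"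
    using Suc.prems(2) multilinear_on_Cons(1)[OF Suc.prems(1)] by (rule_tac Suc.IH) auto
  finally show ?case by simp
qed simp

lemma homogeneous_poly_mem: "homogeneous_poly n X Y P \<Longrightarrow> x \<in> vecs X \<Longrightarrow> P x \<in> vecs Y"
  unfolding homogeneous_poly_def by (metis length_replicate multilinear_on_mem set_replicate_subset)

lemma homogeneous_poly_scl:
  "homogeneous_poly n X Y P \<Longrightarrow> x \<in> vecs X \<Longrightarrow> P (scl X t x) = scl Y (t ^ n) (P x)"
  unfolding homogeneous_poly_def using multilinear_on_replicate_scl X.scl_vecs by metis

lemma homogeneous_poly_add:
  assumes "homogeneous_poly n X Y P" "homogeneous_poly n X Y Q"
  shows "homogeneous_poly n X Y (\<lambda>x. P x + Q x)"
proof -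
  obtain A B where "multilinear_on n X Y A" "multilinear_on n X Y B"
    "\<forall>x\<in>vecs X. P x = A (replicate n x)" "\<forall>x\<in>vecs X. Q x = B (replicate n x)"
    using assms unfolding homogeneous_poly_def by blast
  then show ?thesis unfolding homogeneous_poly_def
    by (intro exI[of _ "\<lambda>xs. A xs + B xs"]) (simp add: multilinear_on_add)
qed

lemma homogeneous_poly_scale:
  assumes "homogeneous_poly n X Y P"
  shows "homogeneous_poly n X Y (\<lambda>x. scl Y c (P x))"
proof -
  obtain A where "multilinear_on n X Y A" "\<forall>x\<in>vecs X. P x = A (replicate n x)"
    using assms unfolding homogeneous_poly_def by blast
  then show ?thesis unfolding homogeneous_poly_def
    by (intro exI[of _ "\<lambda>xs. scl Y c (A xs)"]) (simp add: multilinear_on_scl)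
qed

lemma homogeneous_poly_zero: "homogeneous_poly n X Y (\<lambda>_. 0)"
  unfolding homogeneous_poly_def using multilinear_on_zero by blast

lemma homogeneous_poly_cong:
  "homogeneous_poly n X Y P \<Longrightarrow> (\<And>x. x \<in> vecs X \<Longrightarrow> P x = Q x) \<Longrightarrow> homogeneous_poly n X Y Q"
  unfolding homogeneous_poly_def by auto

text \<open>The third property records that each coefficient is a combination of finitely many
  translates of \<open>P\<close>; boundedness of the coefficients on the unit ball is read off from
  it.\<close>

lemma homogeneous_poly_expand:
  assumes "homogeneous_poly n X Y P" "e \<in> vecs X"
  obtains R where "\<And>i. i \<le> n \<Longrightarrow> homogeneous_poly (n - i) X Y (R i)"
    "\<And>t z. z \<in> vecs X \<Longrightarrow> P (scl X t e + z) = (\<Sum>i\<le>n. scl Y (t ^ i) (R i z))"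
    "\<And>i. i \<le> n \<Longrightarrow> \<exists>N c. \<forall>z\<in>vecs X. R i z = (\<Sum>j\<le>N. scl Y (c j) (P (scl X (2 ^ j) e + z)))"
    "\<And>z. z \<in> vecs X \<Longrightarrow> R 0 z = P z"
proof -
  obtain A where A: "multilinear_on n X Y A" "\<forall>x\<in>vecs X. P x = A (replicate n x)"
    using assms unfolding homogeneous_poly_def by blast
  let ?R = "\<lambda>i z. shuf e i (n - i) A (replicate (n - i) z)"
  show ?thesis
  proof (rule that[of ?R])
    show "homogeneous_poly (n - i) X Y (?R i)" if "i \<le> n" for i
      unfolding homogeneous_poly_def
    proof (intro exI conjI ballI)
      show "multilinear_on (n - i) X Y (shuf e i (n - i) A)"
        using multilinear_on_shuf[of i "n - i" A e] A(1) that assms(2) by simp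
    qed (rule refl)
    show "P (scl X t e + z) = (\<Sum>i\<le>n. scl Y (t ^ i) (?R i z))" if "z \<in> vecs X" for t z
      using A assms that multilinear_on_expand[OF A(1)] by simp
    show "\<exists>N c. \<forall>z\<in>vecs X. ?R i z = (\<Sum>j\<le>N. scl Y (c j) (P (scl X (2 ^ j) e + z)))" if i: "i \<le> n" for i
    proof -
      obtain N c where "\<And>A e z. multilinear_on n X Y A \<Longrightarrow> e \<in> vecs X \<Longrightarrow> z \<in> vecs X \<Longrightarrow>
          shuf e i (n - i) A (replicate (n - i) z) =
          (\<Sum>j\<le>N. scl Y (c j) (A (replicate n (scl X (2 ^ j) e + z))))"
        by (rule shuf_extract[OF i]) (rule that)
      then have "\<forall>z\<in>vecs X. ?R i z = (\<Sum>j\<le>N. scl Y (c j) (P (scl X (2 ^ j) e + z)))"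
        using A assms(2) by simp
      then show ?thesis by blast
    qed
    show "?R 0 z = P z" if "z \<in> vecs X" for z using A that by simp
  qed
qed

text \<open>
  The symmetric multilinear map of a homogeneous polynomial, written as a finite combination of
  values of the polynomial: one slot at a time, the linear coefficient in that slot is extracted.
  Unlike an arbitrary multilinear map representing the polynomial, it depends continuously on it.
\<close>

definition is_extraction :: "nat \<Rightarrow> nat \<times> (nat \<Rightarrow> 'k) \<Rightarrow> bool" where
  "is_extraction n Nc \<longleftrightarrow> (\<forall>A e z. multilinear_on (Suc n) X Y A \<longrightarrow> e \<in> vecs X \<longrightarrow> z \<in> vecs X \<longrightarrow>
    shuf e 1 n A (replicate n z) =
      (\<Sum>i\<le>fst Nc. scl Y (snd Nc i) (A (replicate (Suc n) (scl X (2 ^ i) e + z)))))"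

definition extraction :: "nat \<Rightarrow> nat \<times> (nat \<Rightarrow> 'k)" where
  "extraction n = (SOME Nc. is_extraction n Nc)"

lemma is_extraction_extraction: "is_extraction n (extraction n)"
proof -
  obtain N c where "\<And>A e z. multilinear_on (Suc n) X Y A \<Longrightarrow> e \<in> vecs X \<Longrightarrow> z \<in> vecs X \<Longrightarrow>
    shuf e 1 (Suc n - 1) A (replicate (Suc n - 1) z) =
      (\<Sum>i\<le>N. scl Y (c i) (A (replicate (Suc n) (scl X (2 ^ i) e + z))))"
    by (rule shuf_extract[of 1 "Suc n"], simp) (rule that)
  then have "is_extraction n (N, c)"
    unfolding is_extraction_def by simp
  then show ?thesis unfolding extraction_def by (rule someI)
qed

text \<open>For a polynomial of degree n + 1 this is its derivative at \<open>z\<close> in the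
  direction \<open>e\<close>, divided by n + 1: the symmetric multilinear map with \<open>e\<close>
  in one slot and \<open>z\<close> in the n others.\<close>

definition slot_deriv :: "nat \<Rightarrow> ('v \<Rightarrow> 'w) \<Rightarrow> 'v \<Rightarrow> 'v \<Rightarrow> 'w" where
  "slot_deriv n P e z = (\<Sum>i\<le>fst (extraction n).
     scl Y (snd (extraction n) i / of_nat (Suc n)) (P (scl X (2 ^ i) e + z)))"

primrec polar :: "nat \<Rightarrow> ('v \<Rightarrow> 'w) \<Rightarrow> 'v list \<Rightarrow> 'w" where
  "polar 0 P xs = P 0"
| "polar (Suc n) P xs = polar n (slot_deriv n P (hd xs)) (tl xs)"

lemma slot_deriv_eq:
  assumes "multilinear_on (Suc n) X Y A" "\<And>x. x \<in> vecs X \<Longrightarrow> P x = A (replicate (Suc n) x)"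
    "e \<in> vecs X" "z \<in> vecs X"
  shows "slot_deriv n P e z = scl Y (1 / of_nat (Suc n)) (shuf e 1 n A (replicate n z))"
proof -
  have "shuf e 1 n A (replicate n z) = (\<Sum>i\<le>fst (extraction n).
      scl Y (snd (extraction n) i) (A (replicate (Suc n) (scl X (2 ^ i) e + z))))"
    using is_extraction_extraction assms unfolding is_extraction_def by blast
  then show ?thesis
    using assms by (simp add: slot_deriv_def Y.scale_sum_right)
qed

lemma polar_cong:
  assumes "\<And>x. x \<in> vecs X \<Longrightarrow> P x = Q x" "set xs \<subseteq> vecs X" "length xs = n"
  shows "polar n P xs = polar n Q xs"
  using assms
proof (induction n arbitrary: P Q xs)
  case (Suc n)
  then obtain a r where xs: "xs = a # r" by (cases xs) auto
  show ?case unfolding polar.simps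
  proof (rule Suc.IH)
    show "slot_deriv n P (hd xs) x = slot_deriv n Q (hd xs) x" if "x \<in> vecs X" for x
      using Suc.prems that xs by (simp add: slot_deriv_def)
  qed (use Suc.prems xs in auto)
qed simp

lemma polar_add: "polar n (\<lambda>x. P x + Q x) xs = polar n P xs + polar n Q xs"
proof (induction n arbitrary: P Q xs)
  case (Suc n)
  have "slot_deriv n (\<lambda>x. P x + Q x) e = (\<lambda>x. slot_deriv n P e x + slot_deriv n Q e x)" for e
    by (simp add: slot_deriv_def fun_eq_iff Y.scale_right_distrib sum.distrib)
  then show ?case by (simp add: Suc.IH)
qed simp

lemma polar_scl: "polar n (\<lambda>x. scl Y c (P x)) xs = scl Y c (polar n P xs)"
proof (induction n arbitrary: P xs)
  case (Suc n)
  have "slot_deriv n (\<lambda>x. scl Y c (P x)) e = (\<lambda>x. scl Y c (slot_deriv n P e x))" for e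
    by (simp add: slot_deriv_def fun_eq_iff Y.scale_sum_right mult.commute)
  then show ?case by (simp add: Suc.IH)
qed simp

text \<open>The slot derivative is linear in its direction, because one copy is inserted, and
  homogeneous of degree n in the other variable, so the induction handles the remaining slots. On
  the diagonal the factor n + 1 cancels.\<close>

lemma polar:
  assumes "homogeneous_poly n X Y P"
  shows "multilinear_on n X Y (polar n P) \<and> (\<forall>x\<in>vecs X. polar n P (replicate n x) = P x)"
  using assms
proof (induction n arbitrary: P)
  case 0
  then show ?case using homogeneous_poly_mem[of 0 P 0] unfolding homogeneous_poly_def by auto
next
  case (Suc n)
  then obtain A where A: "multilinear_on (Suc n) X Y A" "\<And>x. x \<in> vecs X \<Longrightarrow> P x = A (replicate (Suc n) x)"
    unfolding homogeneous_poly_def by blast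
  have D: "slot_deriv n P e z = scl Y (1 / of_nat (Suc n)) (shuf e 1 n A (replicate n z))"
    if "e \<in> vecs X" "z \<in> vecs X" for e z
    by (rule slot_deriv_eq[OF A that])
  have hom: "homogeneous_poly n X Y (slot_deriv n P e)" if "e \<in> vecs X" for e
    unfolding homogeneous_poly_def
  proof (intro exI conjI ballI)
    show "multilinear_on n X Y (\<lambda>zs. scl Y (1 / of_nat (Suc n)) (shuf e 1 n A zs))"
      using multilinear_on_shuf[of 1 n A e] A(1) that by (intro multilinear_on_scl) simp
  qed (use D that in auto)
  have "multilinear_on (Suc n) X Y (polar (Suc n) P)"
    unfolding multilinear_on_Suc polar.simps list.sel
  proof (intro conjI ballI allI impI)
    fix a assume "a \<in> vecs X"
    then show "multilinear_on n X Y (polar n (slot_deriv n P a))"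
      using Suc.IH hom by blast
  next
    fix r a b assume r: "length r = n \<and> set r \<subseteq> vecs X" and ab: "a \<in> vecs X" "b \<in> vecs X"
    have "polar n (slot_deriv n P (a + b)) r = polar n (\<lambda>x. slot_deriv n P a x + slot_deriv n P b x) r"
    proof (rule polar_cong)
      fix x assume x: "x \<in> vecs X"
      then have "shuf (a + b) 1 n A (replicate n x) = shuf a 1 n A (replicate n x) + shuf b 1 n A (replicate n x)"
        using ab by (intro shuf_1_add[OF A(1)]) auto
      then show "slot_deriv n P (a + b) x = slot_deriv n P a x + slot_deriv n P b x"
        using ab x by (simp only: D X.add_vecs Y.scale_right_distrib)
    qed (use r in auto)
    then show "polar n (slot_deriv n P (a + b)) r = polar n (slot_deriv n P a) r + polar n (slot_deriv n P b) r"
      by (simp only: polar_add)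
  next
    fix r a c assume r: "length r = n \<and> set r \<subseteq> vecs X" and ab: "a \<in> vecs X"
    have "polar n (slot_deriv n P (scl X c a)) r = polar n (\<lambda>x. scl Y c (slot_deriv n P a x)) r"
    proof (rule polar_cong)
      fix x assume x: "x \<in> vecs X"
      then have "shuf (scl X c a) 1 n A (replicate n x) = scl Y c (shuf a 1 n A (replicate n x))"
        using ab by (intro shuf_1_scl[OF A(1)]) auto
      then show "slot_deriv n P (scl X c a) x = scl Y c (slot_deriv n P a x)"
        using ab x by (simp only: D X.scl_vecs Y.scale_scale mult.commute)
    qed (use r in auto)
    then show "polar n (slot_deriv n P (scl X c a)) r = scl Y c (polar n (slot_deriv n P a) r)"
      by (simp only: polar_scl)
  qed
  moreover have "polar (Suc n) P (replicate (Suc n) x) = P x" if x: "x \<in> vecs X" for x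
  proof -
    have "polar (Suc n) P (replicate (Suc n) x) = slot_deriv n P x x"
      using Suc.IH[OF hom[OF x]] x by simp
    also have "\<dots> = scl Y (1 / of_nat (Suc n)) (shuf x 1 n A (replicate n x))"
      by (rule D[OF x x])
    also have "\<dots> = P x" unfolding shuf_1_diagonal A(2)[OF x] Y.scale_scale
      using of_nat_neq_0[of n, where 'a = 'k] by simp
    finally show ?thesis .
  qed
  ultimately show ?case by blast
qed

lemma polar_limit:
  assumes "\<And>x. x \<in> vecs X \<Longrightarrow> Y.nlim (\<lambda>m. u m x) (P x) F"
    "\<And>m x. x \<in> vecs X \<Longrightarrow> u m x \<in> vecs Y" "\<And>x. x \<in> vecs X \<Longrightarrow> P x \<in> vecs Y"
    "set xs \<subseteq> vecs X" "length xs = n"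
  shows "polar n P xs \<in> vecs Y \<and> Y.nlim (\<lambda>m. polar n (u m) xs) (polar n P xs) F"
  using assms
proof (induction n arbitrary: u P xs)
  case (Suc n)
  then obtain a r where xs: "xs = a # r" "a \<in> vecs X" "set r \<subseteq> vecs X" "length r = n"
    by (cases xs) auto
  show ?case unfolding polar.simps xs list.sel
  proof (rule Suc.IH)
    fix x assume x: "x \<in> vecs X"
    show "Y.nlim (\<lambda>m. slot_deriv n (u m) a x) (slot_deriv n P a x) F"
      unfolding slot_deriv_def using Suc.prems xs x
      by (intro Y.nlim_sum Y.nlim_scl Y.scl_vecs) auto
    show "slot_deriv n P a x \<in> vecs Y" "\<And>m. slot_deriv n (u m) a x \<in> vecs Y"
      unfolding slot_deriv_def using Suc.prems xs x by auto
  qed (use xs in auto)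
qed simp

text \<open>Arbitrary multilinear maps representing the \<open>u m\<close> may fail to converge.
  Their polarizations do, being fixed finite combinations of values, and multilinearity passes to
  the limit.\<close>

lemma homogeneous_poly_limit:
  assumes "\<And>m. homogeneous_poly n X Y (u m)" "F \<noteq> bot"
    "\<And>x. x \<in> vecs X \<Longrightarrow> P x \<in> vecs Y \<and> Y.nlim (\<lambda>m. u m x) (P x) F"
  shows "homogeneous_poly n X Y P"
  unfolding homogeneous_poly_def
proof (intro exI conjI ballI)
  have mem: "u m x \<in> vecs Y" if "x \<in> vecs X" for m x
    using homogeneous_poly_mem[OF assms(1)] that by blast
  have lim: "polar n P xs \<in> vecs Y \<and> Y.nlim (\<lambda>m. polar n (u m) xs) (polar n P xs) F"
    if "length xs = n" "set xs \<subseteq> vecs X" for xs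
    using assms(3) mem that by (intro polar_limit) auto
  show "multilinear_on n X Y (polar n P)"
    by (rule multilinear_on_limit[of n "\<lambda>m. polar n (u m)" F]) (use assms(1,2) polar lim in blast)+
  fix x assume x: "x \<in> vecs X"
  have eq: "polar n (u m) (replicate n x) = u m x" for m
    using x polar[OF assms(1)] by blast
  have "Y.nlim (\<lambda>m. u m x) (polar n P (replicate n x)) F"
    using lim[of "replicate n x"] set_replicate_subset[OF x] by (simp add: eq)
  then show "P x = polar n P (replicate n x)"
    using assms(2,3) x mem lim[of "replicate n x"] set_replicate_subset[OF x] by (intro Y.nlim_unique[of "\<lambda>m. u m x" _ F]) auto
qed

end

section \<open>The normed space of polynomials\<close>

context normed_pair
begin

lemma bounded_unit_ball_pow:
  assumes "homogeneous_poly n X Y P" "\<And>x. x \<in> vecs X \<Longrightarrow> nrm X x \<le> 1 \<Longrightarrow> nrm Y (P x) \<le> C" "x \<in> vecs X"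
  shows "nrm Y (P x) \<le> C * nrm X x ^ n"
proof (cases "x = 0")
  case True
  then show ?thesis
  proof (cases "n = 0")
    case False
    have "P (scl X 0 x) = scl Y (0 ^ n) (P x)"
      using assms by (intro homogeneous_poly_scl)
    with True False show ?thesis by (simp add: power_0_left)
  qed (use True assms(2)[of 0] in simp)
next
  case False
  obtain u where u: "u \<in> vecs X" "nrm X u = 1" "scl X (of_real (nrm X x)) u = x"
    using X.normalize_nrm[OF assms(3) False] assms(3) X.scl_vecs by metis
  have "P x = scl Y (of_real (nrm X x) ^ n) (P u)"
    using homogeneous_poly_scl[OF assms(1) u(1), of "of_real (nrm X x)"] u(3) by simp
  then have "nrm Y (P x) = nrm X x ^ n * nrm Y (P u)"
    using Y.nrm_scl homogeneous_poly_mem[OF assms(1) u(1)] X.nrm_ge_0[OF assms(3)] by (simp add: norm_power)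
  then show ?thesis
    using assms(2)[of u] u X.nrm_ge_0[OF assms(3)] by (simp add: mult.commute mult_right_mono)
qed

text \<open>With y = x + t u and u a unit vector, P y - P x is a sum of positive powers of t times
  coefficients that depend on u. These are bounded uniformly in u, as combinations of values of
  \<open>P\<close> on a fixed ball, so the difference is at most t times a constant for t <
  1.\<close>

lemma bounded_imp_continuous_poly:
  assumes P: "homogeneous_poly n X Y P" and C: "\<And>x. x \<in> vecs X \<Longrightarrow> nrm X x \<le> 1 \<Longrightarrow> nrm Y (P x) \<le> C"
  shows "continuous_map (ntop X) (ntop Y) P"
  unfolding continuous_map_ntop_iff[OF X.normed_on_axioms Y.normed_on_axioms]
proof (intro conjI ballI allI impI)
  show "P ` vecs X \<subseteq> vecs Y" using homogeneous_poly_mem[OF P] by blast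
  fix x and e :: real assume x: "x \<in> vecs X" and e: "0 < e"
  obtain A where A: "multilinear_on n X Y A" "\<And>x. x \<in> vecs X \<Longrightarrow> P x = A (replicate n x)"
    using P unfolding homogeneous_poly_def by blast
  define S where "S i u = shuf u i (n - i) A (replicate (n - i) x)" for i u
  have SY: "S i u \<in> vecs Y" if "u \<in> vecs X" "i \<le> n" for i u
    unfolding S_def using multilinear_on_shuf[of i "n - i" A u] A(1) that x set_replicate_subset[OF x]
    by (intro multilinear_on_mem[of "n - i"]) auto
  have C0: "0 \<le> C" using C[of 0] Y.nrm_ge_0[OF homogeneous_poly_mem[OF P, of 0]] by simp
  have "\<exists>B. \<forall>u\<in>vecs X. nrm X u \<le> 1 \<longrightarrow> nrm Y (S i u) \<le> B" if i: "i \<le> n" for i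
  proof -
    obtain N c where Nc: "\<And>A e z. multilinear_on n X Y A \<Longrightarrow> e \<in> vecs X \<Longrightarrow> z \<in> vecs X \<Longrightarrow>
        shuf e i (n - i) A (replicate (n - i) z) =
        (\<Sum>j\<le>N. scl Y (c j) (A (replicate n (scl X (2 ^ j) e + z))))"
      by (rule shuf_extract[OF i]) (rule that)
    show ?thesis
    proof (intro exI ballI impI)
      fix u assume u: "u \<in> vecs X" "nrm X u \<le> 1"
      have "S i u = (\<Sum>j\<le>N. scl Y (c j) (P (scl X (2 ^ j) u + x)))"
        unfolding S_def using Nc[OF A(1) u(1) x] u x A(2) by simp
      also have "nrm Y \<dots> \<le> (\<Sum>j\<le>N. nrm Y (scl Y (c j) (P (scl X (2 ^ j) u + x))))"
        using u x homogeneous_poly_mem[OF P] by (intro Y.nrm_sum) simp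
      also have "\<dots> \<le> (\<Sum>j\<le>N. norm (c j) * (C * (2 ^ j + nrm X x) ^ n))"
      proof (rule sum_mono)
        fix j
        have "nrm X (scl X (2 ^ j) u + x) \<le> 2 ^ j + nrm X x"
          using X.nrm_add[of "scl X (2 ^ j) u" x] u x X.nrm_scl[of u "2 ^ j"]
          by (simp add: norm_power) (smt (verit) mult_left_le zero_le_power)
        then have "nrm X (scl X (2 ^ j) u + x) ^ n \<le> (2 ^ j + nrm X x) ^ n"
          using u x by (intro power_mono X.nrm_ge_0) auto
        moreover have "nrm Y (P (scl X (2 ^ j) u + x)) \<le> C * nrm X (scl X (2 ^ j) u + x) ^ n"
          using u x by (intro bounded_unit_ball_pow[OF P C]) auto
        ultimately have "nrm Y (P (scl X (2 ^ j) u + x)) \<le> C * (2 ^ j + nrm X x) ^ n"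
          using C0 by (meson mult_left_mono order_trans)
        then show "nrm Y (scl Y (c j) (P (scl X (2 ^ j) u + x))) \<le> norm (c j) * (C * (2 ^ j + nrm X x) ^ n)"
          using u x by (simp add: Y.nrm_scl homogeneous_poly_mem[OF P] mult_left_mono)
      qed
      finally show "nrm Y (S i u) \<le> (\<Sum>j\<le>N. norm (c j) * (C * (2 ^ j + nrm X x) ^ n))" .
    qed
  qed
  then obtain B where B: "\<And>i u. i \<le> n \<Longrightarrow> u \<in> vecs X \<Longrightarrow> nrm X u \<le> 1 \<Longrightarrow> nrm Y (S i u) \<le> B i"
    by metis
  \<comment> \<open>The summand 1 keeps \<open>M\<close> positive when the sum is zero, in
    particular in degree 0.\<close>
  define M where "M = (\<Sum>i<n. B (Suc i)) + 1"
  have B0: "0 \<le> B i" if "i \<le> n" for i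
    using B[OF that, of 0] Y.nrm_ge_0[OF SY[of 0 i]] that by simp
  then have M: "0 < M" "(\<Sum>i<n. B (Suc i)) \<le> M" unfolding M_def by (auto intro!: add_nonneg_pos sum_nonneg)
  show "\<exists>d>0. \<forall>y\<in>vecs X. nrm X (x - y) < d \<longrightarrow> nrm Y (P x - P y) < e"
  proof (intro exI conjI ballI impI)
    show "0 < min 1 (e / M)" using M e by simp
    fix y assume y: "y \<in> vecs X" "nrm X (x - y) < min 1 (e / M)"
    show "nrm Y (P x - P y) < e"
    proof (cases "y = x")
      case False
      define t where "t = nrm X (y - x)"
      define u where "u = scl X (of_real (inverse t)) (y - x)"
      have u: "u \<in> vecs X" "nrm X u = 1" "scl X (of_real t) u = y - x"
        unfolding u_def t_def using X.normalize_nrm[of "y - x"] x y False by auto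
      have t: "0 \<le> t" "t < 1" "t < e / M"
        unfolding t_def using X.nrm_ge_0 y x X.nrm_diff_commute[of x y] by auto
      have "P y = A (replicate n (scl X (of_real t) u + x))"
        using A(2)[OF y(1)] u(3) by simp
      also have "\<dots> = (\<Sum>i\<le>n. scl Y (of_real t ^ i) (S i u))"
        unfolding S_def using multilinear_on_expand[OF A(1) u(1) x] by simp
      also have "\<dots> = P x + (\<Sum>i<n. scl Y (of_real t ^ Suc i) (S (Suc i) u))"
        unfolding lessThan_Suc_atMost[symmetric] sum.lessThan_Suc_shift
        using A(2)[OF x] by (simp add: S_def)
      finally have Py: "P y = P x + (\<Sum>i<n. scl Y (of_real t ^ Suc i) (S (Suc i) u))" .
      have "(\<Sum>i<n. scl Y (of_real t ^ Suc i) (S (Suc i) u)) \<in> vecs Y"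
        using u by (intro Y.sum_vecs Y.scl_vecs SY) auto
      then have "nrm Y (P x - P y) = nrm Y (\<Sum>i<n. scl Y (of_real t ^ Suc i) (S (Suc i) u))"
        using Y.nrm_minus by (simp add: Py del: power_Suc)
      also have "\<dots> \<le> (\<Sum>i<n. nrm Y (scl Y (of_real t ^ Suc i) (S (Suc i) u)))"
        using SY u by (intro Y.nrm_sum) simp
      also have "\<dots> \<le> (\<Sum>i<n. t * B (Suc i))"
      proof (rule sum_mono)
        fix i assume "i \<in> {..<n}"
        then have i: "Suc i \<le> n" by simp
        have "nrm Y (scl Y (of_real t ^ Suc i) (S (Suc i) u)) = t ^ Suc i * nrm Y (S (Suc i) u)"
          using Y.nrm_scl[OF SY[OF u(1) i]] t by (simp add: norm_power norm_mult)
        also have "\<dots> \<le> t * B (Suc i)"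
        proof (rule mult_mono)
          show "t ^ Suc i \<le> t" using t by (simp add: mult_left_le power_le_one)
          show "nrm Y (S (Suc i) u) \<le> B (Suc i)" using B[OF i u(1)] u(2) by simp
        qed (use t Y.nrm_ge_0[OF SY[OF u(1) i]] in auto)
        finally show "nrm Y (scl Y (of_real t ^ Suc i) (S (Suc i) u)) \<le> t * B (Suc i)" .
      qed
      also have "\<dots> \<le> t * M" using M t by (simp add: sum_distrib_left[symmetric] mult_left_mono)
      also have "\<dots> < e" using t M by (simp add: pos_less_divide_eq)
      finally show ?thesis .
    qed (use e x in simp)
  qed
qed

lemma continuous_imp_bounded_poly:
  assumes P: "homogeneous_poly n X Y P" and "continuous_map (ntop X) (ntop Y) P"
  shows "\<exists>C. \<forall>x\<in>vecs X. nrm X x \<le> 1 \<longrightarrow> nrm Y (P x) \<le> C"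
proof -
  obtain d where d: "0 < d" "\<And>y. y \<in> vecs X \<Longrightarrow> nrm X (0 - y) < d \<Longrightarrow> nrm Y (P 0 - P y) < 1"
    using assms(2) X.zero_vecs zero_less_one
    unfolding continuous_map_ntop_iff[OF X.normed_on_axioms Y.normed_on_axioms] by meson
  define c where "c = d / 2"
  have c: "0 < c" "c < d" using d(1) by (auto simp: c_def)
  show ?thesis
  proof (intro exI ballI impI)
    fix x assume x: "x \<in> vecs X" "nrm X x \<le> 1"
    have "nrm X (0 - scl X (of_real c) x) = c * nrm X x"
      using x c X.nrm_minus X.nrm_scl by simp
    also have "\<dots> < d" using x c by (smt (verit) mult_left_le)
    finally have 1: "nrm Y (P 0 - P (scl X (of_real c) x)) < 1"
      using x by (intro d) auto
    have "nrm Y (P (scl X (of_real c) x)) \<le> nrm Y (P 0) + 1"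
      using Y.nrm_diff[of "P 0" "P 0 - P (scl X (of_real c) x)"] 1 x homogeneous_poly_mem[OF P] by simp
    moreover have "P (scl X (of_real c) x) = scl Y (of_real c ^ n) (P x)"
      using homogeneous_poly_scl[OF P x(1)] .
    ultimately have "c ^ n * nrm Y (P x) \<le> nrm Y (P 0) + 1"
      using x c homogeneous_poly_mem[OF P] by (simp add: Y.nrm_scl norm_power)
    then show "nrm Y (P x) \<le> (nrm Y (P 0) + 1) / c ^ n"
      using c by (simp add: pos_le_divide_eq mult.commute)
  qed
qed

text \<open>Membership proofs for concrete polynomials use this form: a bound on the unit ball in
  place of continuity.\<close>

lemma vecs_poly_space:
  "P \<in> vecs (poly_space n X Y) \<longleftrightarrow> homogeneous_poly n X Y P \<and>
    (\<exists>C. \<forall>x\<in>vecs X. nrm X x \<le> 1 \<longrightarrow> nrm Y (P x) \<le> C) \<and> (\<forall>x. x \<notin> vecs X \<longrightarrow> P x = 0)"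
  unfolding poly_space_def using bounded_imp_continuous_poly continuous_imp_bounded_poly by auto metis

lemma scl_poly_space [simp]: "scl (poly_space n X Y) = (\<lambda>c P x. scl Y c (P x))"
  by (simp add: poly_space_def)

lemma poly_mem [simp]: "P \<in> vecs (poly_space n X Y) \<Longrightarrow> P x \<in> vecs Y"
  using homogeneous_poly_mem vecs_poly_space Y.zero_vecs by metis

lemma nrm_poly_upper:
  assumes "P \<in> vecs (poly_space n X Y)" "x \<in> vecs X" "nrm X x \<le> 1"
  shows "nrm Y (P x) \<le> nrm (poly_space n X Y) P"
proof -
  obtain C where "\<forall>x\<in>vecs X. nrm X x \<le> 1 \<longrightarrow> nrm Y (P x) \<le> C"
    using assms(1) vecs_poly_space by blast
  then have "bdd_above ((\<lambda>x. nrm Y (P x)) ` {x \<in> vecs X. nrm X x \<le> 1})"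
    by (auto simp: bdd_above_def)
  then show ?thesis unfolding poly_space_def using assms by (auto intro: cSUP_upper)
qed

lemma nrm_poly_least:
  assumes "\<And>x. x \<in> vecs X \<Longrightarrow> nrm X x \<le> 1 \<Longrightarrow> nrm Y (P x) \<le> C"
  shows "nrm (poly_space n X Y) P \<le> C"
proof -
  have "{x \<in> vecs X. nrm X x \<le> 1} \<noteq> {}" using X.zero_vecs by (auto intro!: exI[of _ 0])
  then show ?thesis unfolding poly_space_def using assms by (auto intro!: cSUP_least)
qed

lemma nrm_poly_pow:
  assumes "P \<in> vecs (poly_space n X Y)" "x \<in> vecs X"
  shows "nrm Y (P x) \<le> nrm (poly_space n X Y) P * nrm X x ^ n"
  using assms vecs_poly_space nrm_poly_upper by (intro bounded_unit_ball_pow) auto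

lemma normed_on_poly_space: "normed_on (poly_space n X Y)"
proof (rule normed_on.intro)
  let ?Z = "poly_space n X Y"
  show vs: "vector_space (scl ?Z)"
    unfolding scl_poly_space
    by standard (auto simp: fun_eq_iff Y.scale_right_distrib Y.scale_left_distrib)
  interpret Z: vector_space "scl ?Z" by (rule vs)
  show sub: "module.subspace (scl ?Z) (vecs ?Z)"
  proof (rule Z.subspaceI)
    show "0 \<in> vecs ?Z"
      unfolding vecs_poly_space using homogeneous_poly_zero[of n] by (auto simp: zero_fun_def)
  next
    fix P Q assume PQ: "P \<in> vecs ?Z" "Q \<in> vecs ?Z"
    have "nrm Y ((P + Q) x) \<le> nrm ?Z P + nrm ?Z Q" if "x \<in> vecs X" "nrm X x \<le> 1" for x
      using nrm_poly_upper[OF PQ(1) that] nrm_poly_upper[OF PQ(2) that] Y.nrm_add[of "P x" "Q x"] PQ by simp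
    then show "P + Q \<in> vecs ?Z"
      using PQ homogeneous_poly_add[of n P Q] unfolding vecs_poly_space by (auto simp: plus_fun_def)
  next
    fix P c assume P: "P \<in> vecs ?Z"
    have "nrm Y (scl Y c (P x)) \<le> norm c * nrm ?Z P" if "x \<in> vecs X" "nrm X x \<le> 1" for x
      using nrm_poly_upper[OF P that] P by (simp add: Y.nrm_scl mult_left_mono)
    then show "scl ?Z c P \<in> vecs ?Z"
      using P homogeneous_poly_scale[of n P c] unfolding vecs_poly_space by auto
  qed
  have sc: "scl ?Z c P \<in> vecs ?Z" if "P \<in> vecs ?Z" for c P
    using Z.subspace_scale[OF sub that] .
  have nn: "0 \<le> nrm ?Z P" if "P \<in> vecs ?Z" for P
    using nrm_poly_upper[OF that, of 0] Y.nrm_ge_0[of "P 0"] that by simp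
  fix P assume P: "P \<in> vecs ?Z"
  note P0 = nn[OF P]
  then show "0 \<le> nrm ?Z P" .
  have "P = 0" if "nrm ?Z P = 0"
  proof
    fix x
    show "P x = 0 x"
    proof (cases "x \<in> vecs X")
      case True
      then show ?thesis
        using nrm_poly_pow[OF P True] that Y.nrm_ge_0[of "P x"] Y.nrm_eq_0[of "P x"] P by simp
    qed (use P vecs_poly_space in auto)
  qed
  moreover have "nrm ?Z 0 \<le> 0" by (rule nrm_poly_least) simp
  ultimately show "nrm ?Z P = 0 \<longleftrightarrow> P = 0" using P0 by auto
  have le: "nrm ?Z (scl ?Z c P) \<le> norm c * nrm ?Z P" if "P \<in> vecs ?Z" for c P
  proof (rule nrm_poly_least)
    fix x assume "x \<in> vecs X" "nrm X x \<le> 1"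
    then show "nrm Y (scl ?Z c P x) \<le> norm c * nrm ?Z P"
      using nrm_poly_upper[OF that] that by (simp add: Y.nrm_scl mult_left_mono)
  qed
  show "nrm ?Z (scl ?Z c P) = norm c * nrm ?Z P" for c
  proof (cases "c = 0")
    case True
    then show ?thesis using le[OF P, of c] nn[OF sc[OF P], of c]
by (simp add: zero_fun_def)
  next
    case False
    have "nrm ?Z (scl ?Z (inverse c) (scl ?Z c P)) \<le> norm (inverse c) * nrm ?Z (scl ?Z c P)"
      by (rule le[OF sc[OF P]])
    moreover have "scl ?Z (inverse c) (scl ?Z c P) = P" using False by simp
    ultimately have "norm c * nrm ?Z P \<le> nrm ?Z (scl ?Z c P)"
      using False by (simp add: norm_inverse norm_divide field_simps)
    then show ?thesis using le[OF P, of c] by simp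
  qed
  fix Q assume Q: "Q \<in> vecs ?Z"
  show "nrm ?Z (P + Q) \<le> nrm ?Z P + nrm ?Z Q"
  proof (rule nrm_poly_least)
    fix x assume x: "x \<in> vecs X" "nrm X x \<le> 1"
    show "nrm Y ((P + Q) x) \<le> nrm ?Z P + nrm ?Z Q"
      using nrm_poly_upper[OF P x] nrm_poly_upper[OF Q x] Y.nrm_add[of "P x" "Q x"] P Q by simp
  qed
qed

text \<open>The pointwise limit of a Cauchy sequence is a homogeneous polynomial by polarization,
  and the convergence is uniform on the unit ball.\<close>

lemma banach_on_poly_space:
  assumes "Y.ms.mcomplete"
  shows "banach_on (poly_space n X Y)"
proof -
  let ?Z = "poly_space n X Y"
  interpret Z: normed_on ?Z by (rule normed_on_poly_space)
  show ?thesis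
  proof (rule Z.banach_onI, rule Z.mcompleteI)
    fix u :: "nat \<Rightarrow> 'v \<Rightarrow> 'w"
    assume u: "\<And>m. u m \<in> vecs ?Z"
      and cauchy: "\<And>e. 0 < e \<Longrightarrow> \<exists>N. \<forall>m\<ge>N. \<forall>l\<ge>N. nrm ?Z (u m - u l) < e"
    have diff: "nrm Y (u m x - u l x) \<le> nrm ?Z (u m - u l) * nrm X x ^ n" if "x \<in> vecs X" for m l x
      using nrm_poly_pow[of "u m - u l" n x] u that by simp
    have "\<exists>y\<in>vecs Y. (\<lambda>m. nrm Y (u m x - y)) \<longlonglongrightarrow> 0" if x: "x \<in> vecs X" for x
    proof (rule Y.mcomplete_Cauchy[OF assms])
      fix e :: real assume e: "0 < e"
      have pos: "0 < nrm X x ^ n + 1" using X.nrm_ge_0[OF x] by (simp add: add_nonneg_pos)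
      then obtain N where N: "\<And>m l. N \<le> m \<Longrightarrow> N \<le> l \<Longrightarrow> nrm ?Z (u m - u l) < e / (nrm X x ^ n + 1)"
        using cauchy[of "e / (nrm X x ^ n + 1)"] e by auto
      have "nrm Y (u m x - u l x) < e" if "N \<le> m" "N \<le> l" for m l
      proof -
        have "nrm Y (u m x - u l x) \<le> nrm ?Z (u m - u l) * (nrm X x ^ n + 1)"
          using diff[OF x, of m l] Z.nrm_ge_0[of "u m - u l"] u by (simp add: algebra_simps)
        also have "\<dots> < e" using N[OF that] pos by (simp add: pos_less_divide_eq)
        finally show ?thesis .
      qed
      then show "\<exists>N. \<forall>m\<ge>N. \<forall>l\<ge>N. nrm Y (u m x - u l x) < e" by blast
    qed (use poly_mem[OF u] in simp)
    then obtain P0 where P0: "\<And>x. x \<in> vecs X \<Longrightarrow> P0 x \<in> vecs Y \<and> (\<lambda>m. nrm Y (u m x - P0 x)) \<longlonglongrightarrow> 0"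
      by metis
    define P where "P x = (if x \<in> vecs X then P0 x else 0)" for x
    have P: "P x \<in> vecs Y" "Y.nlim (\<lambda>m. u m x) (P x) sequentially" if "x \<in> vecs X" for x
      using P0 that by (auto simp: P_def Y.nlim_def)
    have hom: "homogeneous_poly n X Y P"
      by (rule homogeneous_poly_limit[of n u sequentially]) (use u vecs_poly_space P in auto)
    have tail: "\<exists>N. \<forall>m\<ge>N. \<forall>x\<in>vecs X. nrm X x \<le> 1 \<longrightarrow> nrm Y (u m x - P x) \<le> e" if e: "0 < e" for e :: real
    proof -
      obtain N where N: "\<And>m l. N \<le> m \<Longrightarrow> N \<le> l \<Longrightarrow> nrm ?Z (u m - u l) < e"
        using cauchy[OF e] by auto
      have "nrm Y (u m x - P x) \<le> e" if m: "N \<le> m" and x: "x \<in> vecs X" "nrm X x \<le> 1" for m x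
      proof -
        have "Y.nlim (\<lambda>l. u m x - u l x) (u m x - P x) sequentially"
          unfolding Y.nlim_def
          using P(2)[OF x(1)] Y.nrm_diff_commute[of "u _ x" "P x"] P(1)[OF x(1)] poly_mem[OF u]
          by (simp add: Y.nlim_def)
        then have "(\<lambda>l. nrm Y (u m x - u l x)) \<longlonglongrightarrow> nrm Y (u m x - P x)"
          using poly_mem[OF u] P(1)[OF x(1)] by (intro Y.nlim_nrm) auto
        moreover have "nrm Y (u m x - u l x) \<le> e" if "N \<le> l" for l
          using nrm_poly_upper[of "u m - u l" n x] N[OF m that] u x by simp
        ultimately show ?thesis by (intro LIMSEQ_le_const2) auto
      qed
      then show ?thesis by blast
    qed
    obtain N where N: "\<And>x. x \<in> vecs X \<Longrightarrow> nrm X x \<le> 1 \<Longrightarrow> nrm Y (u N x - P x) \<le> 1"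
      using tail[of 1] by auto
    have "nrm Y (P x) \<le> nrm ?Z (u N) + 1" if "x \<in> vecs X" "nrm X x \<le> 1" for x
      using Y.nrm_diff[of "u N x" "u N x - P x"] N[OF that] nrm_poly_upper[OF u[of N] that] poly_mem[OF u] P(1) that by fastforce
    then have PZ: "P \<in> vecs ?Z"
      unfolding vecs_poly_space using hom P_def by auto
    have "(\<lambda>m. nrm ?Z (u m - P)) \<longlonglongrightarrow> 0"
    proof (rule LIMSEQ_I)
      fix r :: real assume r: "0 < r"
      obtain N where N: "\<And>m x. N \<le> m \<Longrightarrow> x \<in> vecs X \<Longrightarrow> nrm X x \<le> 1 \<Longrightarrow> nrm Y (u m x - P x) \<le> r / 2"
        using tail[of "r / 2"] r by auto
      have "nrm ?Z (u m - P) \<le> r / 2" if "N \<le> m" for m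
        using N[OF that] by (intro nrm_poly_least) simp
      then have "norm (nrm ?Z (u m - P) - 0) < r" if "N \<le> m" for m
        using r that Z.nrm_ge_0[of "u m - P"] u PZ by fastforce
      then show "\<exists>N. \<forall>m\<ge>N. norm (nrm ?Z (u m - P) - 0) < r" by blast
    qed
    with PZ show "\<exists>P\<in>vecs ?Z. (\<lambda>m. nrm ?Z (u m - P)) \<longlonglongrightarrow> 0" by blast
  qed
qed

end

section \<open>Dual spaces and a criterion for M-ideals\<close>

context normed_on
begin

lemma vecs_dual:
  "f \<in> vecs (dual X) \<longleftrightarrow>
    (\<forall>x\<in>vecs X. \<forall>y\<in>vecs X. f (x + y) = f x + f y) \<and>
    (\<forall>c. \<forall>x\<in>vecs X. f (scl X c x) = c * f x) \<and>
    (\<exists>C. \<forall>x\<in>vecs X. norm (f x) \<le> C * nrm X x) \<and>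
    (\<forall>x. x \<notin> vecs X \<longrightarrow> f x = 0)"
proof -
  have "continuous_map (ntop X) euclidean f \<longleftrightarrow> (\<exists>C. \<forall>x\<in>vecs X. norm (f x) \<le> C * nrm X x)"
    if add: "\<forall>x\<in>vecs X. \<forall>y\<in>vecs X. f (x + y) = f x + f y"
      and hom: "\<forall>c. \<forall>x\<in>vecs X. f (scl X c x) = c * f x"
  proof
    have f0: "f 0 = 0" using hom[rule_format, of 0 0] by simp
    have fm: "f (- x) = - f x" if "x \<in> vecs X" for x
      using hom[rule_format, of x "- 1"] that by simp
    have fd: "f (x - y) = f x - f y" if "x \<in> vecs X" "y \<in> vecs X" for x y
      using add[rule_format, of x "- y"] fm that by simp
    {
      assume "continuous_map (ntop X) euclidean f"
      then obtain d where d: "0 < d" "\<And>y. y \<in> vecs X \<Longrightarrow> nrm X (0 - y) < d \<Longrightarrow> norm (f 0 - f y) < 1"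
        unfolding continuous_map_ntop_euclidean_iff[OF normed_on_axioms]
        using zero_vecs zero_less_one by meson
      have "norm (f x) \<le> (2 / d) * nrm X x" if x: "x \<in> vecs X" for x
      proof (cases "x = 0")
        case False
        then have pos: "0 < nrm X x" using nrm_ge_0[OF x] nrm_eq_0[OF x] by linarith
        define c where "c = d / (2 * nrm X x)"
        have c: "0 < c" using pos d(1) by (simp add: c_def)
        have "nrm X (0 - scl X (of_real c) x) = c * nrm X x"
          using x c nrm_minus nrm_scl by simp
        also have "\<dots> < d" using pos d(1) by (simp add: c_def)
        finally have "norm (f 0 - f (scl X (of_real c) x)) < 1" using x by (intro d) auto
        then have "c * norm (f x) < 1" using c x by (simp add: f0 hom norm_mult)
        then show ?thesis using pos d(1) by (simp add: c_def field_simps)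
      qed (simp add: f0)
      then show "\<exists>C. \<forall>x\<in>vecs X. norm (f x) \<le> C * nrm X x" by blast
    next
      assume "\<exists>C. \<forall>x\<in>vecs X. norm (f x) \<le> C * nrm X x"
      then obtain C where C: "\<And>x. x \<in> vecs X \<Longrightarrow> norm (f x) \<le> C * nrm X x" by blast
      show "continuous_map (ntop X) euclidean f"
        unfolding continuous_map_ntop_euclidean_iff[OF normed_on_axioms]
      proof (intro ballI allI impI)
        fix x e assume x: "x \<in> vecs X" and e: "0 < (e::real)"
        show "\<exists>d>0. \<forall>y\<in>vecs X. nrm X (x - y) < d \<longrightarrow> norm (f x - f y) < e"
        proof (intro exI conjI ballI impI)
          show "0 < e / (\<bar>C\<bar> + 1)" using e by (simp add: add_nonneg_pos)
          fix y assume y: "y \<in> vecs X" "nrm X (x - y) < e / (\<bar>C\<bar> + 1)"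
          have "norm (f x - f y) \<le> C * nrm X (x - y)"
            using C[of "x - y"] fd x y by simp
          also have "\<dots> \<le> (\<bar>C\<bar> + 1) * nrm X (x - y)"
            using nrm_ge_0[of "x - y"] x y by (intro mult_right_mono) auto
          also have "\<dots> < e" using y(2) by (simp add: pos_less_divide_eq mult.commute)
          finally show "norm (f x - f y) < e" .
        qed
      qed
    }
  qed
  then show ?thesis unfolding dual_def by auto
qed

lemma dual_add: "f \<in> vecs (dual X) \<Longrightarrow> x \<in> vecs X \<Longrightarrow> y \<in> vecs X \<Longrightarrow> f (x + y) = f x + f y"
  and dual_scl: "f \<in> vecs (dual X) \<Longrightarrow> x \<in> vecs X \<Longrightarrow> f (scl X c x) = c * f x"
  and dual_off: "f \<in> vecs (dual X) \<Longrightarrow> x \<notin> vecs X \<Longrightarrow> f x = 0"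
  by (simp_all add: vecs_dual)

lemma dual_zero: "f \<in> vecs (dual X) \<Longrightarrow> f 0 = 0"
  using dual_scl[of f 0 0] by simp

lemma dual_diff: "f \<in> vecs (dual X) \<Longrightarrow> x \<in> vecs X \<Longrightarrow> y \<in> vecs X \<Longrightarrow> f (x - y) = f x - f y"
  using dual_add[of f x "- y"] dual_scl[of f y "- 1"] by simp

lemma dual_sum: "f \<in> vecs (dual X) \<Longrightarrow> (\<And>i. i \<in> I \<Longrightarrow> x i \<in> vecs X) \<Longrightarrow> f (sum x I) = (\<Sum>i\<in>I. f (x i))"
  by (induction I rule: infinite_finite_induct) (simp_all add: dual_zero dual_add)

lemma nrm_dual_upper:
  assumes f: "f \<in> vecs (dual X)" and x: "x \<in> vecs X" "nrm X x \<le> 1"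
  shows "norm (f x) \<le> nrm (dual X) f"
proof -
  obtain C where C: "\<And>x. x \<in> vecs X \<Longrightarrow> norm (f x) \<le> C * nrm X x"
    using f vecs_dual by blast
  have "norm (f y) \<le> \<bar>C\<bar>" if "y \<in> vecs X" "nrm X y \<le> 1" for y
  proof -
    have "C * nrm X y \<le> \<bar>C\<bar> * nrm X y" using nrm_ge_0 that by (intro mult_right_mono) auto
    also have "\<dots> \<le> \<bar>C\<bar>" using that by (intro mult_left_le) auto
    finally show ?thesis using C[OF that(1)] by simp
  qed
  then have "bdd_above ((\<lambda>x. norm (f x)) ` {x \<in> vecs X. nrm X x \<le> 1})"
    by (auto simp: bdd_above_def)
  then show ?thesis unfolding dual_def using x by (auto intro: cSUP_upper)
qed

lemma nrm_dual_least:
  assumes "\<And>x. x \<in> vecs X \<Longrightarrow> nrm X x \<le> 1 \<Longrightarrow> norm (f x) \<le> C"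
  shows "nrm (dual X) f \<le> C"
proof -
  have "{x \<in> vecs X. nrm X x \<le> 1} \<noteq> {}" using zero_vecs by (auto intro!: exI[of _ 0])
  then show ?thesis unfolding dual_def using assms by (auto intro!: cSUP_least)
qed

lemma nrm_dual_ge_0: "f \<in> vecs (dual X) \<Longrightarrow> 0 \<le> nrm (dual X) f"
  by (metis nrm_dual_upper norm_ge_zero order_trans zero_vecs nrm_0 zero_le_one)

lemma norm_dual_le:
  assumes "f \<in> vecs (dual X)" "x \<in> vecs X"
  shows "norm (f x) \<le> nrm (dual X) f * nrm X x"
proof (cases "x = 0")
  case False
  obtain u where u: "u \<in> vecs X" "nrm X u = 1" "scl X (of_real (nrm X x)) u = x"
    using normalize_nrm[OF assms(2) False] assms(2) scl_vecs by metis
  have "f x = of_real (nrm X x) * f u" using dual_scl[OF assms(1) u(1)] u(3) by metis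
  then show ?thesis
    using nrm_dual_upper[OF assms(1) u(1)] u(2) nrm_ge_0[OF assms(2)]
    by (simp add: norm_mult mult.commute mult_left_mono)
qed (simp add: dual_zero[OF assms(1)])

lemma dual_plus: "f \<in> vecs (dual X) \<Longrightarrow> g \<in> vecs (dual X) \<Longrightarrow> f + g \<in> vecs (dual X)"
  unfolding vecs_dual[of "f + g"]
proof (intro conjI)
  assume fg: "f \<in> vecs (dual X)" "g \<in> vecs (dual X)"
  have "norm ((f + g) x) \<le> (nrm (dual X) f + nrm (dual X) g) * nrm X x" if "x \<in> vecs X" for x
    using norm_dual_le[OF fg(1) that] norm_dual_le[OF fg(2) that] norm_triangle_ineq[of "f x" "g x"]
    by (simp add: distrib_right)
  then show "\<exists>C. \<forall>x\<in>vecs X. norm ((f + g) x) \<le> C * nrm X x" by blast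
qed (auto simp: dual_add dual_scl dual_off algebra_simps)

lemma scl_dual [simp]: "scl (dual X) = (\<lambda>c f x. c * f x)"
  by (simp add: dual_def)

lemma dual_scale: "f \<in> vecs (dual X) \<Longrightarrow> scl (dual X) c f \<in> vecs (dual X)"
  unfolding scl_dual vecs_dual[of "\<lambda>x. c * f x"]
proof (intro conjI)
  assume f: "f \<in> vecs (dual X)"
  have "norm (c * f x) \<le> (norm c * nrm (dual X) f) * nrm X x" if "x \<in> vecs X" for x
    using mult_left_mono[OF norm_dual_le[OF f that] norm_ge_zero[of c]]
    by (simp add: norm_mult mult.assoc)
  then show "\<exists>C. \<forall>x\<in>vecs X. norm (c * f x) \<le> C * nrm X x" by blast
qed (auto simp: dual_add dual_scl dual_off algebra_simps)

lemma dual_minus: "f \<in> vecs (dual X) \<Longrightarrow> g \<in> vecs (dual X) \<Longrightarrow> f - g \<in> vecs (dual X)"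
  using dual_plus[of f "scl (dual X) (- 1) g"] dual_scale[of g "- 1"]
  by (simp add: plus_fun_def fun_diff_def)

lemma nrm_dual_triangle:
  assumes "f \<in> vecs (dual X)" "g \<in> vecs (dual X)"
  shows "nrm (dual X) f \<le> nrm (dual X) g + nrm (dual X) (f - g)"
proof (rule nrm_dual_least)
  fix x assume x: "x \<in> vecs X" "nrm X x \<le> 1"
  then show "norm (f x) \<le> nrm (dual X) g + nrm (dual X) (f - g)"
    using nrm_dual_upper[OF assms(2) x] nrm_dual_upper[OF dual_minus[OF assms] x]
      norm_triangle_ineq[of "g x" "f x - g x"] by simp
qed

text \<open>
  The projection is \<open>f \<mapsto> lim f \<circ> S\<^sub>m\<close>; it is a norm preserving extension of the restriction of \<open>f\<close>
  to \<^term>\<open>J\<close>. The inequality \<open>\<bar>f R\<bar> + \<bar>lim f (D\<^sub>m Q)\<bar> \<le> \<parallel>f\<parallel>\<close> for \<open>R\<close> in the unit ball of \<^term>\<open>J\<close>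
  and \<open>Q\<close> in the unit ball of \<^term>\<open>X\<close>, applied to this extension, shows that its limit along
  \<open>D\<^sub>m\<close> vanishes; applied to \<open>f\<close>, it then gives the additivity of the norm.
\<close>

theorem M_ideal_criterion:
  assumes "banach_on X" "J \<subseteq> vecs X" "module.subspace (scl X) J" "closedin (ntop X) J"
    and S_mem: "\<And>m x. x \<in> vecs X \<Longrightarrow> S m x \<in> J"
    and S_add: "\<And>m x y. x \<in> vecs X \<Longrightarrow> y \<in> vecs X \<Longrightarrow> S m (x + y) = S m x + S m y"
    and S_scl: "\<And>m x c. x \<in> vecs X \<Longrightarrow> S m (scl X c x) = scl X c (S m x)"
    and S_le: "\<And>m x. x \<in> vecs X \<Longrightarrow> nrm X (S m x) \<le> nrm X x"
    and S_lim: "\<And>x. x \<in> J \<Longrightarrow> (\<lambda>m. nrm X (S m x - x)) \<longlonglongrightarrow> 0"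
    and D_mem: "\<And>m x. x \<in> vecs X \<Longrightarrow> D m x \<in> vecs X"
    and D_scl: "\<And>m x c. x \<in> vecs X \<Longrightarrow> D m (scl X c x) = scl X c (D m x)"
    and D_le: "\<And>m x. x \<in> vecs X \<Longrightarrow> nrm X (D m x) \<le> nrm X x"
    and D_diff: "\<And>m x. x \<in> vecs X \<Longrightarrow> x - D m x \<in> J"
    and key: "\<And>R Q e. R \<in> J \<Longrightarrow> nrm X R \<le> 1 \<Longrightarrow> Q \<in> vecs X \<Longrightarrow> nrm X Q \<le> 1 \<Longrightarrow> 0 < e \<Longrightarrow>
      \<forall>\<^sub>F m in sequentially. nrm X (R + D m Q) \<le> 1 + e"
  shows "M_ideal X J"
proof -
  obtain U :: "nat filter" where U: "U \<le> sequentially" "U \<noteq> bot"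
    and conv: "\<And>s::nat \<Rightarrow> 'k. bounded (range s) \<Longrightarrow> \<exists>l. (s \<longlongrightarrow> l) U"
    using ex_subfilter_bounded_functions_converge[where F = sequentially and 'k = 'k] by auto
  have JX: "x \<in> vecs X" if "x \<in> J" for x using assms(2) that by blast
  define \<pi> where "\<pi> f x = (if x \<in> vecs X then Lim U (\<lambda>m. f (S m x)) else 0)" for f :: "'v \<Rightarrow> 'k" and x
  have bdd: "bounded (range (\<lambda>m. f (T m)))"
    if "f \<in> vecs (dual X)" "\<And>m. T m \<in> vecs X" "\<And>m. nrm X (T m) \<le> B" for f T B
  proof -
    have "norm (f (T m)) \<le> nrm (dual X) f * B" for m
      using norm_dual_le[OF that(1,2)] mult_left_mono[OF that(3) nrm_dual_ge_0[OF that(1)]]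
      by (meson order_trans)
    then show ?thesis by (auto simp: bounded_iff)
  qed
  have \<pi>: "((\<lambda>m. f (S m x)) \<longlongrightarrow> \<pi> f x) U" if f: "f \<in> vecs (dual X)" and x: "x \<in> vecs X" for f x
  proof -
    obtain l where "((\<lambda>m. f (S m x)) \<longlongrightarrow> l) U"
      using conv[OF bdd[OF f, of "\<lambda>m. S m x"]] S_mem JX S_le x by blast
    then show ?thesis using x U(2) by (simp add: \<pi>_def tendsto_Lim)
  qed
  have \<pi>_bound: "norm (\<pi> f x) \<le> C * nrm X x"
    if f: "f \<in> vecs (dual X)" and C: "\<And>R. R \<in> J \<Longrightarrow> norm (f R) \<le> C * nrm X R" "0 \<le> C" and x: "x \<in> vecs X" for f x C
  proof (rule tendsto_upperbound[OF tendsto_norm[OF \<pi>[OF f x]] _ U(2)])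
    have "norm (f (S m x)) \<le> C * nrm X x" for m
      using C(1)[OF S_mem[OF x]] mult_left_mono[OF S_le[OF x] C(2)] by (meson order_trans)
    then show "\<forall>\<^sub>F m in U. norm (f (S m x)) \<le> C * nrm X x" by simp
  qed
  have \<pi>_dual: "\<pi> f \<in> vecs (dual X)" if f: "f \<in> vecs (dual X)" for f
    unfolding vecs_dual
  proof (intro conjI ballI allI impI)
    fix x y assume xy: "x \<in> vecs X" "y \<in> vecs X"
    have "((\<lambda>m. f (S m x) + f (S m y)) \<longlongrightarrow> \<pi> f x + \<pi> f y) U"
      by (intro tendsto_add \<pi> f xy)
    moreover have "f (S m (x + y)) = f (S m x) + f (S m y)" for m
      using S_add[OF xy] dual_add[OF f] S_mem JX xy by simp
    ultimately show "\<pi> f (x + y) = \<pi> f x + \<pi> f y"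
      using tendsto_unique[OF U(2)] \<pi>[OF f add_vecs[OF xy]] by simp
  next
    fix c x assume x: "x \<in> vecs X"
    have "((\<lambda>m. c * f (S m x)) \<longlongrightarrow> c * \<pi> f x) U"
      by (intro tendsto_mult_left \<pi> f x)
    moreover have "f (S m (scl X c x)) = c * f (S m x)" for m
      using S_scl[OF x] dual_scl[OF f] S_mem JX x by simp
    ultimately have "((\<lambda>m. c * f (S m x)) \<longlongrightarrow> \<pi> f (scl X c x)) U" "((\<lambda>m. c * f (S m x)) \<longlongrightarrow> c * \<pi> f x) U"
      using \<pi>[OF f scl_vecs[OF x, of c]] by simp_all
    then show "\<pi> f (scl X c x) = c * \<pi> f x" by (rule tendsto_unique[OF U(2)])
  next
    show "\<exists>C. \<forall>x\<in>vecs X. norm (\<pi> f x) \<le> C * nrm X x"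
      using \<pi>_bound[OF f norm_dual_le[OF f JX] nrm_dual_ge_0[OF f]] by blast
  qed (simp add: \<pi>_def)
  have \<pi>_J: "\<pi> f x = f x" if f: "f \<in> vecs (dual X)" and x: "x \<in> J" for f x
  proof -
    have "((\<lambda>m. f (S m x) - f x) \<longlongrightarrow> 0) U"
    proof (rule Lim_null_comparison)
      have "norm (f (S m x) - f x) \<le> nrm (dual X) f * nrm X (S m x - x)" for m
        using norm_dual_le[OF f, of "S m x - x"] dual_diff[OF f, of "S m x" x] S_mem JX x by simp
      then show "\<forall>\<^sub>F m in U. norm (f (S m x) - f x) \<le> nrm (dual X) f * nrm X (S m x - x)" by simp
      show "((\<lambda>m. nrm (dual X) f * nrm X (S m x - x)) \<longlongrightarrow> 0) U"
        using tendsto_mono[OF U(1) S_lim[OF x]] by (rule tendsto_mult_right_zero)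
    qed
    then have "((\<lambda>m. f (S m x)) \<longlongrightarrow> f x) U" by (simp add: LIM_zero_iff)
    then show ?thesis using tendsto_unique[OF U(2) \<pi>[OF f JX[OF x]]] by simp
  qed
  \<comment> \<open>A scalar of modulus 1, a sign or a rotation, makes both summands in
    \<open>split\<close> nonnegative, so that the modulus of their sum is the sum of the
    moduli.\<close>
  have phase: "\<exists>c. norm c = 1 \<and> c * z = of_real (norm z)" for z :: 'k
  proof (cases "z = 0")
    case True
    then show ?thesis by (intro exI[of _ 1]) simp
  next
    case False
    then show ?thesis by (intro exI[of _ "of_real (norm z) / z"]) (simp add: norm_divide)
  qed
  have limD: "\<exists>l. ((\<lambda>m. g (D m Q)) \<longlongrightarrow> l) U" if g: "g \<in> vecs (dual X)" and Q: "Q \<in> vecs X" for g Q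
    using conv[OF bdd[OF g, of "\<lambda>m. D m Q"]] D_mem D_le Q by blast
  have split: "norm (g R) + norm l \<le> nrm (dual X) g"
    if g: "g \<in> vecs (dual X)" and R: "R \<in> J" "nrm X R \<le> 1" and Q: "Q \<in> vecs X" "nrm X Q \<le> 1"
      and l: "((\<lambda>m. g (D m Q)) \<longlongrightarrow> l) U" for g R Q l
  proof (rule field_le_epsilon)
    fix e :: real assume e: "0 < e"
    obtain c d where c: "norm c = 1" "c * g R = of_real (norm (g R))"
      and d: "norm d = 1" "d * l = of_real (norm l)"
      using phase by metis
    \<comment> \<open>The denominator is increased by 1 so that the choice also works when
      \<open>g\<close> has norm 0.\<close>
    define e' where "e' = e / (nrm (dual X) g + 1)"
    have e': "0 < e'" using e nrm_dual_ge_0[OF g] by (simp add: e'_def)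
    have cR: "scl X c R \<in> J" using assms(3) R(1) by (simp add: subspace_scale)
    have "\<forall>\<^sub>F m in sequentially. nrm X (scl X c R + D m (scl X d Q)) \<le> 1 + e'"
      using cR R Q c d e' JX by (intro key) (auto simp: nrm_scl)
    then have ev: "\<forall>\<^sub>F m in U. nrm X (scl X c R + D m (scl X d Q)) \<le> 1 + e'"
      using U(1) by (rule filter_leD[rotated])
    have lim: "((\<lambda>m. norm (of_real (norm (g R)) + d * g (D m Q))) \<longlongrightarrow> norm (of_real (norm (g R)) + d * l)) U"
      by (intro tendsto_norm tendsto_add tendsto_const tendsto_mult_left l)
    have "norm (of_real (norm (g R)) + d * l) \<le> nrm (dual X) g * (1 + e')"
    proof (rule tendsto_upperbound[OF lim _ U(2)])
      show "\<forall>\<^sub>F m in U. norm (of_real (norm (g R)) + d * g (D m Q)) \<le> nrm (dual X) g * (1 + e')"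
        using ev
      proof eventually_elim
        case (elim m)
        have "g (scl X c R + D m (scl X d Q)) = of_real (norm (g R)) + d * g (D m Q)"
          using dual_add[OF g] dual_scl[OF g] D_scl[OF Q(1)] D_mem[OF Q(1)] JX R(1) cR c by simp
        moreover have "norm (g (scl X c R + D m (scl X d Q))) \<le> nrm (dual X) g * nrm X (scl X c R + D m (scl X d Q))"
          using Q D_mem JX cR by (intro norm_dual_le[OF g]) auto
        ultimately show ?case
          using mult_left_mono[OF elim nrm_dual_ge_0[OF g]] by simp
      qed
    qed
    moreover have "norm (of_real (norm (g R)) + d * l) = norm (g R) + norm l"
      unfolding d(2) of_real_add[symmetric] by (simp only: norm_of_real) simp
    moreover have "nrm (dual X) g * (1 + e') \<le> nrm (dual X) g + e"
    proof -
      have "nrm (dual X) g * e' \<le> (nrm (dual X) g + 1) * e'" using e' by (intro mult_right_mono) auto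
      also have "\<dots> = e" using nrm_dual_ge_0[OF g] by (simp add: e'_def)
      finally show ?thesis by (simp add: algebra_simps)
    qed
    ultimately show "norm (g R) + norm l \<le> nrm (dual X) g + e" by simp
  qed
  \<comment> \<open>The maps \<open>S m\<close> send the unit ball of the space into that of
    \<open>J\<close>, so bounds for \<open>f\<close> there bound the whole functional
    \<open>\<pi> f\<close>.\<close>
  have nrm_\<pi>: "nrm (dual X) (\<pi> f) \<le> C"
    if f: "f \<in> vecs (dual X)" and C: "\<And>R. R \<in> J \<Longrightarrow> nrm X R \<le> 1 \<Longrightarrow> norm (f R) \<le> C" for f C
  proof (rule nrm_dual_least)
    fix x assume x: "x \<in> vecs X" "nrm X x \<le> 1"
    have "norm (f (S m x)) \<le> C" for m
      using C[OF S_mem[OF x(1)]] S_le[OF x(1), of m] x(2) by (meson order_trans)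
    then show "norm (\<pi> f x) \<le> C"
      by (intro tendsto_upperbound[OF tendsto_norm[OF \<pi>[OF f x(1)]] _ U(2)]) simp
  qed
  have lim0: "((\<lambda>m. \<pi> f (D m Q)) \<longlongrightarrow> 0) U"
    if f: "f \<in> vecs (dual X)" and Q: "Q \<in> vecs X" "nrm X Q \<le> 1" for f Q
  proof -
    obtain l where l: "((\<lambda>m. \<pi> f (D m Q)) \<longlongrightarrow> l) U" using limD[OF \<pi>_dual[OF f] Q(1)] by blast
    have "nrm (dual X) (\<pi> f) \<le> nrm (dual X) (\<pi> f) - norm l"
    proof (rule nrm_\<pi>[OF f])
      fix R assume "R \<in> J" "nrm X R \<le> 1"
      then show "norm (f R) \<le> nrm (dual X) (\<pi> f) - norm l"
        using split[OF \<pi>_dual[OF f] _ _ Q l, of R] \<pi>_J[OF f] by simp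
    qed
    then show ?thesis using l by simp
  qed
  \<comment> \<open>The functional f - \<open>\<pi> f\<close> annihilates \<open>J\<close>, which
    contains Q - \<open>D m Q\<close>; hence its value at Q is its value at \<open>D m Q\<close> for
    every m, and there \<open>\<pi> f\<close> disappears in the limit.\<close>
  have sub: "(f - \<pi> f) Q = l"
    if f: "f \<in> vecs (dual X)" and Q: "Q \<in> vecs X" "nrm X Q \<le> 1" and l: "((\<lambda>m. f (D m Q)) \<longlongrightarrow> l) U" for f Q l
  proof -
    have "(f - \<pi> f) Q = f (D m Q) - \<pi> f (D m Q)" for m
    proof -
      have "(f - \<pi> f) (Q - D m Q) = 0" using \<pi>_J[OF f D_diff[OF Q(1)]] by simp
      then show ?thesis
        using dual_diff[OF dual_minus[OF f \<pi>_dual[OF f]], of Q "D m Q"] Q(1) D_mem by simp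
    qed
    then have "((\<lambda>m. (f - \<pi> f) Q) \<longlongrightarrow> l - 0) U"
      using tendsto_diff[OF l lim0[OF f Q]] by (simp add: fun_diff_def)
    then show ?thesis using tendsto_unique[OF U(2) tendsto_const] by fastforce
  qed
  have le: "nrm (dual X) (\<pi> f) + nrm (dual X) (f - \<pi> f) \<le> nrm (dual X) f" if f: "f \<in> vecs (dual X)" for f
  proof -
    have "nrm (dual X) (f - \<pi> f) \<le> nrm (dual X) f - nrm (dual X) (\<pi> f)"
    proof (rule nrm_dual_least)
      fix Q assume Q: "Q \<in> vecs X" "nrm X Q \<le> 1"
      obtain l where l: "((\<lambda>m. f (D m Q)) \<longlongrightarrow> l) U" using limD[OF f Q(1)] by blast
      have "nrm (dual X) (\<pi> f) \<le> nrm (dual X) f - norm l"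
        using split[OF f _ _ Q l] by (intro nrm_\<pi>[OF f]) (simp add: le_diff_eq)
      then show "norm ((f - \<pi> f) Q) \<le> nrm (dual X) f - nrm (dual X) (\<pi> f)"
        using sub[OF f Q l] by simp
    qed
    then show ?thesis by simp
  qed
  have "linear_projection (dual X) \<pi>"
    unfolding linear_projection_def
  proof (intro conjI ballI allI)
    fix f assume f: "f \<in> vecs (dual X)"
    show "\<pi> f \<in> vecs (dual X)" by (rule \<pi>_dual[OF f])
    have "\<pi> f (S m x) = f (S m x)" if "x \<in> vecs X" for m x using \<pi>_J[OF f S_mem[OF that]] .
    then show "\<pi> (\<pi> f) = \<pi> f" by (simp add: fun_eq_iff \<pi>_def)
    fix c
    have "\<pi> (scl (dual X) c f) x = c * \<pi> f x" for x
    proof (cases "x \<in> vecs X")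
      case True
      have "((\<lambda>m. scl (dual X) c f (S m x)) \<longlongrightarrow> c * \<pi> f x) U"
        using tendsto_mult_left[OF \<pi>[OF f True], of c] by simp
      then show ?thesis using tendsto_unique[OF U(2) \<pi>[OF dual_scale[OF f] True]] by simp
    qed (simp add: \<pi>_def)
    then show "\<pi> (scl (dual X) c f) = scl (dual X) c (\<pi> f)" by (simp add: fun_eq_iff)
  next
    fix f g assume fg: "f \<in> vecs (dual X)" "g \<in> vecs (dual X)"
    have "\<pi> (f + g) x = \<pi> f x + \<pi> g x" for x
    proof (cases "x \<in> vecs X")
      case True
      have "((\<lambda>m. (f + g) (S m x)) \<longlongrightarrow> \<pi> f x + \<pi> g x) U"
        using tendsto_add[OF \<pi>[OF fg(1) True] \<pi>[OF fg(2) True]] by simp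
      then show ?thesis using tendsto_unique[OF U(2) \<pi>[OF dual_plus[OF fg] True]] by simp
    qed (simp add: \<pi>_def)
    then show "\<pi> (f + g) = \<pi> f + \<pi> g" by (simp add: fun_eq_iff)
  qed
  moreover have "{f \<in> vecs (dual X). \<pi> f = 0} = annihilator X J"
  proof (rule set_eqI)
    fix f
    show "f \<in> {f \<in> vecs (dual X). \<pi> f = 0} \<longleftrightarrow> f \<in> annihilator X J"
    proof (cases "f \<in> vecs (dual X)")
      case True
      have "\<pi> f = 0" if "\<forall>x\<in>J. f x = 0"
      proof
        fix x
        show "\<pi> f x = 0 x"
          using \<pi>_bound[OF True, of 0 x] that by (cases "x \<in> vecs X") (auto simp: \<pi>_def)
      qed
      moreover have "\<forall>x\<in>J. f x = 0" if "\<pi> f = 0"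
        using \<pi>_J[OF True] that by simp
      ultimately show ?thesis using True by (auto simp: annihilator_def)
    qed (simp add: annihilator_def)
  qed
  moreover have "nrm (dual X) f = nrm (dual X) (\<pi> f) + nrm (dual X) (f - \<pi> f)" if f: "f \<in> vecs (dual X)" for f
    using le[OF f] nrm_dual_triangle[OF f \<pi>_dual[OF f]] by simp
  ultimately show ?thesis unfolding M_ideal_def using assms(1-4) by blast
qed

end

section \<open>Weakly continuous polynomials form a closed subspace\<close>

context normed_pair
begin

lemma weakly_continuousD:
  assumes "weakly_continuous_on_bounded X Y P" "x \<in> vecs X"
    "\<forall>\<^sub>F y in F. y \<in> vecs X \<and> nrm X y \<le> r" "\<And>f. f \<in> vecs (dual X) \<Longrightarrow> (f \<longlongrightarrow> f x) F"
  shows "Y.nlim P (P x) F"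
  using assms unfolding weakly_continuous_on_bounded_def Y.nlim_def by blast

lemma weakly_continuousI:
  assumes "\<And>F r x. x \<in> vecs X \<Longrightarrow> \<forall>\<^sub>F y in F. y \<in> vecs X \<and> nrm X y \<le> r \<Longrightarrow>
    (\<And>f. f \<in> vecs (dual X) \<Longrightarrow> (f \<longlongrightarrow> f x) F) \<Longrightarrow> Y.nlim P (P x) F"
  shows "weakly_continuous_on_bounded X Y P"
  using assms unfolding weakly_continuous_on_bounded_def Y.nlim_def by blast

lemma weakly_continuous_add:
  assumes "weakly_continuous_on_bounded X Y P" "weakly_continuous_on_bounded X Y Q"
    "\<And>x. P x \<in> vecs Y" "\<And>x. Q x \<in> vecs Y"
  shows "weakly_continuous_on_bounded X Y (\<lambda>x. P x + Q x)"
  by (rule weakly_continuousI) (blast intro: Y.nlim_add weakly_continuousD assms)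

lemma weakly_continuous_scl:
  assumes "weakly_continuous_on_bounded X Y P" "\<And>x. P x \<in> vecs Y"
  shows "weakly_continuous_on_bounded X Y (\<lambda>x. scl Y c (P x))"
  by (rule weakly_continuousI) (blast intro: Y.nlim_scl weakly_continuousD assms)

lemma subspace_weak_polys: "module.subspace (scl (poly_space n X Y)) (weak_polys n X Y)"
proof -
  interpret Z: normed_on "poly_space n X Y" by (rule normed_on_poly_space)
  show ?thesis
  proof (rule Z.subspaceI)
    have "weakly_continuous_on_bounded X Y 0"
      by (rule weakly_continuousI) (simp add: Y.nlim_def)
    then show "0 \<in> weak_polys n X Y" by (simp add: weak_polys_def)
  next
    fix P Q assume PQ: "P \<in> weak_polys n X Y" "Q \<in> weak_polys n X Y"
    then have "weakly_continuous_on_bounded X Y (P + Q)"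
      unfolding plus_fun_def using poly_mem
      by (intro weakly_continuous_add) (auto simp: weak_polys_def)
    then show "P + Q \<in> weak_polys n X Y" using PQ by (simp add: weak_polys_def)
  next
    fix c P assume P: "P \<in> weak_polys n X Y"
    then have "weakly_continuous_on_bounded X Y (\<lambda>x. scl Y c (P x))"
      using poly_mem by (intro weakly_continuous_scl) (auto simp: weak_polys_def)
    then show "scl (poly_space n X Y) c P \<in> weak_polys n X Y"
      using P Z.scl_vecs[of P c] by (simp add: weak_polys_def)
  qed
qed

text \<open>Convergence in the polynomial norm is uniform on bounded sets, so the usual three-term
  estimate applies along a bounded net.\<close>

lemma closedin_weak_polys: "closedin (ntop (poly_space n X Y)) (weak_polys n X Y)"
proof -
  let ?Z = "poly_space n X Y"
  interpret Z: normed_on ?Z by (rule normed_on_poly_space)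
  show ?thesis
  proof (rule Z.closedin_ntopI)
    show "weak_polys n X Y \<subseteq> vecs ?Z" by (auto simp: weak_polys_def)
    fix u :: "nat \<Rightarrow> 'v \<Rightarrow> 'w" and P
    assume u: "\<And>m. u m \<in> weak_polys n X Y" and P: "P \<in> vecs ?Z"
      and lim: "(\<lambda>m. nrm ?Z (u m - P)) \<longlonglongrightarrow> 0"
    have uZ: "u m \<in> vecs ?Z" and uw: "weakly_continuous_on_bounded X Y (u m)" for m
      using u by (auto simp: weak_polys_def)
    have "weakly_continuous_on_bounded X Y P"
    proof (rule weakly_continuousI)
      fix F r x
      assume x: "x \<in> vecs X" and F: "\<forall>\<^sub>F y in F. y \<in> vecs X \<and> nrm X y \<le> r"
        and wk: "\<And>f. f \<in> vecs (dual X) \<Longrightarrow> (f \<longlongrightarrow> f x) F"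
      \<comment> \<open>By homogeneity the error on a ball grows like the n-th power of the radius;
        \<open>B\<close> covers the net and its limit together.\<close>
      define B where "B = \<bar>r\<bar> ^ n + nrm X x ^ n + 1"
      have B: "0 < B" using X.nrm_ge_0[OF x] by (simp add: B_def add_nonneg_pos)
      show "Y.nlim P (P x) F" unfolding Y.nlim_def
      proof (rule tendstoI)
        fix e :: real assume e: "0 < e"
        have "\<forall>\<^sub>F m in sequentially. nrm ?Z (u m - P) < e / (2 * B)"
          using order_tendstoD(2)[OF lim, of "e / (2 * B)"] e B by simp
        then obtain m where m: "nrm ?Z (u m - P) < e / (2 * B)"
          by (auto simp: eventually_sequentially)
        have "\<forall>\<^sub>F y in F. nrm Y (u m y - u m x) < e / 2"
          using order_tendstoD(2)[OF weakly_continuousD[OF uw[of m] x F wk, unfolded Y.nlim_def], of "e / 2"] e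
          by simp
        with F show "\<forall>\<^sub>F y in F. dist (nrm Y (P y - P x)) 0 < e"
        proof eventually_elim
          case (elim y)
          have mP: "u m - P \<in> vecs ?Z" using uZ P by simp
          have 1: "nrm Y (u m z - P z) \<le> nrm ?Z (u m - P) * nrm X z ^ n" if "z \<in> vecs X" for z
            using nrm_poly_pow[OF mP that] by simp
          have "nrm X y ^ n \<le> \<bar>r\<bar> ^ n" using elim X.nrm_ge_0[of y] by (intro power_mono) auto
          then have "nrm ?Z (u m - P) * nrm X y ^ n + nrm ?Z (u m - P) * nrm X x ^ n \<le> nrm ?Z (u m - P) * B"
            unfolding distrib_left[symmetric] B_def using Z.nrm_ge_0[OF mP] by (intro mult_left_mono) auto
          also have "\<dots> < e / 2" using m B by (simp add: field_simps)
          finally have 2: "nrm Y (u m y - P y) + nrm Y (u m x - P x) < e / 2"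
            using 1[of y] 1[of x] elim x by simp
          have Ymem: "u m y \<in> vecs Y" "u m x \<in> vecs Y" "P y \<in> vecs Y" "P x \<in> vecs Y"
            using poly_mem[OF uZ] poly_mem[OF P] by auto
          have "nrm Y (P y - P x) \<le> nrm Y (P y - u m y) + nrm Y (u m y - P x)"
            by (intro Y.nrm_diff_triangle Ymem)
          also have "nrm Y (u m y - P x) \<le> nrm Y (u m y - u m x) + nrm Y (u m x - P x)"
            by (intro Y.nrm_diff_triangle Ymem)
          finally have "nrm Y (P y - P x) < e"
            using 2 elim Y.nrm_diff_commute[OF Ymem(1,3)] by simp
          then show ?case using Y.nrm_ge_0[of "P y - P x"] Ymem by simp
        qed
      qed
    qed
    then show "P \<in> weak_polys n X Y" using P by (simp add: weak_polys_def)
  qed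
qed

end

section \<open>Weighted sequence spaces\<close>

text \<open>If a or b is 0, the claim reduces to \<open>m powr q\<close> \<le> m for m in [0,1];
  otherwise it is convexity of the power.\<close>

lemma powr_convex_combination:
  fixes a b l q :: real
  assumes "1 \<le> q" "0 \<le> a" "0 \<le> b" "0 \<le> l" "l \<le> 1"
  shows "(l * a + (1 - l) * b) powr q \<le> l * a powr q + (1 - l) * b powr q"
proof -
  have le: "(m * c) powr q \<le> m * c powr q" if "0 \<le> m" "m \<le> 1" "0 \<le> c" for m c :: real
  proof -
    have "m powr q \<le> m powr 1" using that assms(1) by (intro powr_mono') auto
    then show ?thesis using that by (simp add: powr_mult mult_right_mono)
  qed
  consider "a = 0" | "b = 0" | "0 < a" "0 < b" using assms by fastforce
  then show ?thesis
  proof cases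
    case 1
    then show ?thesis using le[of "1 - l" b] assms by simp
  next
    case 2
    then show ?thesis using le[of l a] assms by simp
  next
    case 3
    then show ?thesis
      using convex_onD[OF powr_convex[OF assms(1)], of "1 - l" a b] assms by simp
  qed
qed

text \<open>Convexity of the power, applied to a/A and b/B with the weights A/(A+B) and B/(A+B).
  Only upper bounds A and B are assumed, so that norms can be inserted for the finite partial sums;
  a zero bound makes one summand negligible.\<close>

lemma Minkowski_sum:
  fixes v a b :: "'i \<Rightarrow> real"
  assumes q: "1 \<le> q" and AB: "0 \<le> A" "0 \<le> B"
    and nonneg: "\<And>i. i \<in> I \<Longrightarrow> 0 \<le> v i" "\<And>i. i \<in> I \<Longrightarrow> 0 \<le> a i" "\<And>i. i \<in> I \<Longrightarrow> 0 \<le> b i"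
    and a: "(\<Sum>i\<in>I. v i * a i powr q) \<le> A powr q" and b: "(\<Sum>i\<in>I. v i * b i powr q) \<le> B powr q"
  shows "(\<Sum>i\<in>I. v i * (a i + b i) powr q) \<le> (A + B) powr q"
proof (cases "finite I")
  case fin: True
  have degenerate: "(\<Sum>i\<in>I. v i * (c i + d i) powr q) = (\<Sum>i\<in>I. v i * d i powr q)"
    if "(\<Sum>i\<in>I. v i * c i powr q) \<le> 0" "\<And>i. i \<in> I \<Longrightarrow> 0 \<le> c i" for c d
  proof -
    have "(\<Sum>i\<in>I. v i * c i powr q) = 0"
      using that nonneg by (intro antisym sum_nonneg) auto
    then have "\<forall>i\<in>I. v i * c i powr q = 0"
      using fin nonneg by (subst (asm) sum_nonneg_eq_0_iff) auto
    then show ?thesis by (intro sum.cong) auto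
  qed
  consider "A = 0" | "B = 0" | "0 < A" "0 < B" using AB by fastforce
  then show ?thesis
  proof cases
    case 1
    then show ?thesis using degenerate[of a b] a b nonneg by simp
  next
    case 2
    then show ?thesis using degenerate[of b a] a b nonneg by (simp add: add.commute)
  next
    case 3
    define l where "l = A / (A + B)"
    have l: "0 \<le> l" "l \<le> 1" "1 - l = B / (A + B)" using 3 by (auto simp: l_def field_simps)
    have eq: "(\<Sum>i\<in>I. v i * (a i + b i) powr q) =
        (A + B) powr q * (\<Sum>i\<in>I. v i * (l * (a i / A) + (1 - l) * (b i / B)) powr q)"
      unfolding sum_distrib_left
    proof (rule sum.cong)
      fix i assume i: "i \<in> I"
      have "a i + b i = (A + B) * (l * (a i / A) + (1 - l) * (b i / B))"
      proof -
        have "(A + B) * (l * (a i / A)) = a i" "(A + B) * (B / (A + B) * (b i / B)) = b i"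
          using 3 by (auto simp: l_def)
        then show ?thesis unfolding l(3) distrib_left by simp
      qed
      then have "(a i + b i) powr q = (A + B) powr q * (l * (a i / A) + (1 - l) * (b i / B)) powr q"
        using 3 nonneg[OF i] l by (metis (no_types) powr_mult add_nonneg_nonneg less_imp_le mult_nonneg_nonneg divide_nonneg_pos diff_ge_0_iff_ge)
      then show "v i * (a i + b i) powr q = (A + B) powr q * (v i * (l * (a i / A) + (1 - l) * (b i / B)) powr q)"
        by simp
    qed simp
    have "(\<Sum>i\<in>I. v i * (l * (a i / A) + (1 - l) * (b i / B)) powr q) \<le>
        (\<Sum>i\<in>I. v i * (l * (a i / A) powr q + (1 - l) * (b i / B) powr q))"
      using nonneg 3 l by (intro sum_mono mult_left_mono powr_convex_combination q) auto
    also have "\<dots> = l * ((\<Sum>i\<in>I. v i * a i powr q) / A powr q) + (1 - l) * ((\<Sum>i\<in>I. v i * b i powr q) / B powr q)"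
    proof -
      have "v i * (l * (a i / A) powr q + (1 - l) * (b i / B) powr q) =
          l * (v i * a i powr q / A powr q) + (1 - l) * (v i * b i powr q / B powr q)" if "i \<in> I" for i
        using nonneg[OF that] 3 by (simp add: powr_divide algebra_simps)
      then show ?thesis by (simp add: sum.distrib sum_distrib_left sum_divide_distrib cong: sum.cong)
    qed
    also have "\<dots> \<le> l * 1 + (1 - l) * 1"
      using l 3 a b by (intro add_mono mult_left_mono) auto
    finally have "(\<Sum>i\<in>I. v i * (l * (a i / A) + (1 - l) * (b i / B)) powr q) \<le> 1" by simp
    from mult_left_mono[OF this, of "(A + B) powr q"] show ?thesis unfolding eq by simp
  qed
qed simp

definition restr :: "nat set \<Rightarrow> (nat \<Rightarrow> 'a::zero) \<Rightarrow> nat \<Rightarrow> 'a" where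
  "restr A x = (\<lambda>i. if i \<in> A then x i else 0)"

lemma restr_apply [simp]: "restr A x i = (if i \<in> A then x i else 0)"
  by (simp add: restr_def)

lemma restr_add: "restr A (x + y) = restr A x + restr A (y::nat \<Rightarrow> 'a::monoid_add)"
  by (simp add: fun_eq_iff)

lemma restr_diff: "restr A (x - y) = restr A x - restr A (y::nat \<Rightarrow> 'a::group_add)"
  by (simp add: fun_eq_iff)

lemma restr_mult: "restr A (\<lambda>i. c * x i) = (\<lambda>i. c * restr A x i :: 'a::mult_zero)"
  by (simp add: fun_eq_iff)

lemma restr_0 [simp]: "restr A 0 = 0"
  by (simp add: fun_eq_iff)

lemma restr_restr: "restr A (restr B x) = restr (A \<inter> B) x"
  by (simp add: fun_eq_iff)

lemma restr_split: "restr {..<m} x + restr {m..} (x::nat \<Rightarrow> 'a::monoid_add) = x"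
  by (auto simp: fun_eq_iff)

definition unit_vec :: "nat \<Rightarrow> nat \<Rightarrow> 'a::zero_neq_one" where
  "unit_vec i j = (if j = i then 1 else 0)"

lemma sum_fun_apply: "sum f I x = (\<Sum>i\<in>I. f i x :: 'a::comm_monoid_add)"
  by (induction I rule: infinite_finite_induct) auto

text \<open>
  Sequence spaces whose norm is the supremum of weighted \<open>q\<close>-norms over a set \<^term>\<open>T\<close> of
  rearrangements: the identity alone gives \<open>\<ell>\<^sub>p\<close>, all bijections give the Lorentz space.
\<close>

locale seq_space =
  fixes X :: "('k::real_or_complex, nat \<Rightarrow> 'k) nspace" and v :: "nat \<Rightarrow> real" and q :: real
    and T :: "(nat \<Rightarrow> nat) set"
  assumes q: "1 \<le> q"
    and scl_def: "scl X = (\<lambda>c x i. c * x i)"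
    and v: "0 \<le> v j" "v j \<le> 1"
    and inj_T: "\<tau> \<in> T \<Longrightarrow> inj \<tau>"
    and ball: "0 \<le> A \<Longrightarrow> x \<in> vecs X \<and> nrm X x \<le> A \<longleftrightarrow>
      (\<forall>\<tau>\<in>T. \<forall>N. (\<Sum>j<N. v j * norm (x (\<tau> j)) powr q) \<le> A powr q)"
    and nrm_nonneg: "x \<in> vecs X \<Longrightarrow> 0 \<le> nrm X x"
    and coord_le: "x \<in> vecs X \<Longrightarrow> norm (x i) \<le> nrm X x"
begin

lemma nballI:
  assumes "0 \<le> A" "\<And>\<tau> N. \<tau> \<in> T \<Longrightarrow> (\<Sum>j<N. v j * norm (x (\<tau> j)) powr q) \<le> A powr q"
  shows "x \<in> vecs X" "nrm X x \<le> A"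
  using ball[of A x] assms by blast+

lemma nballD:
  assumes "x \<in> vecs X" "nrm X x \<le> A" "\<tau> \<in> T"
  shows "(\<Sum>j<N. v j * norm (x (\<tau> j)) powr q) \<le> A powr q"
  using ball[of A x] assms nrm_nonneg[of x] by fastforce

lemma solid:
  assumes "x \<in> vecs X" "\<And>i. norm (y i) \<le> norm (x i)"
  shows "y \<in> vecs X" "nrm X y \<le> nrm X x"
proof -
  have "(\<Sum>j<N. v j * norm (y (\<tau> j)) powr q) \<le> nrm X x powr q" if "\<tau> \<in> T" for \<tau> N
  proof -
    have "(\<Sum>j<N. v j * norm (y (\<tau> j)) powr q) \<le> (\<Sum>j<N. v j * norm (x (\<tau> j)) powr q)"
      using assms v q by (intro sum_mono mult_left_mono powr_mono2) auto
    also have "\<dots> \<le> nrm X x powr q" by (rule nballD[OF assms(1) order_refl that])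
    finally show ?thesis .
  qed
  then show "y \<in> vecs X" "nrm X y \<le> nrm X x"
    using nballI[of "nrm X x" y] nrm_nonneg[OF assms(1)] by blast+
qed

lemma zero_mem: "0 \<in> vecs X" "nrm X 0 = 0"
  using nballI[of 0 0] nrm_nonneg[of 0] by (auto intro: antisym)

lemma add_mem:
  assumes "x \<in> vecs X" "y \<in> vecs X"
  shows "x + y \<in> vecs X" "nrm X (x + y) \<le> nrm X x + nrm X y"
proof -
  have "(\<Sum>j<N. v j * norm ((x + y) (\<tau> j)) powr q) \<le> (nrm X x + nrm X y) powr q" if "\<tau> \<in> T" for \<tau> N
  proof -
    have "(\<Sum>j<N. v j * norm ((x + y) (\<tau> j)) powr q) \<le> (\<Sum>j<N. v j * (norm (x (\<tau> j)) + norm (y (\<tau> j))) powr q)"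
      using v q by (intro sum_mono mult_left_mono powr_mono2) (auto simp: norm_triangle_ineq)
    also have "\<dots> \<le> (nrm X x + nrm X y) powr q"
      using assms v that by (intro Minkowski_sum q nrm_nonneg nballD) auto
    finally show ?thesis .
  qed
  then show "x + y \<in> vecs X" "nrm X (x + y) \<le> nrm X x + nrm X y"
    using nballI[of "nrm X x + nrm X y" "x + y"] nrm_nonneg[OF assms(1)] nrm_nonneg[OF assms(2)]
    by (meson add_nonneg_nonneg)+
qed

lemma scl_mem:
  assumes "x \<in> vecs X"
  shows "(\<lambda>i. c * x i) \<in> vecs X" "nrm X (\<lambda>i. c * x i) = norm c * nrm X x"
proof -
  have *: "(\<lambda>i. c * x i) \<in> vecs X \<and> nrm X (\<lambda>i. c * x i) \<le> norm c * nrm X x" if x: "x \<in> vecs X" for c x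
  proof -
    have "(\<Sum>j<N. v j * norm (c * x (\<tau> j)) powr q) \<le> (norm c * nrm X x) powr q" if "\<tau> \<in> T" for \<tau> N
    proof -
      have "(\<Sum>j<N. v j * norm (c * x (\<tau> j)) powr q) = norm c powr q * (\<Sum>j<N. v j * norm (x (\<tau> j)) powr q)"
        by (simp add: sum_distrib_left norm_mult powr_mult ac_simps)
      also have "\<dots> \<le> norm c powr q * nrm X x powr q"
        by (intro mult_left_mono nballD[OF x order_refl that]) auto
      finally show ?thesis using nrm_nonneg[OF x] by (simp add: powr_mult)
    qed
    then show ?thesis
      using nballI[of "norm c * nrm X x" "\<lambda>i. c * x i"] nrm_nonneg[OF x]
      by (meson mult_nonneg_nonneg norm_ge_zero)
  qed
  show "(\<lambda>i. c * x i) \<in> vecs X" using * assms by blast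
  show "nrm X (\<lambda>i. c * x i) = norm c * nrm X x"
  proof (cases "c = 0")
    case True
    then show ?thesis using zero_mem by (simp add: zero_fun_def)
  next
    case False
    have "nrm X (\<lambda>i. inverse c * (c * x i)) \<le> norm (inverse c) * nrm X (\<lambda>i. c * x i)"
      using * assms by blast
    moreover have "(\<lambda>i. inverse c * (c * x i)) = x"
      using False by (simp add: fun_eq_iff mult.assoc[symmetric])
    ultimately have "norm c * nrm X x \<le> nrm X (\<lambda>i. c * x i)"
      using False by (simp add: norm_divide field_simps)
    then show ?thesis using *[OF assms, of c] by simp
  qed
qed

sublocale normed_on X
proof (rule normed_on.intro)
  show vs: "vector_space (scl X)"
    unfolding scl_def by standard (auto simp: fun_eq_iff algebra_simps)
  interpret vector_space "scl X" by (rule vs)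
  show "module.subspace (scl X) (vecs X)"
    by (rule subspaceI) (auto simp: zero_mem add_mem scl_mem scl_def)
  fix x assume x: "x \<in> vecs X"
  show "0 \<le> nrm X x" by (rule nrm_nonneg[OF x])
  show "nrm X x = 0 \<longleftrightarrow> x = 0"
  proof
    assume "nrm X x = 0"
    then show "x = 0" using coord_le[OF x] by (auto simp: fun_eq_iff)
  qed (simp add: zero_mem)
  show "nrm X (scl X c x) = norm c * nrm X x" for c
    using scl_mem[OF x] by (simp add: scl_def)
  fix y assume "y \<in> vecs X"
  with x show "nrm X (x + y) \<le> nrm X x + nrm X y" by (rule add_mem)
qed

lemma restr_mem [simp]:
  assumes "x \<in> vecs X"
  shows "restr A x \<in> vecs X"
  using solid(1)[of x "restr A x"] assms by simp

lemma nrm_restr_le: "x \<in> vecs X \<Longrightarrow> nrm X (restr A x) \<le> nrm X x"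
  using solid(2)[of x "restr A x"] by simp

text \<open>The upper q-estimate. Along each single rearrangement the sum splits exactly, and each
  part is bounded by its own supremum.\<close>

lemma nrm_disjoint:
  assumes "x \<in> vecs X" "y \<in> vecs X" "\<And>i. x i = 0 \<or> y i = 0"
  shows "nrm X (x + y) powr q \<le> nrm X x powr q + nrm X y powr q"
proof -
  let ?A = "(nrm X x powr q + nrm X y powr q) powr (1 / q)"
  have A: "?A powr q = nrm X x powr q + nrm X y powr q" using q by (simp add: powr_powr)
  have "(\<Sum>j<N. v j * norm ((x + y) (\<tau> j)) powr q) \<le> ?A powr q" if "\<tau> \<in> T" for \<tau> N
  proof -
    have "norm ((x + y) i) powr q = norm (x i) powr q + norm (y i) powr q" for i
      using assms(3)[of i] q by auto
    then have "(\<Sum>j<N. v j * norm ((x + y) (\<tau> j)) powr q) =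
        (\<Sum>j<N. v j * norm (x (\<tau> j)) powr q) + (\<Sum>j<N. v j * norm (y (\<tau> j)) powr q)"
      by (simp add: distrib_left sum.distrib)
    also have "\<dots> \<le> ?A powr q"
      unfolding A by (intro add_mono nballD[OF _ order_refl that] assms)
    finally show ?thesis .
  qed
  then have "nrm X (x + y) \<le> ?A" by (intro nballI) auto
  then have "nrm X (x + y) powr q \<le> ?A powr q" using q nrm_nonneg assms by (intro powr_mono2) auto
  then show ?thesis unfolding A .
qed

text \<open>The weights are at most 1 and rearrangements are injective, so the norm is dominated by
  the unweighted q-norm.\<close>

lemma finite_support_mem:
  assumes "finite S" "\<And>i. i \<notin> S \<Longrightarrow> x i = 0"
  shows "x \<in> vecs X" "nrm X x powr q \<le> (\<Sum>i\<in>S. norm (x i) powr q)"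
proof -
  let ?A = "(\<Sum>i\<in>S. norm (x i) powr q) powr (1 / q)"
  have A: "?A powr q = (\<Sum>i\<in>S. norm (x i) powr q)" using q by (simp add: powr_powr sum_nonneg)
  have le: "(\<Sum>j<N. v j * norm (x (\<tau> j)) powr q) \<le> ?A powr q" if \<tau>: "\<tau> \<in> T" for \<tau> N
  proof -
    have "(\<Sum>j<N. v j * norm (x (\<tau> j)) powr q) \<le> (\<Sum>j<N. norm (x (\<tau> j)) powr q)"
      using v by (intro sum_mono) (simp add: mult_left_le_one_le)
    also have "\<dots> = (\<Sum>i\<in>\<tau> ` {..<N}. norm (x i) powr q)"
      using inj_T[OF \<tau>] by (subst sum.reindex) (auto intro: inj_on_subset)
    also have "\<dots> = (\<Sum>i\<in>\<tau> ` {..<N} \<inter> S. norm (x i) powr q)"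
      using assms q by (intro sum.mono_neutral_right) auto
    also have "\<dots> \<le> (\<Sum>i\<in>S. norm (x i) powr q)"
      using assms by (intro sum_mono2) auto
    finally show ?thesis unfolding A .
  qed
  have 1: "x \<in> vecs X" "nrm X x \<le> ?A" using nballI[of ?A x] le powr_ge_zero by blast+
  then show "x \<in> vecs X" by blast
  have "nrm X x powr q \<le> ?A powr q" using 1 nrm_nonneg q by (intro powr_mono2) auto
  then show "nrm X x powr q \<le> (\<Sum>i\<in>S. norm (x i) powr q)" unfolding A .
qed

lemma unit_vec_mem [simp]: "unit_vec i \<in> vecs X"
  using finite_support_mem(1)[of "{i}" "unit_vec i"] by (simp add: unit_vec_def)

lemma nrm_unit_vec [simp]: "nrm X (unit_vec i) = 1"
proof (rule antisym)
  show "1 \<le> nrm X (unit_vec i)" using coord_le[of "unit_vec i" i] by (simp add: unit_vec_def)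
  have "nrm X (unit_vec i) powr q \<le> 1"
    using finite_support_mem(2)[of "{i}" "unit_vec i"] by (simp add: unit_vec_def)
  then show "nrm X (unit_vec i) \<le> 1"
    using \<open>1 \<le> nrm X (unit_vec i)\<close> q by (smt (verit) gr_one_powr)
qed

lemma restr_finite_mem: "finite A \<Longrightarrow> restr A x \<in> vecs X"
  by (rule finite_support_mem(1)[of A]) auto

lemma coord_dual: "(\<lambda>x. if x \<in> vecs X then x i else 0) \<in> vecs (dual X)"
  unfolding vecs_dual using coord_le[of _ i]
  by (auto simp: scl_def add_mem scl_mem intro!: exI[of _ 1])

text \<open>Bounds on the norm are bounds on finite partial sums, and these survive coordinatewise
  limits, as in Fatou's lemma.\<close>

lemma complete: "ms.mcomplete"
proof (rule mcompleteI)
  fix u :: "nat \<Rightarrow> nat \<Rightarrow> 'k"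
  assume u: "\<And>m. u m \<in> vecs X"
    and cauchy: "\<And>e. 0 < e \<Longrightarrow> \<exists>N. \<forall>m\<ge>N. \<forall>l\<ge>N. nrm X (u m - u l) < e"
  have "\<exists>l. (\<lambda>m. u m i) \<longlonglongrightarrow> l" for i
  proof (rule scalar_Cauchy_convergent, rule CauchyI)
    fix e :: real assume "0 < e"
    then obtain N where N: "\<And>m l. N \<le> m \<Longrightarrow> N \<le> l \<Longrightarrow> nrm X (u m - u l) < e" using cauchy by blast
    have "norm (u m i - u l i) < e" if "N \<le> m" "N \<le> l" for m l
      using coord_le[of "u m - u l" i] N[OF that] u by simp
    then show "\<exists>M. \<forall>m\<ge>M. \<forall>n\<ge>M. norm (u m i - u n i) < e" by blast
  qed
  then obtain x where x: "\<And>i. (\<lambda>m. u m i) \<longlonglongrightarrow> x i" by metis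
  have tail: "\<exists>N. \<forall>m\<ge>N. u m - x \<in> vecs X \<and> nrm X (u m - x) \<le> e" if e: "0 < e" for e
  proof -
    obtain N where N: "\<And>m l. N \<le> m \<Longrightarrow> N \<le> l \<Longrightarrow> nrm X (u m - u l) < e" using cauchy e by blast
    have "u m - x \<in> vecs X \<and> nrm X (u m - x) \<le> e" if m: "N \<le> m" for m
    proof -
      have "(\<Sum>j<K. v j * norm ((u m - x) (\<tau> j)) powr q) \<le> e powr q" if \<tau>: "\<tau> \<in> T" for \<tau> K
      proof (rule LIMSEQ_le_const2)
        show "(\<lambda>l. \<Sum>j<K. v j * norm (u m (\<tau> j) - u l (\<tau> j)) powr q) \<longlonglongrightarrow>
            (\<Sum>j<K. v j * norm ((u m - x) (\<tau> j)) powr q)"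
          using q x by (auto intro!: tendsto_intros tendsto_powr')
        have "(\<Sum>j<K. v j * norm (u m (\<tau> j) - u l (\<tau> j)) powr q) \<le> e powr q" if l: "N \<le> l" for l
          using nballD[of "u m - u l" e \<tau> K] N[OF m l] u \<tau> by simp
        then show "\<exists>M. \<forall>l\<ge>M. (\<Sum>j<K. v j * norm (u m (\<tau> j) - u l (\<tau> j)) powr q) \<le> e powr q" by blast
      qed
      then show ?thesis using e nballI[of e "u m - x"] less_imp_le by blast
    qed
    then show ?thesis by blast
  qed
  obtain m where "u m - x \<in> vecs X" using tail[of 1] by auto
  then have xX: "x \<in> vecs X" using u[of m] diff_vecs[of "u m" "u m - x"] by simp
  have "(\<lambda>m. nrm X (u m - x)) \<longlonglongrightarrow> 0"
  proof (rule LIMSEQ_I)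
    fix r :: real assume r: "0 < r"
    obtain N where "\<And>m. N \<le> m \<Longrightarrow> nrm X (u m - x) \<le> r / 2" using tail[of "r / 2"] r by auto
    then have "norm (nrm X (u m - x) - 0) < r" if "N \<le> m" for m
      using r that nrm_ge_0[of "u m - x"] u xX by fastforce
    then show "\<exists>N. \<forall>m\<ge>N. norm (nrm X (u m - x) - 0) < r" by blast
  qed
  with xX show "\<exists>x\<in>vecs X. (\<lambda>m. nrm X (u m - x)) \<longlonglongrightarrow> 0" by blast
qed

end

section \<open>The space of p-summable sequences\<close>

lemma vecs_lp: "x \<in> vecs (lp_space p) \<longleftrightarrow> summable (\<lambda>i. norm (x i) powr p)"
  by (simp add: lp_space_def ell_def)

lemma nrm_lp: "nrm (lp_space p) x = (\<Sum>i. norm (x i) powr p) powr (1 / p)"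
  by (simp add: lp_space_def)

lemma nrm_lp_powr:
  assumes "0 < p" "x \<in> vecs (lp_space p)"
  shows "nrm (lp_space p) x powr p = (\<Sum>i. norm (x i) powr p)"
  using assms suminf_nonneg[of "\<lambda>i. norm (x i) powr p"]
  by (simp add: nrm_lp vecs_lp powr_powr)

lemma seq_space_lp:
  assumes "1 \<le> p"
  shows "seq_space (lp_space p :: ('k::real_or_complex, nat \<Rightarrow> 'k) nspace) (\<lambda>_. 1) p {id}"
proof
  let ?X = "lp_space p :: ('k, nat \<Rightarrow> 'k) nspace"
  show "1 \<le> p" by fact
  show "scl ?X = (\<lambda>c x i. c * x i)" by (simp add: lp_space_def)
  fix x :: "nat \<Rightarrow> 'k"
  show "0 \<le> nrm ?X x" if "x \<in> vecs ?X" by (simp add: nrm_lp)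
  show "norm (x i) \<le> nrm ?X x" if x: "x \<in> vecs ?X" for i
  proof -
    have "norm (x i) powr p \<le> (\<Sum>i. norm (x i) powr p)"
      using sum_le_suminf[of "\<lambda>i. norm (x i) powr p" "{i}"] x by (simp add: vecs_lp)
    then have "(norm (x i) powr p) powr (1 / p) \<le> nrm ?X x"
      unfolding nrm_lp using assms by (intro powr_mono2) auto
    then show ?thesis using assms by (simp add: powr_powr)
  qed
  fix A :: real assume A: "0 \<le> A"
  have "x \<in> vecs ?X \<and> nrm ?X x \<le> A \<longleftrightarrow> (\<forall>N. (\<Sum>j<N. norm (x j) powr p) \<le> A powr p)"
  proof
    assume x: "x \<in> vecs ?X \<and> nrm ?X x \<le> A"
    then have "nrm ?X x powr p \<le> A powr p" using assms by (intro powr_mono2) (auto simp: nrm_lp)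
    then have "(\<Sum>i. norm (x i) powr p) \<le> A powr p" using x assms by (simp add: nrm_lp_powr)
    moreover have "(\<Sum>j<N. norm (x j) powr p) \<le> (\<Sum>i. norm (x i) powr p)" for N
      using x by (intro sum_le_suminf) (auto simp: vecs_lp)
    ultimately show "\<forall>N. (\<Sum>j<N. norm (x j) powr p) \<le> A powr p" by (meson order_trans)
  next
    assume le: "\<forall>N. (\<Sum>j<N. norm (x j) powr p) \<le> A powr p"
    then have s: "summable (\<lambda>j. norm (x j) powr p)"
      by (intro summableI_nonneg_bounded[where x = "A powr p"]) auto
    then have "(\<Sum>j. norm (x j) powr p) \<le> A powr p" using le by (intro suminf_le_const) auto
    then have "nrm ?X x \<le> (A powr p) powr (1 / p)"
      unfolding nrm_lp using assms s by (intro powr_mono2) (auto intro: suminf_nonneg)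
    then show "x \<in> vecs ?X \<and> nrm ?X x \<le> A" using s A assms by (simp add: vecs_lp powr_powr)
  qed
  then show "x \<in> vecs ?X \<and> nrm ?X x \<le> A \<longleftrightarrow>
      (\<forall>\<tau>\<in>{id}. \<forall>N. (\<Sum>j<N. 1 * norm (x (\<tau> j)) powr p) \<le> A powr p)" by simp
qed auto

text \<open>An equality, in contrast to the one-sided estimate for disjoint supports; it keeps the
  p-th powers of head and tail of a unit vector below 1 in total.\<close>

lemma lp_restr_split:
  fixes x :: "nat \<Rightarrow> 'k::real_or_complex"
  assumes p: "1 \<le> p" and x: "x \<in> vecs (lp_space p)"
  shows "nrm (lp_space p) (restr {..<m} x) powr p + nrm (lp_space p) (restr {m..} x) powr p
    = nrm (lp_space p) x powr p"
proof -
  interpret E: seq_space "lp_space p :: ('k, nat \<Rightarrow> 'k) nspace" "\<lambda>_. 1" p "{id}" by (rule seq_space_lp[OF p])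
  have s: "summable (\<lambda>i. norm (restr A x i) powr p)" for A
    using E.restr_mem[OF x, of A] unfolding vecs_lp .
  have "norm (restr {..<m} x i) powr p + norm (restr {m..} x i) powr p = norm (x i) powr p" for i
    using p by (cases "i < m") auto
  then have "(\<Sum>i. norm (x i) powr p) = (\<Sum>i. norm (restr {..<m} x i) powr p + norm (restr {m..} x i) powr p)"
    by simp
  also have "\<dots> = (\<Sum>i. norm (restr {..<m} x i) powr p) + (\<Sum>i. norm (restr {m..} x i) powr p)"
    by (rule suminf_add[symmetric]) (rule s)+
  finally show ?thesis using p x by (simp only: nrm_lp_powr E.restr_mem)
qed

lemma lp_restr_tail_tendsto:
  fixes x :: "nat \<Rightarrow> 'k::real_or_complex"
  assumes p: "1 \<le> p" and x: "x \<in> vecs (lp_space p)"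
  shows "(\<lambda>m. nrm (lp_space p) (restr {m..} x)) \<longlonglongrightarrow> 0"
proof -
  interpret E: seq_space "lp_space p :: ('k, nat \<Rightarrow> 'k) nspace" "\<lambda>_. 1" p "{id}" by (rule seq_space_lp[OF p])
  have "nrm (lp_space p) (restr {..<m} x) powr p = (\<Sum>i<m. norm (x i) powr p)" for m
  proof -
    have "(\<Sum>i. norm (restr {..<m} x i) powr p) = (\<Sum>i<m. norm (restr {..<m} x i) powr p)"
      using p by (intro suminf_finite) auto
    then show ?thesis using p x by (simp only: nrm_lp_powr E.restr_mem) simp
  qed
  moreover have "(\<lambda>m. \<Sum>i<m. norm (x i) powr p) \<longlonglongrightarrow> nrm (lp_space p) x powr p"
    using p x by (simp add: nrm_lp_powr vecs_lp summable_LIMSEQ)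
  ultimately have "(\<lambda>m. nrm (lp_space p) x powr p - nrm (lp_space p) (restr {..<m} x) powr p) \<longlonglongrightarrow>
      nrm (lp_space p) x powr p - nrm (lp_space p) x powr p"
    by (intro tendsto_diff tendsto_const) simp
  moreover have "nrm (lp_space p) x powr p - nrm (lp_space p) (restr {..<m} x) powr p =
      nrm (lp_space p) (restr {m..} x) powr p" for m
    using lp_restr_split[OF p x, of m] by simp
  ultimately have "(\<lambda>m. nrm (lp_space p) (restr {m..} x) powr p) \<longlonglongrightarrow> 0" by simp
  then have "(\<lambda>m. (nrm (lp_space p) (restr {m..} x) powr p) powr (1 / p)) \<longlonglongrightarrow> 0 powr (1 / p)"
    using p by (intro tendsto_powr') auto
  then show ?thesis using p E.nrm_ge_0[OF E.restr_mem[OF x]] by (simp add: powr_powr)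
qed

section \<open>Lorentz sequence spaces\<close>

text \<open>A permutation that already agrees on \<open>I\<close> is corrected at the new point by a
  transposition of values, which leaves the earlier values alone.\<close>

lemma ex_bij_extending:
  fixes \<rho> :: "'a \<Rightarrow> 'a"
  assumes "finite I" "inj_on \<rho> I"
  shows "\<exists>\<sigma>. bij \<sigma> \<and> (\<forall>j\<in>I. \<sigma> j = \<rho> j)"
  using assms
proof (induction I)
  case empty
  show ?case using bij_id by blast
next
  case (insert a I)
  then obtain \<sigma> where \<sigma>: "bij \<sigma>" "\<forall>j\<in>I. \<sigma> j = \<rho> j" by auto
  let ?\<sigma> = "Transposition.transpose (\<sigma> a) (\<rho> a) \<circ> \<sigma>"
  have "?\<sigma> j = \<rho> j" if j: "j \<in> I" for j
  proof -
    have "j \<noteq> a" using j insert.hyps by auto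
    then have "\<sigma> j \<noteq> \<sigma> a" using \<sigma>(1) by (auto dest: bij_is_inj injD)
    moreover have "\<rho> j \<noteq> \<rho> a" using insert.prems j \<open>j \<noteq> a\<close> by (metis inj_onD insertCI)
    ultimately show ?thesis using \<sigma>(2) j by (simp add: Transposition.transpose_def)
  qed
  moreover have "?\<sigma> a = \<rho> a" by simp
  moreover have "bij ?\<sigma>" using \<sigma>(1) by (intro bij_comp) auto
  ultimately show ?case by blast
qed

lemma vecs_lorentz: "x \<in> vecs (lorentz_space w q) \<longleftrightarrow>
     (\<forall>\<sigma>. bij \<sigma> \<longrightarrow> summable (\<lambda>j. w j * norm (x (\<sigma> j)) powr q)) \<and>
     bdd_above ((\<lambda>\<sigma>. (\<Sum>j. w j * norm (x (\<sigma> j)) powr q) powr (1 / q)) ` {\<sigma>. bij \<sigma>})"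
  by (simp add: lorentz_space_def)

lemma nrm_lorentz:
  "nrm (lorentz_space w q) x = (SUP \<sigma>\<in>{\<sigma>. bij \<sigma>}. (\<Sum>j. w j * norm (x (\<sigma> j)) powr q) powr (1 / q))"
  by (simp add: lorentz_space_def)

lemma lorentz_weight_le_1: "lorentz_weight w \<Longrightarrow> w j \<le> 1"
  unfolding lorentz_weight_def by (metis decseqD le0)

lemma lorentz_weight_pos: "lorentz_weight w \<Longrightarrow> 0 < w j"
  unfolding lorentz_weight_def by blast

lemma lorentz_weight_not_summable: "lorentz_weight w \<Longrightarrow> \<not> summable w"
proof
  assume w: "lorentz_weight w" and "summable w"
  then have "w \<in> ell 1" using lorentz_weight_pos[OF w] by (simp add: ell_def less_imp_le)
  then show False using w by (simp add: lorentz_weight_def)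
qed

lemma seq_space_lorentz:
  assumes w: "lorentz_weight w" and q: "1 \<le> q"
  shows "seq_space (lorentz_space w q :: ('k::real_or_complex, nat \<Rightarrow> 'k) nspace) w q {\<sigma>. bij \<sigma>}"
proof
  let ?X = "lorentz_space w q :: ('k, nat \<Rightarrow> 'k) nspace"
  have w0: "0 \<le> w j" for j using lorentz_weight_pos[OF w, of j] by simp
  have ne: "{\<sigma>::nat \<Rightarrow> nat. bij \<sigma>} \<noteq> {}" using bij_id by blast
  show "1 \<le> q" by fact
  show "scl ?X = (\<lambda>c x i. c * x i)" by (simp add: lorentz_space_def)
  show "0 \<le> w j" "w j \<le> 1" for j by (rule w0, rule lorentz_weight_le_1[OF w])
  show "inj \<tau>" if "\<tau> \<in> {\<sigma>. bij \<sigma>}" for \<tau> :: "nat \<Rightarrow> nat" using that by (simp add: bij_is_inj)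
  fix x :: "nat \<Rightarrow> 'k"
  show nn: "0 \<le> nrm ?X x" if "x \<in> vecs ?X"
    using that by (auto simp: nrm_lorentz vecs_lorentz intro!: cSUP_upper2[of _ _ id] bij_id[unfolded id_def] simp: id_def)
  have ball: "x \<in> vecs ?X \<and> nrm ?X x \<le> A \<longleftrightarrow>
      (\<forall>\<tau>\<in>{\<sigma>. bij \<sigma>}. \<forall>N. (\<Sum>j<N. w j * norm (x (\<tau> j)) powr q) \<le> A powr q)" if A: "0 \<le> A" for A
  proof (intro iffI ballI allI)
    fix \<tau> :: "nat \<Rightarrow> nat" and N assume x: "x \<in> vecs ?X \<and> nrm ?X x \<le> A" and \<tau>: "\<tau> \<in> {\<sigma>. bij \<sigma>}"
    let ?S = "\<Sum>j. w j * norm (x (\<tau> j)) powr q"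
    have s: "summable (\<lambda>j. w j * norm (x (\<tau> j)) powr q)" using x \<tau> by (simp add: vecs_lorentz)
    have "?S powr (1 / q) \<le> nrm ?X x"
      unfolding nrm_lorentz using x \<tau> by (intro cSUP_upper) (auto simp: vecs_lorentz)
    also have "\<dots> \<le> A" using x by simp
    finally have "(?S powr (1 / q)) powr q \<le> A powr q" using q by (intro powr_mono2) auto
    moreover have "(\<Sum>j<N. w j * norm (x (\<tau> j)) powr q) \<le> ?S"
      using s w0 by (intro sum_le_suminf) auto
    moreover have "0 \<le> ?S" using s w0 by (intro suminf_nonneg) auto
    ultimately show "(\<Sum>j<N. w j * norm (x (\<tau> j)) powr q) \<le> A powr q"
      using q by (simp add: powr_powr)
  next
    assume le: "\<forall>\<tau>\<in>{\<sigma>. bij \<sigma>}. \<forall>N. (\<Sum>j<N. w j * norm (x (\<tau> j)) powr q) \<le> A powr q"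
    have s: "summable (\<lambda>j. w j * norm (x (\<tau> j)) powr q)" if "bij \<tau>" for \<tau>
      using le that w0 by (intro summableI_nonneg_bounded[where x = "A powr q"]) auto
    have b: "(\<Sum>j. w j * norm (x (\<tau> j)) powr q) powr (1 / q) \<le> A" if "bij \<tau>" for \<tau>
    proof -
      have "(\<Sum>j. w j * norm (x (\<tau> j)) powr q) \<le> A powr q"
        using s[OF that] le that by (intro suminf_le_const) auto
      then have "(\<Sum>j. w j * norm (x (\<tau> j)) powr q) powr (1 / q) \<le> (A powr q) powr (1 / q)"
        using s[OF that] w0 q by (intro powr_mono2) (auto intro!: suminf_nonneg)
      then show ?thesis using q A by (simp add: powr_powr)
    qed
    show "x \<in> vecs ?X \<and> nrm ?X x \<le> A"
      using s b ne by (auto simp: vecs_lorentz nrm_lorentz bdd_above_def intro!: cSUP_least)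
  qed
  fix A :: real assume "0 \<le> A"
  then show "x \<in> vecs ?X \<and> nrm ?X x \<le> A \<longleftrightarrow>
      (\<forall>\<tau>\<in>{\<sigma>. bij \<sigma>}. \<forall>N. (\<Sum>j<N. w j * norm (x (\<tau> j)) powr q) \<le> A powr q)" by (rule ball)
next
  let ?X = "lorentz_space w q :: ('k, nat \<Rightarrow> 'k) nspace"
  fix x :: "nat \<Rightarrow> 'k" and i assume x: "x \<in> vecs ?X"
  \<comment> \<open>Coordinate \<open>i\<close> moves to the first position, where the weight is
    1.\<close>
  let ?\<sigma> = "Transposition.transpose 0 i :: nat \<Rightarrow> nat"
  let ?f = "\<lambda>j. w j * norm (x (?\<sigma> j)) powr q"
  have s: "summable ?f" using x by (simp add: vecs_lorentz)
  have "?f 0 \<le> suminf ?f"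
    using sum_le_suminf[OF s, of "{0}"] lorentz_weight_pos[OF w] by (simp add: less_imp_le)
  then have "norm (x i) powr q \<le> suminf ?f" using w by (simp add: lorentz_weight_def)
  then have "(norm (x i) powr q) powr (1 / q) \<le> suminf ?f powr (1 / q)"
    using q by (intro powr_mono2) auto
  also have "\<dots> \<le> nrm ?X x"
    unfolding nrm_lorentz using x by (intro cSUP_upper) (auto simp: vecs_lorentz)
  finally show "norm (x i) \<le> nrm ?X x" using q by (simp add: powr_powr)
qed

locale lorentz =
  fixes w :: "nat \<Rightarrow> real" and q :: real and F :: "('k::real_or_complex, nat \<Rightarrow> 'k) nspace"
  assumes w: "lorentz_weight w" and q1: "1 \<le> q" and F: "F = lorentz_space w q"

sublocale lorentz \<subseteq> seq_space F w q "{\<sigma>. bij \<sigma>}"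
  unfolding F by (rule seq_space_lorentz[OF w q1])

context lorentz
begin

text \<open>The norm is defined by permutations, whereas lower estimates prescribe only finitely
  many positions; an injective prescription extends to a permutation.\<close>

lemma sum_positions_le:
  assumes x: "x \<in> vecs F" and I: "finite I" "inj_on \<rho> I"
  shows "(\<Sum>j\<in>I. w j * norm (x (\<rho> j)) powr q) \<le> nrm F x powr q"
proof -
  obtain \<sigma> where \<sigma>: "bij \<sigma>" "\<forall>j\<in>I. \<sigma> j = \<rho> j" using ex_bij_extending[OF I] by blast
  obtain N where N: "I \<subseteq> {..<N}" using I(1) finite_nat_iff_bounded by blast
  have "(\<Sum>j\<in>I. w j * norm (x (\<rho> j)) powr q) = (\<Sum>j\<in>I. w j * norm (x (\<sigma> j)) powr q)"
    using \<sigma>(2) by (intro sum.cong) auto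
  also have "\<dots> \<le> (\<Sum>j<N. w j * norm (x (\<sigma> j)) powr q)"
    using N v by (intro sum_mono2) auto
  also have "\<dots> \<le> nrm F x powr q" using \<sigma>(1) by (intro nballD[OF x order_refl]) simp
  finally show ?thesis .
qed

text \<open>Coordinate \<open>i\<close> is put in the position of weight 1 and \<open>j\<close> in
  the next one. The 2-ball property is tested against this lower estimate.\<close>

lemma two_coords_le:
  assumes "x \<in> vecs F" "i \<noteq> j"
  shows "norm (x i) powr q + w 1 * norm (x j) powr q \<le> nrm F x powr q"
  using sum_positions_le[OF assms(1), of "{0, 1}" "\<lambda>k. if k = 0 then i else j"] assms(2) w
  by (simp add: lorentz_weight_def inj_on_def)

text \<open>Infinitely many entries of size at least e, listed in the successive positions, would
  bound the partial sums of \<open>w\<close>, which is not summable.\<close>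

lemma coords_tendsto_0:
  assumes x: "x \<in> vecs F"
  shows "x \<longlonglongrightarrow> 0"
proof (rule ccontr)
  assume "\<not> x \<longlonglongrightarrow> 0"
  then obtain e where e: "0 < e" "\<not> (\<exists>N. \<forall>i\<ge>N. norm (x i) < e)"
    unfolding LIMSEQ_iff by auto
  define S where "S = {i. e \<le> norm (x i)}"
  have "infinite S"
    unfolding infinite_nat_iff_unbounded_le S_def using e(2) by (auto simp: not_less)
  then have en: "enumerate S j \<in> S" "inj (enumerate S)" for j
    using strict_mono_enumerate strict_mono_imp_inj_on by (auto intro: enumerate_in_set)
  have "(\<Sum>j<N. w j) \<le> nrm F x powr q / e powr q" for N
  proof -
    have "(\<Sum>j<N. w j) * e powr q = (\<Sum>j<N. w j * e powr q)" by (simp add: sum_distrib_right)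
    also have "\<dots> \<le> (\<Sum>j<N. w j * norm (x (enumerate S j)) powr q)"
      using en(1) e(1) v q unfolding S_def by (intro sum_mono mult_left_mono powr_mono2) auto
    also have "\<dots> \<le> nrm F x powr q"
      using en(2) by (intro sum_positions_le[OF x]) (auto intro: inj_on_subset)
    finally show ?thesis using e(1) by (simp add: pos_le_divide_eq)
  qed
  then have "summable w" using v by (intro summableI_nonneg_bounded) auto
  then show False using lorentz_weight_not_summable[OF w] by blast
qed

text \<open>
  A finite set of coordinates that nearly attains the norm leaves little for the coordinates beyond
  it, except in the first positions, where small entries are harmless.
\<close>

lemma restr_tail_tendsto:
  assumes x: "x \<in> vecs F"
  shows "(\<lambda>m. nrm F (restr {m..} x)) \<longlonglongrightarrow> 0"
proof (rule LIMSEQ_I)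
  fix r :: real assume r: "0 < r"
  \<comment> \<open>Half of the target \<open>(r / 2) powr q\<close>: one half for the first N
    positions, the other for the later ones.\<close>
  define e where "e = (r / 2) powr q / 2"
  have e: "0 < e" "e + e = (r / 2) powr q" using r by (auto simp: e_def)
  have "\<exists>\<sigma> N. bij \<sigma> \<and> nrm F x powr q - e < (\<Sum>j<N. w j * norm (x (\<sigma> j)) powr q)"
  proof (rule ccontr)
    assume "\<not> ?thesis"
    then have le: "(\<Sum>j<N. w j * norm (x (\<sigma> j)) powr q) \<le> nrm F x powr q - e" if "bij \<sigma>" for \<sigma> N
      using that by (meson not_less)
    have pos: "0 \<le> nrm F x powr q - e" using le[OF bij_id, of 0] by simp
    have root: "((nrm F x powr q - e) powr (1 / q)) powr q = nrm F x powr q - e"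
      using q pos by (simp add: powr_powr)
    have "nrm F x \<le> (nrm F x powr q - e) powr (1 / q)"
      using le root by (intro nballI) auto
    then have "nrm F x powr q \<le> ((nrm F x powr q - e) powr (1 / q)) powr q"
      using q nrm_ge_0[OF x] by (intro powr_mono2) auto
    then show False using root e by simp
  qed
  then obtain \<sigma> N where \<sigma>: "bij \<sigma>" "nrm F x powr q - e < (\<Sum>j<N. w j * norm (x (\<sigma> j)) powr q)" by blast
  \<comment> \<open>Coordinates from \<open>M\<close> on are not among those that
    \<open>\<sigma>\<close> places in the first N positions; this makes the glued map below
    injective.\<close>
  obtain M where M: "\<sigma> ` {..<N} \<subseteq> {..<M}" using finite_nat_iff_bounded by blast
  \<comment> \<open>N entries of modulus at most \<open>d\<close> contribute at most e in
    total.\<close>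
  define d where "d = (e / (real N + 1)) powr (1 / q)"
  have d: "0 < d" "d powr q = e / (real N + 1)" using e q by (auto simp: d_def powr_powr add_nonneg_pos)
  obtain M' where M': "\<And>i. M' \<le> i \<Longrightarrow> norm (x i) < d"
    using coords_tendsto_0[OF x] d(1) unfolding LIMSEQ_iff by auto
  have "nrm F (restr {m..} x) \<le> r / 2" if m: "max M M' \<le> m" for m
  proof (rule nballI)
    show "0 \<le> r / 2" using r by simp
    fix \<tau> :: "nat \<Rightarrow> nat" and K assume "\<tau> \<in> {\<sigma>. bij \<sigma>}"
    then have \<tau>: "bij \<tau>" by simp
    let ?t = "\<lambda>j. w j * norm (restr {m..} x (\<tau> j)) powr q"
    let ?I = "{j. N \<le> j \<and> j < K \<and> m \<le> \<tau> j}"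
    \<comment> \<open>Keep the nearly optimal choice in the first N positions and add the far
      coordinates where \<open>\<tau>\<close> has them. Since the first part already reaches the
      norm up to e, at most e is left for the second.\<close>
    let ?\<rho> = "\<lambda>j. if j < N then \<sigma> j else \<tau> j"
    have fin: "finite ?I" by (rule finite_subset[of _ "{..<K}"]) auto
    have "(\<Sum>j<N. ?t j) \<le> (\<Sum>j<N. e / (real N + 1))"
    proof (rule sum_mono)
      fix j
      have "norm (restr {m..} x (\<tau> j)) powr q \<le> d powr q"
        using M'[of "\<tau> j"] m d q by (intro powr_mono2) auto
      moreover have "?t j \<le> norm (restr {m..} x (\<tau> j)) powr q"
        using v by (simp add: mult_left_le_one_le)
      ultimately show "?t j \<le> e / (real N + 1)" using d by linarith
    qed
    also have "\<dots> \<le> e" using e by (simp add: field_simps)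
    finally have 1: "(\<Sum>j<N. ?t j) \<le> e" .
    have "inj_on ?\<rho> ({..<N} \<union> ?I)"
    proof (rule inj_onI)
      fix a b assume ab: "a \<in> {..<N} \<union> ?I" "b \<in> {..<N} \<union> ?I" "?\<rho> a = ?\<rho> b"
      have "\<sigma> c \<noteq> \<tau> d" "\<tau> d \<noteq> \<sigma> c" if "c < N" "m \<le> \<tau> d" for c d using M m that by fastforce+
      note neq = this
      consider "a < N" "b < N" | "a < N" "\<not> b < N" "m \<le> \<tau> b"
        | "\<not> a < N" "m \<le> \<tau> a" "b < N" | "\<not> a < N" "\<not> b < N"
        using ab(1,2) by auto
      then show "a = b"
      proof cases
        case 1
        then show ?thesis using ab(3) injD[OF bij_is_inj[OF \<sigma>(1)], of a b] by simp
      next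
        case 2
        then show ?thesis using ab(3) neq(1)[of a b] by simp
      next
        case 3
        then show ?thesis using ab(3) neq(2)[of b a] by simp
      next
        case 4
        then show ?thesis using ab(3) injD[OF bij_is_inj[OF \<tau>], of a b] by simp
      qed
    qed
    then have "(\<Sum>j\<in>{..<N} \<union> ?I. w j * norm (x (?\<rho> j)) powr q) \<le> nrm F x powr q"
      using fin by (intro sum_positions_le[OF x]) auto
    moreover have "(\<Sum>j\<in>{..<N} \<union> ?I. w j * norm (x (?\<rho> j)) powr q) =
        (\<Sum>j<N. w j * norm (x (?\<rho> j)) powr q) + (\<Sum>j\<in>?I. w j * norm (x (?\<rho> j)) powr q)"
      using fin by (intro sum.union_disjoint) auto
    moreover have "(\<Sum>j<N. w j * norm (x (?\<rho> j)) powr q) = (\<Sum>j<N. w j * norm (x (\<sigma> j)) powr q)"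
      by (intro sum.cong) auto
    moreover have "(\<Sum>j\<in>?I. w j * norm (x (?\<rho> j)) powr q) = (\<Sum>j\<in>?I. ?t j)"
      by (intro sum.cong) auto
    ultimately have 2: "(\<Sum>j\<in>?I. ?t j) \<le> e" using \<sigma>(2) by linarith
    have "(\<Sum>j<K. ?t j) = (\<Sum>j\<in>{..<K} \<inter> ({..<N} \<union> ?I). ?t j)"
      using q by (intro sum.mono_neutral_right) auto
    also have "\<dots> \<le> (\<Sum>j\<in>{..<N} \<union> ?I. ?t j)"
      using fin v by (intro sum_mono2) auto
    also have "\<dots> = (\<Sum>j<N. ?t j) + (\<Sum>j\<in>?I. ?t j)"
      using fin by (intro sum.union_disjoint) auto
    finally show "(\<Sum>j<K. ?t j) \<le> (r / 2) powr q" using 1 2 e(2) by linarith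
  qed
  then have "norm (nrm F (restr {m..} x) - 0) < r" if "max M M' \<le> m" for m
    using r that nrm_ge_0[OF restr_mem[OF x, of "{m..}"]] by fastforce
  then show "\<exists>N. \<forall>m\<ge>N. norm (nrm F (restr {m..} x) - 0) < r" by blast
qed

end

section \<open>Weak convergence in the space of p-summable sequences\<close>

context normed_on
begin

lemma nlim_scl2:
  assumes "(c \<longlongrightarrow> d) G" "nlim u x G" "x \<in> vecs X" "\<And>a. u a \<in> vecs X"
  shows "nlim (\<lambda>a. scl X (c a) (u a)) (scl X d x) G"
  unfolding nlim_def
proof (rule tendsto_sandwich[where f = "\<lambda>_. 0"])
  have "nrm X (scl X (c a) (u a) - scl X d x) \<le> norm (c a) * nrm X (u a - x) + norm (c a - d) * nrm X x" for a
  proof -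
    have "scl X (c a) (u a) - scl X d x = scl X (c a) (u a - x) + scl X (c a - d) x"
      by (simp add: scale_right_diff_distrib scale_left_diff_distrib)
    also have "nrm X \<dots> \<le> nrm X (scl X (c a) (u a - x)) + nrm X (scl X (c a - d) x)"
      using assms by (intro nrm_add) auto
    finally show ?thesis using assms by (simp add: nrm_scl)
  qed
  then show "\<forall>\<^sub>F a in G. nrm X (scl X (c a) (u a) - scl X d x) \<le>
      norm (c a) * nrm X (u a - x) + norm (c a - d) * nrm X x" by simp
  have "((\<lambda>a. norm (c a - d)) \<longlongrightarrow> 0) G"
    using assms(1) by (metis LIM_zero tendsto_norm_zero)
  then have "((\<lambda>a. norm (c a) * nrm X (u a - x) + norm (c a - d) * nrm X x) \<longlongrightarrow> norm d * 0 + 0 * nrm X x) G"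
    using assms(1,2) unfolding nlim_def
    by (intro tendsto_add tendsto_mult tendsto_norm tendsto_const) auto
  then show "((\<lambda>a. norm (c a) * nrm X (u a - x) + norm (c a - d) * nrm X x) \<longlongrightarrow> 0) G" by simp
  show "\<forall>\<^sub>F a in G. 0 \<le> nrm X (scl X (c a) (u a) - scl X d x)"
    using assms by (auto intro!: always_eventually nrm_ge_0 diff_vecs scl_vecs)
qed simp

end

lemma (in seq_space) restr_lessThan_eq_sum:
  "restr {..<m} x = (\<Sum>i<m. scl X (x i) (unit_vec i))"
proof
  fix j
  have "(\<Sum>i<m. scl X (x i) (unit_vec i)) j = (\<Sum>i<m. if j = i then x i else 0)"
    unfolding sum_fun_apply by (rule sum.cong) (auto simp: scl_def unit_vec_def)
  moreover have "(\<Sum>i<m. if j = i then x i else 0) = restr {..<m} x j" by simp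
  ultimately show "restr {..<m} x j = (\<Sum>i<m. scl X (x i) (unit_vec i)) j" by (simp only:)
qed

locale lp = 
  fixes p :: real and E :: "('k::real_or_complex, nat \<Rightarrow> 'k) nspace"
  assumes p: "1 < p" and E: "E = lp_space p"

sublocale lp \<subseteq> seq_space E "\<lambda>_. 1" p "{id}"
  unfolding E using p by (intro seq_space_lp) simp

context lp
begin

lemma restr_powr_split:
  "x \<in> vecs E \<Longrightarrow> nrm E (restr {..<m} x) powr p + nrm E (restr {m..} x) powr p = nrm E x powr p"
  unfolding E using p by (intro lp_restr_split) auto

lemma restr_tail_tendsto: "x \<in> vecs E \<Longrightarrow> (\<lambda>m. nrm E (restr {m..} x)) \<longlonglongrightarrow> 0"
  unfolding E using p by (intro lp_restr_tail_tendsto) auto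

text \<open>
  A gliding hump argument: if the tails stayed large, sums of \<open>N\<close> disjoint blocks would have norm at
  most \<open>N\<^bsup>1/p\<^esup>\<close>, while \<open>g\<close> at these sums would grow like \<open>N\<close>. Choosing the blocks such that their
  images cluster around one scalar avoids a choice of signs.
\<close>

lemma gliding_hump:
  fixes g :: "(nat \<Rightarrow> 'k) \<Rightarrow> 'k"
  assumes a: "0 \<le> a" "a < p"
    and bound: "\<And>x. x \<in> vecs E \<Longrightarrow> norm (g x) \<le> C * nrm E x powr a"
    and cont: "\<And>x. x \<in> vecs E \<Longrightarrow> nrm E x \<le> 1 \<Longrightarrow> (\<lambda>L. g (restr {..<L} x)) \<longlonglongrightarrow> g x"
    and split: "\<And>y L e. y \<in> vecs E \<Longrightarrow> restr {..<L} y = y \<Longrightarrow> 0 < e \<Longrightarrow>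
      \<exists>m. \<forall>z\<in>vecs E. nrm E z \<le> 1 \<and> restr {m..} z = z \<longrightarrow> norm (g (y + z) - g y - g z) \<le> e"
    and e: "0 < e"
  shows "\<exists>m. \<forall>m'\<ge>m. \<forall>x\<in>vecs E. nrm E x \<le> 1 \<longrightarrow> norm (g (restr {m'..} x)) \<le> e"
proof (rule ccontr)
  assume neg: "\<not> ?thesis"
  have "\<exists>z\<in>vecs E. nrm E z \<le> 1 \<and> restr {m..} z = z \<and> e < norm (g z)" for m
  proof -
    obtain m' x where "m \<le> m'" "x \<in> vecs E" "nrm E x \<le> 1" "e < norm (g (restr {m'..} x))"
      using neg by (meson not_less)
    then show ?thesis
      using nrm_restr_le[of x "{m'..}"]
      by (intro bexI[of _ "restr {m'..} x"]) (auto simp: restr_restr Int_absorb1)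
  qed
  then obtain z where z: "\<And>m. z m \<in> vecs E" "\<And>m. nrm E (z m) \<le> 1" "\<And>m. restr {m..} (z m) = z m"
    "\<And>m. e < norm (g (z m))" by metis
  have g0: "g 0 = 0" using bound[of 0] by simp
  have C: "0 \<le> C"
  proof (rule ccontr)
    assume "\<not> 0 \<le> C"
    then have "C * nrm E (z 0) powr a \<le> 0" by (intro mult_nonpos_nonneg) auto
    then show False using bound[OF z(1)[of 0]] z(4)[of 0] e by linarith
  qed
  have le1: "norm (g (z m)) \<le> C" for m
  proof -
    have "nrm E (z m) powr a \<le> 1" using a z(1,2) nrm_ge_0 by (intro powr_le1) auto
    then have "C * nrm E (z m) powr a \<le> C" using C by (rule mult_left_le)
    then show ?thesis using bound[OF z(1)[of m]] by simp
  qed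
  then have "bounded (range (\<lambda>m. g (z m)))" by (auto simp: bounded_iff)
  then obtain U \<gamma> where U: "U \<le> sequentially" "U \<noteq> bot" and \<gamma>: "((\<lambda>m. g (z m)) \<longlongrightarrow> \<gamma>) U"
    using ex_subfilter_bounded_functions_converge[where F = sequentially and 'k = 'k] by auto
  have \<gamma>e: "e \<le> norm \<gamma>"
    using z(4) by (intro tendsto_lowerbound[OF tendsto_norm[OF \<gamma>] _ U(2)]) (auto intro!: always_eventually less_imp_le)
  \<comment> \<open>Finite support beyond any m, with a value near the one scalar
    \<open>\<gamma>\<close>: the vector \<open>z k\<close> is chosen far out along \<open>U\<close>
    and then truncated.\<close>
  have block: "\<exists>u\<in>vecs E. \<exists>L. nrm E u \<le> 1 \<and> restr {m..} u = u \<and> restr {..<L} u = u \<and> norm (g u - \<gamma>) \<le> e / 4" for m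
  proof -
    have "\<forall>\<^sub>F k in U. dist (g (z k)) \<gamma> < e / 8" using tendstoD[OF \<gamma>, of "e / 8"] e by simp
    moreover have "\<forall>\<^sub>F k in U. m \<le> k" using U(1) eventually_ge_at_top[of m] by (rule filter_leD)
    ultimately have "\<forall>\<^sub>F k in U. dist (g (z k)) \<gamma> < e / 8 \<and> m \<le> k" by (rule eventually_conj)
    then obtain k where k: "dist (g (z k)) \<gamma> < e / 8" "m \<le> k" using eventually_happens'[OF U(2)] by blast
    obtain L where L: "dist (g (restr {..<L} (z k))) (g (z k)) < e / 8"
      using tendstoD[OF cont[OF z(1,2)], of "e / 8" k] e by (auto simp: eventually_sequentially)
    let ?u = "restr {..<L} (z k)"
    have "restr {m..} ?u = ?u"
    proof
      fix i
      have "z k i = 0" if "i < m" using fun_cong[OF z(3)[of k], of i] that k(2) by simp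
      then show "restr {m..} ?u i = ?u i" by auto
    qed
    moreover have "norm (g ?u - \<gamma>) \<le> e / 4"
      using dist_triangle[of "g ?u" \<gamma> "g (z k)"] L k(1) by (simp add: dist_norm)
    moreover have "nrm E ?u \<le> 1" using nrm_restr_le[OF z(1)[of k], of "{..<L}"] z(2)[of k] by simp
    ultimately show ?thesis
      using z(1) by (intro bexI[of _ ?u] exI[of _ L]) (auto simp: restr_restr)
  qed
  \<comment> \<open>Every further block costs e/4 for the defect of additivity and e/4 for the
    distance of its value from \<open>\<gamma>\<close>, hence the error N e/2.\<close>
  have grow: "\<exists>y\<in>vecs E. \<exists>M. restr {..<M} y = y \<and> nrm E y powr p \<le> real N \<and>
      norm (g y - of_nat N * \<gamma>) \<le> real N * (e / 2)" for N
  proof (induction N)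
    case 0
    have "restr {..<0} 0 = (0 :: nat \<Rightarrow> 'k) \<and> nrm E 0 powr p \<le> real 0 \<and>
        norm (g 0 - of_nat 0 * \<gamma>) \<le> real 0 * (e / 2)" using g0 p by simp
    then show ?case using zero_vecs by blast
  next
    case (Suc N)
    then obtain y M where y: "y \<in> vecs E" "restr {..<M} y = y" "nrm E y powr p \<le> real N"
      "norm (g y - of_nat N * \<gamma>) \<le> real N * (e / 2)" by blast
    obtain m0 where m0: "\<And>u. u \<in> vecs E \<Longrightarrow> nrm E u \<le> 1 \<Longrightarrow> restr {m0..} u = u \<Longrightarrow>
        norm (g (y + u) - g y - g u) \<le> e / 4"
      using split[OF y(1,2), of "e / 4"] e by auto
    obtain u L where u: "u \<in> vecs E" "nrm E u \<le> 1" "restr {max m0 M..} u = u" "restr {..<L} u = u"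
      "norm (g u - \<gamma>) \<le> e / 4" using block[of "max m0 M"] by blast
    have u0: "u i = 0" if "i < max m0 M" for i
      using fun_cong[OF u(3), of i] that by (auto simp: less_max_iff_disj split: if_splits)
    have y0: "y i = 0" if "M \<le> i" for i using fun_cong[OF y(2), of i] that by auto
    have uL: "u i = 0" if "L \<le> i" for i using fun_cong[OF u(4), of i] that by auto
    have "restr {m0..} u = u" using u0 by (auto simp: fun_eq_iff)
    then have 1: "norm (g (y + u) - g y - g u) \<le> e / 4" using u m0 by blast
    have "nrm E (y + u) powr p \<le> nrm E y powr p + nrm E u powr p"
      using y u u0 y0 by (intro nrm_disjoint) (auto simp: not_le[symmetric])
    moreover have "nrm E u powr p \<le> 1" using u p nrm_ge_0 by (intro powr_le1) auto
    ultimately have "nrm E (y + u) powr p \<le> real (Suc N)" using y(3) by simp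
    moreover have "restr {..<max M L} (y + u) = y + u" using y0 uL by (auto simp: fun_eq_iff)
    moreover have "norm (g (y + u) - of_nat (Suc N) * \<gamma>) \<le> real (Suc N) * (e / 2)"
    proof -
      have "g (y + u) - of_nat (Suc N) * \<gamma> =
          (g (y + u) - g y - g u) + ((g y - of_nat N * \<gamma>) + (g u - \<gamma>))"
        by (simp add: algebra_simps)
      also have "norm \<dots> \<le> e / 4 + (real N * (e / 2) + e / 4)"
        by (intro norm_triangle_mono 1 y(4) u(5))
      also have "\<dots> = real (Suc N) * (e / 2)" by (simp add: algebra_simps)
      finally show ?thesis .
    qed
    ultimately have "restr {..<max M L} (y + u) = y + u \<and> nrm E (y + u) powr p \<le> real (Suc N) \<and>
        norm (g (y + u) - of_nat (Suc N) * \<gamma>) \<le> real (Suc N) * (e / 2)" by blast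
    then show ?case using add_vecs[OF y(1) u(1)] by blast
  qed
  \<comment> \<open>Since \<open>\<gamma>\<close> has modulus at least e, the value at the sum is at
    least N e/2, while growth of order a bounds it by C times \<open>N powr (a / p)\<close>.\<close>
  have "real N powr (1 - a / p) \<le> 2 * C / e" if N: "0 < N" for N
  proof -
    obtain y where y: "y \<in> vecs E" "nrm E y powr p \<le> real N"
      "norm (g y - of_nat N * \<gamma>) \<le> real N * (e / 2)" using grow by blast
    have "real N * e \<le> norm (of_nat N * \<gamma>)" using \<gamma>e by (simp add: norm_mult mult_left_mono)
    also have "\<dots> \<le> norm (g y) + real N * (e / 2)"
      using norm_triangle_ineq4[of "g y" "g y - of_nat N * \<gamma>"] y(3) by simp
    finally have "real N * (e / 2) \<le> norm (g y)" by (simp add: algebra_simps)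
    also have "\<dots> \<le> C * nrm E y powr a" by (rule bound[OF y(1)])
    also have "nrm E y powr a = (nrm E y powr p) powr (a / p)"
      using p nrm_ge_0[OF y(1)] by (simp add: powr_powr)
    also have "C * (nrm E y powr p) powr (a / p) \<le> C * real N powr (a / p)"
      using y(2) a p C by (intro mult_left_mono powr_mono2) auto
    finally have "real N * e / 2 \<le> C * real N powr (a / p)" by simp
    then have "real N / real N powr (a / p) \<le> 2 * C / e"
      using e N by (simp add: field_simps)
    then show ?thesis using N by (simp add: powr_diff)
  qed
  moreover have "filterlim (\<lambda>N. real N powr (1 - a / p)) at_top sequentially"
    using a p by real_asymp
  then have "\<forall>\<^sub>F N in sequentially. 2 * C / e < real N powr (1 - a / p)"
    by (simp add: filterlim_at_top_dense)
  then have "\<forall>\<^sub>F N in sequentially. 0 < N \<and> 2 * C / e < real N powr (1 - a / p)"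
    using eventually_gt_at_top by (rule eventually_conj[rotated])
  then obtain N where "0 < N" "2 * C / e < real N powr (1 - a / p)"
    by (auto simp: eventually_sequentially)
  ultimately show False by (meson not_less)
qed

text \<open>The gliding hump with exponent 1 < p, for which additivity of \<open>f\<close> makes the
  splitting condition immediate. No description of the dual space by sequences enters.\<close>

lemma dual_tail_small:
  assumes f: "f \<in> vecs (dual E)" and e: "0 < e"
  shows "\<exists>m. \<forall>m'\<ge>m. \<forall>x\<in>vecs E. norm (f (restr {m'..} x)) \<le> e * nrm E x"
proof -
  have "\<exists>m. \<forall>m'\<ge>m. \<forall>x\<in>vecs E. nrm E x \<le> 1 \<longrightarrow> norm (f (restr {m'..} x)) \<le> e"
  proof (rule gliding_hump[of 1 f "nrm (dual E) f"])
    show "norm (f x) \<le> nrm (dual E) f * nrm E x powr 1" if "x \<in> vecs E" for x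
      using norm_dual_le[OF f that] nrm_ge_0[OF that] by simp
    show "(\<lambda>L. f (restr {..<L} x)) \<longlonglongrightarrow> f x" if x: "x \<in> vecs E" for x
    proof -
      have "(\<lambda>L. f (restr {..<L} x) - f x) \<longlonglongrightarrow> 0"
      proof (rule Lim_null_comparison)
        have "f (restr {..<L} x) - f x = - f (restr {L..} x)" for L
          using dual_add[OF f, of "restr {..<L} x" "restr {L..} x"] x by (simp add: restr_split)
        then show "\<forall>\<^sub>F L in sequentially. norm (f (restr {..<L} x) - f x) \<le> nrm (dual E) f * nrm E (restr {L..} x)"
          using norm_dual_le[OF f restr_mem[OF x]] by simp
        show "(\<lambda>L. nrm (dual E) f * nrm E (restr {L..} x)) \<longlonglongrightarrow> 0"
          by (rule tendsto_mult_right_zero[OF restr_tail_tendsto[OF x]])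
      qed
      then show ?thesis by (simp add: LIM_zero_iff)
    qed
    show "\<exists>m. \<forall>z\<in>vecs E. nrm E z \<le> 1 \<and> restr {m..} z = z \<longrightarrow> norm (f (y + z) - f y - f z) \<le> e"
      if "y \<in> vecs E" "0 < e" for y e
      using dual_add[OF f that(1)] that(2) by auto
  qed (use p e in auto)
  then obtain m where m: "\<And>m' x. m \<le> m' \<Longrightarrow> x \<in> vecs E \<Longrightarrow> nrm E x \<le> 1 \<Longrightarrow> norm (f (restr {m'..} x)) \<le> e"
    by blast
  have "norm (f (restr {m'..} x)) \<le> e * nrm E x" if m': "m \<le> m'" and x: "x \<in> vecs E" for m' x
  proof (cases "x = 0")
    case False
    obtain u where u: "u \<in> vecs E" "nrm E u = 1" "scl E (of_real (nrm E x)) u = x"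
      using normalize_nrm[OF x False] x scl_vecs by metis
    have "restr {m'..} x = scl E (of_real (nrm E x)) (restr {m'..} u)"
      unfolding scl_def restr_mult[symmetric] using u(3) by (simp add: scl_def)
    then have "f (restr {m'..} x) = of_real (nrm E x) * f (restr {m'..} u)"
      using dual_scl[OF f restr_mem[OF u(1)]] by simp
    moreover have "norm (f (restr {m'..} u)) \<le> e" using m[OF m' u(1)] u(2) by simp
    from mult_left_mono[OF this nrm_ge_0[OF x]] have "nrm E x * norm (f (restr {m'..} u)) \<le> e * nrm E x"
      by (simp only: mult.commute[of e])
    ultimately show ?thesis using nrm_ge_0[OF x] by (simp add: norm_mult)
  qed (simp add: dual_zero[OF f])
  then show ?thesis by blast
qed

text \<open>A functional is a finite sum of coordinates up to a tail that is uniformly small on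
  balls. Weak continuity on bounded sets can thus be tested on coordinates.\<close>

lemma coordinatewise_imp_weak:
  assumes f: "f \<in> vecs (dual E)" and x: "x \<in> vecs E"
    and u: "\<forall>\<^sub>F a in G. u a \<in> vecs E \<and> nrm E (u a) \<le> r"
    and lim: "\<And>i. ((\<lambda>a. u a i) \<longlongrightarrow> x i) G"
  shows "((\<lambda>a. f (u a)) \<longlongrightarrow> f x) G"
proof (rule tendstoI)
  fix e :: real assume e: "0 < e"
  define B where "B = \<bar>r\<bar> + nrm E x + 1"
  have B: "0 < B" using nrm_ge_0[OF x] by (simp add: B_def)
  obtain m where m: "\<And>y. y \<in> vecs E \<Longrightarrow> norm (f (restr {m..} y)) \<le> e / (2 * B) * nrm E y"
    using dual_tail_small[OF f, of "e / (2 * B)"] e B by auto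
  have "((\<lambda>a. \<Sum>i<m. (u a i - x i) * f (unit_vec i)) \<longlongrightarrow> (\<Sum>i<m. (x i - x i) * f (unit_vec i))) G"
    by (intro tendsto_sum tendsto_mult tendsto_diff lim tendsto_const)
  then have L: "((\<lambda>a. \<Sum>i<m. (u a i - x i) * f (unit_vec i)) \<longlongrightarrow> 0) G" by simp
  have "\<forall>\<^sub>F a in G. norm (\<Sum>i<m. (u a i - x i) * f (unit_vec i)) < e / 2"
    using tendstoD[OF L, of "e / 2"] e by (simp only: dist_0_norm dist_commute[of _ 0])
  with u show "\<forall>\<^sub>F a in G. dist (f (u a)) (f x) < e"
  proof eventually_elim
    case (elim a)
    then have d: "u a - x \<in> vecs E" using x by simp
    have "f (u a) - f x = f (restr {..<m} (u a - x) + restr {m..} (u a - x))"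
      unfolding restr_split using dual_diff[OF f] elim x by simp
    also have "\<dots> = f (restr {..<m} (u a - x)) + f (restr {m..} (u a - x))"
      using d by (intro dual_add[OF f]) auto
    also have "f (restr {..<m} (u a - x)) = (\<Sum>i<m. (u a i - x i) * f (unit_vec i))"
      unfolding restr_lessThan_eq_sum by (subst dual_sum[OF f]) (auto simp: dual_scl[OF f])
    finally have eq: "f (u a) - f x = (\<Sum>i<m. (u a i - x i) * f (unit_vec i)) + f (restr {m..} (u a - x))" .
    have "norm (f (u a) - f x) \<le> norm (\<Sum>i<m. (u a i - x i) * f (unit_vec i)) + norm (f (restr {m..} (u a - x)))"
      unfolding eq by (rule norm_triangle_ineq)
    moreover have "norm (f (restr {m..} (u a - x))) \<le> e / 2"
    proof -
      have "nrm E (u a - x) \<le> nrm E (u a) + nrm E x" "nrm E (u a) \<le> r"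
        using elim x by (auto intro: nrm_diff)
      then have "nrm E (u a - x) \<le> B" unfolding B_def by linarith
      then have "e / (2 * B) * nrm E (u a - x) \<le> e / (2 * B) * B" using e B by (intro mult_left_mono) auto
      moreover have "e / (2 * B) * B = e / 2" using B by simp
      ultimately show ?thesis using m[OF d] by linarith
    qed
    ultimately show ?case using elim by (simp add: dist_norm)
  qed
qed

text \<open>Weak compactness of the ball: all coordinates converge along one finer filter, and the
  partial sums of the p-th powers keep their bound.\<close>

lemma ball_compact:
  assumes "\<And>a. u a \<in> vecs E" "\<And>a. nrm E (u a) \<le> r" "G \<noteq> bot"
  obtains U x where "U \<le> G" "U \<noteq> bot" "x \<in> vecs E" "nrm E x \<le> r" "\<And>i. ((\<lambda>a. u a i) \<longlongrightarrow> x i) U"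
proof -
  obtain U where U: "U \<le> G" "U \<noteq> bot"
    and conv: "\<And>s::_ \<Rightarrow> 'k. bounded (range s) \<Longrightarrow> \<exists>l. (s \<longlongrightarrow> l) U"
    using ex_subfilter_bounded_functions_converge[OF assms(3), where 'k = 'k] by auto
  have "norm (u a i) \<le> r" for a i using coord_le[OF assms(1), of a i] assms(2)[of a] by simp
  then have "\<exists>l. ((\<lambda>a. u a i) \<longlongrightarrow> l) U" for i
    by (intro conv) (auto simp: bounded_iff)
  then obtain x where x: "\<And>i. ((\<lambda>a. u a i) \<longlongrightarrow> x i) U" by metis
  have r: "0 \<le> r" using nrm_ge_0[OF assms(1)] assms(2) by (meson order_trans)
  have "(\<Sum>j<N. 1 * norm (x (\<tau> j)) powr p) \<le> r powr p" if "\<tau> \<in> {id}" for \<tau> N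
  proof (rule tendsto_upperbound[OF _ _ U(2)])
    show "((\<lambda>a. \<Sum>j<N. 1 * norm (u a (\<tau> j)) powr p) \<longlongrightarrow> (\<Sum>j<N. 1 * norm (x (\<tau> j)) powr p)) U"
      using p x by (auto intro!: tendsto_intros tendsto_powr')
    show "\<forall>\<^sub>F a in U. (\<Sum>j<N. 1 * norm (u a (\<tau> j)) powr p) \<le> r powr p"
      using nballD[OF assms(1,2) that] by simp
  qed
  then have "x \<in> vecs E" "nrm E x \<le> r" using nballI[OF r, of x] by blast+
  then show ?thesis using that U x by blast
qed

text \<open>Turns limits along weakly convergent points into uniform estimates. Points violating the
  bound for arbitrarily large m would have a weakly convergent refinement by compactness, along
  which \<open>B\<close> tends to 0.\<close>

lemma uniform_on_ball:
  fixes B :: "nat \<Rightarrow> (nat \<Rightarrow> 'k) \<Rightarrow> real"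
  assumes B: "\<And>U u x. U \<le> sequentially \<Longrightarrow> U \<noteq> bot \<Longrightarrow> (\<And>m. u m \<in> vecs E) \<Longrightarrow> (\<And>m. nrm E (u m) \<le> 1) \<Longrightarrow>
      x \<in> vecs E \<Longrightarrow> nrm E x \<le> 1 \<Longrightarrow> (\<And>i. ((\<lambda>m. u m i) \<longlongrightarrow> x i) U) \<Longrightarrow> ((\<lambda>m. B m (u m)) \<longlongrightarrow> 0) U"
    and e: "0 < e"
  shows "\<forall>\<^sub>F m in sequentially. \<forall>x\<in>vecs E. nrm E x \<le> 1 \<longrightarrow> B m x \<le> e"
proof (rule ccontr)
  assume neg: "\<not> ?thesis"
  define bad where "bad = {m. \<exists>x\<in>vecs E. nrm E x \<le> 1 \<and> e < B m x}"
  have "\<not> eventually (\<lambda>m. m \<notin> bad) sequentially"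
    using neg by (simp add: bad_def not_less)
  then have G: "inf sequentially (principal bad) \<noteq> bot"
    by (simp add: inf_principal trivial_limit_def eventually_inf_principal)
  have "\<exists>x\<in>vecs E. nrm E x \<le> 1 \<and> (m \<in> bad \<longrightarrow> e < B m x)" for m
    by (cases "m \<in> bad") (auto simp: bad_def intro!: bexI[of _ 0])
  then obtain u where u: "\<And>m. u m \<in> vecs E" "\<And>m. nrm E (u m) \<le> 1" "\<And>m. m \<in> bad \<Longrightarrow> e < B m (u m)"
    by metis
  obtain U x where U: "U \<le> inf sequentially (principal bad)" "U \<noteq> bot" and
    x: "x \<in> vecs E" "nrm E x \<le> 1" "\<And>i. ((\<lambda>m. u m i) \<longlongrightarrow> x i) U"
    by (rule ball_compact[of u 1, OF u(1,2) G]) blast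
  have "((\<lambda>m. B m (u m)) \<longlongrightarrow> 0) U"
    using U by (intro B[OF _ U(2) u(1,2) x]) auto
  moreover have "\<forall>\<^sub>F m in U. e \<le> B m (u m)"
  proof (rule filter_leD[OF U(1)])
    show "\<forall>\<^sub>F m in inf sequentially (principal bad). e \<le> B m (u m)"
      using u(3) by (auto simp: eventually_inf_principal intro!: always_eventually less_imp_le)
  qed
  ultimately have "e \<le> 0" by (intro tendsto_lowerbound[OF _ _ U(2)])
  with e show False by simp
qed

end

section \<open>Polynomials from \<open>\<ell>\<^sub>p\<close> to a Lorentz space\<close>

context normed_pair
begin

lemma homogeneous_poly_compose:
  assumes "homogeneous_poly n X Y P"
    and L: "\<And>x. x \<in> vecs X \<Longrightarrow> L x \<in> vecs X" "\<And>x y. x \<in> vecs X \<Longrightarrow> y \<in> vecs X \<Longrightarrow> L (x + y) = L x + L y"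
      "\<And>c x. x \<in> vecs X \<Longrightarrow> L (scl X c x) = scl X c (L x)"
    and M: "\<And>x. x \<in> vecs Y \<Longrightarrow> M x \<in> vecs Y" "\<And>x y. x \<in> vecs Y \<Longrightarrow> y \<in> vecs Y \<Longrightarrow> M (x + y) = M x + M y"
      "\<And>c x. x \<in> vecs Y \<Longrightarrow> M (scl Y c x) = scl Y c (M x)"
  shows "homogeneous_poly n X Y (\<lambda>x. M (P (L x)))"
proof -
  obtain A where A: "multilinear_on n X Y A" "\<And>x. x \<in> vecs X \<Longrightarrow> P x = A (replicate n x)"
    using assms(1) unfolding homogeneous_poly_def by blast
  have "multilinear_on n X Y (\<lambda>xs. M (A (map L xs)))"
    using A(1)
  proof (induction n arbitrary: A)
    case 0
    then show ?case using M by simp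
  next
    case (Suc n)
    show ?case unfolding multilinear_on_Suc
    proof (intro conjI ballI allI impI)
      fix a assume a: "a \<in> vecs X"
      show "multilinear_on n X Y (\<lambda>r. M (A (map L (a # r))))"
        using Suc.IH[OF multilinear_on_Cons(1)[OF Suc.prems L(1)[OF a]]] by simp
    next
      fix r a b assume r: "length r = n \<and> set r \<subseteq> vecs X" and ab: "a \<in> vecs X" "b \<in> vecs X"
      have r': "length (map L r) = n" "set (map L r) \<subseteq> vecs X" using r L(1) by auto
      have "A (L a # map L r) \<in> vecs Y" "A (L b # map L r) \<in> vecs Y"
        using r' ab L(1) by (simp_all add: multilinear_on_mem[OF Suc.prems])
      then show "M (A (map L ((a + b) # r))) = M (A (map L (a # r))) + M (A (map L (b # r)))"
        using multilinear_on_Cons(2)[OF Suc.prems L(1)[OF ab(1)] L(1)[OF ab(2)] r'] L(2)[OF ab] M(2) by simp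
    next
      fix r a c assume r: "length r = n \<and> set r \<subseteq> vecs X" and a: "a \<in> vecs X"
      have r': "length (map L r) = n" "set (map L r) \<subseteq> vecs X" using r L(1) by auto
      have "A (L a # map L r) \<in> vecs Y"
        using r' a L(1) by (simp_all add: multilinear_on_mem[OF Suc.prems])
      then show "M (A (map L (scl X c a # r))) = scl Y c (M (A (map L (a # r))))"
        using multilinear_on_Cons(3)[OF Suc.prems L(1)[OF a] r', of c] L(3)[OF a] M(3) by simp
    qed
  qed
  then show ?thesis unfolding homogeneous_poly_def
    using A(2) L(1) by (intro exI[of _ "\<lambda>xs. M (A (map L xs))"]) (simp add: map_replicate_const)
qed

lemma poly_space_continuous:
  assumes "P \<in> vecs (poly_space n X Y)" "X.nlim u x G" "x \<in> vecs X" "\<And>a. u a \<in> vecs X"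
  shows "Y.nlim (\<lambda>a. P (u a)) (P x) G"
  unfolding Y.nlim_def
proof (rule tendstoI)
  fix e :: real assume "0 < e"
  have "continuous_map (ntop X) (ntop Y) P" using assms(1) by (simp add: poly_space_def)
  then obtain d where d: "0 < d" "\<And>y. y \<in> vecs X \<Longrightarrow> nrm X (x - y) < d \<Longrightarrow> nrm Y (P x - P y) < e"
    using assms(3) \<open>0 < e\<close> unfolding continuous_map_ntop_iff[OF X.normed_on_axioms Y.normed_on_axioms] by meson
  have "\<forall>\<^sub>F a in G. nrm X (u a - x) < d"
    using order_tendstoD(2)[OF assms(2)[unfolded X.nlim_def] d(1)] .
  then show "\<forall>\<^sub>F a in G. dist (nrm Y (P (u a) - P x)) 0 < e"
  proof eventually_elim
    case (elim a)
    then have "nrm Y (P x - P (u a)) < e"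
      using assms(3,4) X.nrm_diff_commute by (intro d(2)) auto
    then show ?case
      using Y.nrm_diff_commute[of "P x" "P (u a)"] Y.nrm_ge_0[of "P (u a) - P x"] assms(1) by simp
  qed
qed

end

lemma diff_add_telescope: "(a - b) + (b - c) = (a - c :: 'a::ab_group_add)"
  by simp

lemma restr_UNIV: "restr UNIV x = x"
  by (simp add: fun_eq_iff)

locale lp_lorentz = E: lp p E + F: lorentz w q F
  for p :: real and E :: "('k::real_or_complex, nat \<Rightarrow> 'k) nspace"
    and w :: "nat \<Rightarrow> real" and q :: real and F :: "('k, nat \<Rightarrow> 'k) nspace" +
  assumes q: "1 < q"

sublocale lp_lorentz \<subseteq> normed_pair E F ..

context lp_lorentz
begin

abbreviation "Polys n \<equiv> poly_space n E F"

text \<open>Weak continuity in the form in which it is applied: bounded indexed points that converge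
  in each coordinate.\<close>

lemma weak_poly_nlim:
  assumes R: "weakly_continuous_on_bounded E F R" and x: "x \<in> vecs E"
    and u: "\<And>a. u a \<in> vecs E" "\<And>a. nrm E (u a) \<le> r"
    and lim: "\<And>i. ((\<lambda>a. u a i) \<longlongrightarrow> x i) G"
  shows "F.nlim (\<lambda>a. R (u a)) (R x) G"
proof -
  have "F.nlim R (R x) (filtermap u G)"
  proof (rule weakly_continuousD[OF R x])
    show "\<forall>\<^sub>F y in filtermap u G. y \<in> vecs E \<and> nrm E y \<le> r" using u by (simp add: eventually_filtermap)
    fix f assume "f \<in> vecs (dual E)"
    then have "((\<lambda>a. f (u a)) \<longlongrightarrow> f x) G"
      using u by (intro E.coordinatewise_imp_weak[OF _ x _ lim, of f r]) auto
    then show "(f \<longlongrightarrow> f x) (filtermap u G)" by (simp add: filterlim_filtermap)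
  qed
  then show ?thesis unfolding F.nlim_def by (simp add: filterlim_filtermap)
qed

text \<open>Coordinates are functionals once they are set to 0 off the carrier, and the points
  considered lie in the carrier eventually.\<close>

lemma weakly_continuous_coordinatewiseI:
  assumes "\<And>G r x. x \<in> vecs E \<Longrightarrow> \<forall>\<^sub>F y in G. y \<in> vecs E \<and> nrm E y \<le> r \<Longrightarrow>
    (\<And>i. ((\<lambda>y. y i) \<longlongrightarrow> x i) G) \<Longrightarrow> F.nlim P (P x) G"
  shows "weakly_continuous_on_bounded E F P"
proof (rule weakly_continuousI)
  fix G r x
  assume x: "x \<in> vecs E" and b: "\<forall>\<^sub>F y in G. y \<in> vecs E \<and> nrm E y \<le> r"
    and f: "\<And>f. f \<in> vecs (dual E) \<Longrightarrow> (f \<longlongrightarrow> f x) G"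
  have "((\<lambda>y. y i) \<longlongrightarrow> x i) G" for i
  proof -
    have "((\<lambda>y. if y \<in> vecs E then y i else 0) \<longlongrightarrow> x i) G"
      using f[OF E.coord_dual[of i]] x by simp
    moreover have "\<forall>\<^sub>F y in G. (if y \<in> vecs E then y i else 0) = y i"
      using b by eventually_elim simp
    ultimately show ?thesis by (rule Lim_transform_eventually)
  qed
  then show "F.nlim P (P x) G" by (rule assms[OF x b])
qed

text \<open>The truncation \<open>\<Pi>\<^sub>B P \<pi>\<^sub>A\<close> of argument and value,
  normalised like all polynomials to vanish off the carrier.\<close>

definition cut :: "nat set \<Rightarrow> nat set \<Rightarrow> ((nat \<Rightarrow> 'k) \<Rightarrow> nat \<Rightarrow> 'k) \<Rightarrow> (nat \<Rightarrow> 'k) \<Rightarrow> nat \<Rightarrow> 'k" where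
  "cut A B P x = (if x \<in> vecs E then restr B (P (restr A x)) else 0)"

lemma cut_mem:
  assumes P: "P \<in> vecs (Polys n)"
  shows "cut A B P \<in> vecs (Polys n)" "nrm (Polys n) (cut A B P) \<le> nrm (Polys n) P"
proof -
  have hom: "homogeneous_poly n E F (cut A B P)"
  proof (rule homogeneous_poly_cong)
    show "homogeneous_poly n E F (\<lambda>x. restr B (P (restr A x)))"
      by (rule homogeneous_poly_compose[where P = P and L = "restr A" and M = "restr B"])
        (use P in \<open>simp_all add: vecs_poly_space restr_add E.scl_def F.scl_def restr_mult\<close>)
  qed (simp add: cut_def)
  have le: "nrm F (cut A B P x) \<le> nrm (Polys n) P" if x: "x \<in> vecs E" "nrm E x \<le> 1" for x
  proof -
    have "nrm F (cut A B P x) \<le> nrm F (P (restr A x))"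
      using x poly_mem[OF P] by (simp add: cut_def F.nrm_restr_le)
    also have "\<dots> \<le> nrm (Polys n) P"
      using x E.nrm_restr_le[OF x(1), of A] by (intro nrm_poly_upper[OF P]) auto
    finally show ?thesis .
  qed
  show "cut A B P \<in> vecs (Polys n)"
    unfolding vecs_poly_space using hom le by (auto simp: cut_def)
  show "nrm (Polys n) (cut A B P) \<le> nrm (Polys n) P" by (rule nrm_poly_least[OF le])
qed

lemma cut_add: "cut A B (P + Q) = cut A B P + cut A B Q"
  by (rule ext) (simp add: cut_def restr_add)

lemma cut_scl: "cut A B (scl (Polys n) c P) = scl (Polys n) c (cut A B P)"
  by (rule ext) (auto simp: cut_def F.scl_def restr_mult)

text \<open>On finitely many coordinates, convergence of each coordinate is norm convergence, so
  continuity of \<open>P\<close> is enough.\<close>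

lemma cut_finite_weak:
  assumes P: "P \<in> vecs (Polys n)"
  shows "cut {..<m} B P \<in> weak_polys n E F"
proof -
  have "weakly_continuous_on_bounded E F (cut {..<m} B P)"
  proof (rule weakly_continuous_coordinatewiseI)
    fix G r x
    assume x: "x \<in> vecs E" and b: "\<forall>\<^sub>F y in G. y \<in> vecs E \<and> nrm E y \<le> r"
      and lim: "\<And>i. ((\<lambda>y. y i) \<longlongrightarrow> x i) G"
    have "E.nlim (\<lambda>y. \<Sum>i<m. scl E (y i) (unit_vec i)) (\<Sum>i<m. scl E (x i) (unit_vec i)) G"
      by (intro E.nlim_sum E.nlim_scl2 lim) (auto simp: E.nlim_def)
    then have "E.nlim (\<lambda>y. restr {..<m} y) (restr {..<m} x) G"
      unfolding E.restr_lessThan_eq_sum[symmetric] .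
    then have "F.nlim (\<lambda>y. P (restr {..<m} y)) (P (restr {..<m} x)) G"
      by (intro poly_space_continuous[OF P]) (auto intro: E.restr_finite_mem)
    then have *: "((\<lambda>y. nrm F (P (restr {..<m} y) - P (restr {..<m} x))) \<longlongrightarrow> 0) G"
      unfolding F.nlim_def .
    show "F.nlim (cut {..<m} B P) (cut {..<m} B P x) G" unfolding F.nlim_def
    proof (rule tendsto_sandwich[OF _ _ tendsto_const *])
      show "\<forall>\<^sub>F y in G. 0 \<le> nrm F (cut {..<m} B P y - cut {..<m} B P x)"
        using poly_mem[OF cut_mem(1)[OF P]] by (auto intro!: always_eventually F.nrm_ge_0 F.diff_vecs)
      show "\<forall>\<^sub>F y in G. nrm F (cut {..<m} B P y - cut {..<m} B P x) \<le> nrm F (P (restr {..<m} y) - P (restr {..<m} x))"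
        using b
      proof eventually_elim
        case (elim y)
        then have "cut {..<m} B P y - cut {..<m} B P x = restr B (P (restr {..<m} y) - P (restr {..<m} x))"
          using x by (simp add: cut_def restr_diff)
        then show ?case using poly_mem[OF P] by (simp add: F.nrm_restr_le)
      qed
    qed
  qed
  then show ?thesis using cut_mem(1)[OF P] by (simp add: weak_polys_def)
qed

text \<open>
  Expanded in powers of the coordinate \<open>i\<close>, the difference has coefficients of degree less than \<open>n\<close>,
  which are weakly continuous by assumption.
\<close>

lemma drop_coordinate_weak:
  assumes Q: "Q \<in> vecs (Polys n)"
    and lower: "\<And>k. 1 \<le> k \<Longrightarrow> k < n \<Longrightarrow> weak_polys k E F = vecs (Polys k)"
  shows "Q - cut (- {i}) UNIV Q \<in> weak_polys n E F"
proof -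
  interpret Z: normed_on "Polys n" by (rule normed_on_poly_space)
  have "homogeneous_poly n E F Q" using Q vecs_poly_space by blast
  then obtain R where R: "\<And>j. j \<le> n \<Longrightarrow> homogeneous_poly (n - j) E F (R j)"
    "\<And>t z. z \<in> vecs E \<Longrightarrow> Q (scl E t (unit_vec i) + z) = (\<Sum>j\<le>n. scl F (t ^ j) (R j z))"
    "\<And>j. j \<le> n \<Longrightarrow> \<exists>N c. \<forall>z\<in>vecs E. R j z = (\<Sum>k\<le>N. scl F (c k) (Q (scl E (2 ^ k) (unit_vec i) + z)))"
    "\<And>z. z \<in> vecs E \<Longrightarrow> R 0 z = Q z"
    by (rule homogeneous_poly_expand[OF _ E.unit_vec_mem[of i]]) blast
  define R' where "R' j z = (if z \<in> vecs E then R j z else 0)" for j z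
  have R'_poly: "R' j \<in> vecs (Polys (n - j))" if j: "j \<le> n" for j
    unfolding vecs_poly_space
  proof (intro conjI)
    show "homogeneous_poly (n - j) E F (R' j)"
      by (rule homogeneous_poly_cong[OF R(1)[OF j]]) (simp add: R'_def)
    obtain N c where Nc: "\<And>z. z \<in> vecs E \<Longrightarrow> R j z = (\<Sum>k\<le>N. scl F (c k) (Q (scl E (2 ^ k) (unit_vec i) + z)))"
      using R(3)[OF j] by blast
    show "\<exists>C. \<forall>x\<in>vecs E. nrm E x \<le> 1 \<longrightarrow> nrm F (R' j x) \<le> C"
    proof (intro exI ballI impI)
      fix x assume x: "x \<in> vecs E" "nrm E x \<le> 1"
      have "nrm F (R' j x) \<le> (\<Sum>k\<le>N. nrm F (scl F (c k) (Q (scl E (2 ^ k) (unit_vec i) + x))))"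
        unfolding R'_def using x(1) Nc poly_mem[OF Q] by (simp add: F.nrm_sum)
      also have "\<dots> \<le> (\<Sum>k\<le>N. norm (c k) * (nrm (Polys n) Q * (2 ^ k + 1) ^ n))"
      proof (rule sum_mono)
        fix k
        have "nrm E (scl E (2 ^ k) (unit_vec i) + x) \<le> 2 ^ k + 1"
          using E.nrm_add[of "scl E (2 ^ k) (unit_vec i)" x] x by (simp add: E.nrm_scl norm_power)
        then have "nrm E (scl E (2 ^ k) (unit_vec i) + x) ^ n \<le> (2 ^ k + 1) ^ n"
          using x by (intro power_mono E.nrm_ge_0) auto
        then have "nrm (Polys n) Q * nrm E (scl E (2 ^ k) (unit_vec i) + x) ^ n \<le> nrm (Polys n) Q * (2 ^ k + 1) ^ n"
          using Z.nrm_ge_0[OF Q] by (intro mult_left_mono)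
        moreover have "nrm F (Q (scl E (2 ^ k) (unit_vec i) + x)) \<le>
            nrm (Polys n) Q * nrm E (scl E (2 ^ k) (unit_vec i) + x) ^ n"
          using x by (intro nrm_poly_pow[OF Q]) auto
        ultimately have "nrm F (Q (scl E (2 ^ k) (unit_vec i) + x)) \<le> nrm (Polys n) Q * (2 ^ k + 1) ^ n"
          by (rule order_trans[rotated])
        then show "nrm F (scl F (c k) (Q (scl E (2 ^ k) (unit_vec i) + x))) \<le>
            norm (c k) * (nrm (Polys n) Q * (2 ^ k + 1) ^ n)"
          using poly_mem[OF Q] by (simp add: F.nrm_scl mult_left_mono)
      qed
      finally show "nrm F (R' j x) \<le> (\<Sum>k\<le>N. norm (c k) * (nrm (Polys n) Q * (2 ^ k + 1) ^ n))" .
    qed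
  qed (simp add: R'_def)
  let ?z = "restr (- {i})"
  have expand: "(Q - cut (- {i}) UNIV Q) y = (\<Sum>j<n. scl F (y i ^ Suc j) (R' (Suc j) (?z y)))"
    if y: "y \<in> vecs E" for y
  proof -
    have "scl E (y i) (unit_vec i) + ?z y = y"
      by (auto simp: fun_eq_iff E.scl_def unit_vec_def)
    then have "Q y = (\<Sum>j\<le>n. scl F (y i ^ j) (R j (?z y)))"
      using R(2)[OF E.restr_mem[OF y], of "y i" "- {i}"] by simp
    also have "\<dots> = Q (?z y) + (\<Sum>j<n. scl F (y i ^ Suc j) (R (Suc j) (?z y)))"
      unfolding lessThan_Suc_atMost[symmetric] sum.lessThan_Suc_shift using R(4) y by simp
    finally have Qy: "Q y = Q (?z y) + (\<Sum>j<n. scl F (y i ^ Suc j) (R (Suc j) (?z y)))" .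
    have "cut (- {i}) UNIV Q y = Q (?z y)" using y by (simp add: cut_def restr_UNIV)
    moreover have "R' (Suc j) (?z y) = R (Suc j) (?z y)" for j
      unfolding R'_def using E.restr_mem[OF y] by (rule if_P)
    ultimately show ?thesis unfolding fun_diff_def[of Q] by (simp only: Qy add_diff_cancel_left')
  qed
  have "weakly_continuous_on_bounded E F (Q - cut (- {i}) UNIV Q)"
  proof (rule weakly_continuous_coordinatewiseI)
    fix G r x
    assume x: "x \<in> vecs E" and b: "\<forall>\<^sub>F y in G. y \<in> vecs E \<and> nrm E y \<le> r"
      and lim: "\<And>i. ((\<lambda>y. y i) \<longlongrightarrow> x i) G"
    \<comment> \<open>The points are in the ball only eventually; the value 0 elsewhere provides a
      bound for all of them.\<close>
    define z where "z y = (if y \<in> vecs E \<and> nrm E y \<le> r then ?z y else 0)" for y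
    have z: "z y \<in> vecs E" "nrm E (z y) \<le> \<bar>r\<bar>" for y
      using E.nrm_restr_le[of y "- {i}"] by (auto simp: z_def)
    have zlim: "((\<lambda>y. z y k) \<longlongrightarrow> ?z x k) G" for k
    proof (rule Lim_transform_eventually)
      show "((\<lambda>y. ?z y k) \<longlongrightarrow> ?z x k) G" using lim[of k] by simp
      show "\<forall>\<^sub>F y in G. ?z y k = z y k" using b by eventually_elim (simp add: z_def)
    qed
    have R'lim: "F.nlim (\<lambda>y. R' j (z y)) (R' j (?z x)) G" if j: "1 \<le> j" "j \<le> n" for j
    proof (cases "j = n")
      case False
      then have "R' j \<in> weak_polys (n - j) E F"
        using lower[of "n - j"] R'_poly[OF j(2)] j by simp
      then have "weakly_continuous_on_bounded E F (R' j)" by (simp add: weak_polys_def)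
      then show ?thesis by (rule weak_poly_nlim[OF _ E.restr_mem[OF x] z zlim])
    next
      \<comment> \<open>The top coefficient has degree 0, which the hypothesis on lower degrees does
        not cover, but it is constant.\<close>
      case True
      have "homogeneous_poly 0 E F (R' j)" using R'_poly[OF j(2)] True by (simp add: vecs_poly_space)
      then obtain c where "\<And>y. y \<in> vecs E \<Longrightarrow> R' j y = c" unfolding homogeneous_poly_def by auto
      then have "R' j (z y) = R' j (?z x)" for y using z(1) E.restr_mem[OF x] by metis
      then show ?thesis by (simp add: F.nlim_def)
    qed
    have A: "F.nlim (\<lambda>y. \<Sum>j<n. scl F (y i ^ Suc j) (R' (Suc j) (z y))) (\<Sum>j<n. scl F (x i ^ Suc j) (R' (Suc j) (?z x))) G"
      using R'_poly poly_mem x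
      by (intro F.nlim_sum F.nlim_scl2 tendsto_power lim R'lim F.scl_vecs) (auto intro!: poly_mem[OF R'_poly])
    have B: "\<forall>\<^sub>F y in G. (\<Sum>j<n. scl F (y i ^ Suc j) (R' (Suc j) (z y))) = (Q - cut (- {i}) UNIV Q) y"
      using b by eventually_elim (subst expand, auto simp: z_def)
    show "F.nlim (Q - cut (- {i}) UNIV Q) ((Q - cut (- {i}) UNIV Q) x) G"
      unfolding F.nlim_def expand[OF x]
      by (rule Lim_transform_eventually[OF A[unfolded F.nlim_def]]) (use B in eventually_elim, simp only:)
  qed
  then show ?thesis using Z.diff_vecs[OF Q cut_mem(1)[OF Q]] by (simp add: weak_polys_def)
qed

text \<open>The first m coordinates are dropped one at a time, each step applied to the polynomial
  truncated so far; the weakly continuous differences telescope.\<close>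

lemma head_weak:
  assumes Q: "Q \<in> vecs (Polys n)"
    and lower: "\<And>k. 1 \<le> k \<Longrightarrow> k < n \<Longrightarrow> weak_polys k E F = vecs (Polys k)"
  shows "Q - cut {m..} UNIV Q \<in> weak_polys n E F"
proof (induction m)
  case 0
  interpret Z: normed_on "Polys n" by (rule normed_on_poly_space)
  have "Q = cut {0..} UNIV Q"
    using Q by (auto simp: fun_eq_iff cut_def restr_def vecs_poly_space)
  then have eq: "Q - cut {0..} UNIV Q = 0" by (metis diff_self)
  show ?case unfolding eq by (rule Z.subspace_0[OF subspace_weak_polys])
next
  case (Suc m)
  interpret Z: normed_on "Polys n" by (rule normed_on_poly_space)
  have "cut (- {m}) UNIV (cut {m..} UNIV Q) = cut {Suc m..} UNIV Q"
  proof
    fix x :: "nat \<Rightarrow> 'k"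
    have "restr {m..} (restr (- {m}) x) = restr {Suc m..} x" by (auto simp: fun_eq_iff)
    then show "cut (- {m}) UNIV (cut {m..} UNIV Q) x = cut {Suc m..} UNIV Q x"
      by (simp add: cut_def restr_restr)
  qed
  then have "cut {m..} UNIV Q - cut {Suc m..} UNIV Q \<in> weak_polys n E F"
    using drop_coordinate_weak[OF cut_mem(1)[OF Q], of "{m..}" UNIV m] lower by simp
  from Z.subspace_add[OF subspace_weak_polys Suc this] show ?case by (simp only: diff_add_telescope)
qed

end

section \<open>Approximation by truncations and the norm estimate for the M-ideal\<close>

context lp_lorentz
begin

text \<open>Every fixed coordinate is eventually below the moving cut, so tails become weakly null
  and heads keep the weak limit.\<close>

lemma weak_restr_tail:
  assumes "U \<le> sequentially" "\<And>i. ((\<lambda>m. u m i) \<longlongrightarrow> x i) U"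
  shows "((\<lambda>m. restr {m..} (u m) i) \<longlongrightarrow> (0::'k)) U" "((\<lambda>m. restr {..<m} (u m) i) \<longlongrightarrow> (x i::'k)) U"
proof -
  have ev: "\<forall>\<^sub>F m in U. i < m"
    using assms(1) eventually_gt_at_top[of i] by (rule filter_leD)
  show "((\<lambda>m. restr {m..} (u m) i) \<longlongrightarrow> 0) U"
    by (rule Lim_transform_eventually[OF tendsto_const]) (use ev in eventually_elim, simp)
  show "((\<lambda>m. restr {..<m} (u m) i) \<longlongrightarrow> x i) U"
    by (rule Lim_transform_eventually[OF assms(2)]) (use ev in eventually_elim, simp)
qed

text \<open>Two uniform limits on the ball: heads of the argument have the same weak limit as the
  argument, and values of \<open>R\<close> at weakly convergent points converge in norm, so that
  their tails vanish.\<close>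

lemma cut_approx:
  assumes R: "R \<in> weak_polys n E F"
  shows "(\<lambda>m. nrm (Polys n) (cut {..<m} {..<m} R - R)) \<longlonglongrightarrow> 0"
proof (rule LIMSEQ_I)
  interpret Z: normed_on "Polys n" by (rule normed_on_poly_space)
  have RP: "R \<in> vecs (Polys n)" and Rw: "weakly_continuous_on_bounded E F R"
    using R by (auto simp: weak_polys_def)
  fix e :: real assume e: "0 < e"
  have 1: "\<forall>\<^sub>F m in sequentially. \<forall>x\<in>vecs E. nrm E x \<le> 1 \<longrightarrow> nrm F (R (restr {..<m} x) - R x) \<le> e / 4"
  proof (rule E.uniform_on_ball)
    fix U u x
    assume U: "U \<le> sequentially" and u: "\<And>m. u m \<in> vecs E" "\<And>m. nrm E (u m) \<le> 1"
      and x: "x \<in> vecs E" and lim: "\<And>i. ((\<lambda>m. u m i) \<longlongrightarrow> x i) U"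
    have "nrm E (restr {..<m} (u m)) \<le> 1" for m
      using E.nrm_restr_le[OF u(1)[of m], of "{..<m}"] u(2)[of m] by linarith
    then have "F.nlim (\<lambda>m. R (restr {..<m} (u m))) (R x) U"
      using u by (intro weak_poly_nlim[OF Rw x, of _ 1] weak_restr_tail(2)[OF U lim]) auto
    moreover have "F.nlim (\<lambda>m. R (u m)) (R x) U"
      by (rule weak_poly_nlim[OF Rw x u lim])
    ultimately have *: "((\<lambda>m. nrm F (R (restr {..<m} (u m)) - R x) + nrm F (R (u m) - R x)) \<longlongrightarrow> 0 + 0) U"
      unfolding F.nlim_def by (rule tendsto_add)
    show "((\<lambda>m. nrm F (R (restr {..<m} (u m)) - R (u m))) \<longlongrightarrow> 0) U"
    proof (rule Lim_null_comparison[OF _ *[simplified]])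
      have "nrm F (R (restr {..<m} (u m)) - R (u m)) \<le> nrm F (R (restr {..<m} (u m)) - R x) + nrm F (R (u m) - R x)" for m
        using F.nrm_diff_triangle[of "R (restr {..<m} (u m))" "R x" "R (u m)"]
          F.nrm_diff_commute[of "R x" "R (u m)"] poly_mem[OF RP] by simp
      then show "\<forall>\<^sub>F m in U. norm (nrm F (R (restr {..<m} (u m)) - R (u m)))
          \<le> nrm F (R (restr {..<m} (u m)) - R x) + nrm F (R (u m) - R x)"
        using poly_mem[OF RP] by (simp add: F.nrm_ge_0)
    qed
  qed (use e in simp)
  have 2: "\<forall>\<^sub>F m in sequentially. \<forall>x\<in>vecs E. nrm E x \<le> 1 \<longrightarrow> nrm F (restr {m..} (R x)) \<le> e / 4"
  proof (rule E.uniform_on_ball)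
    fix U u x
    assume U: "U \<le> sequentially" and u: "\<And>m. u m \<in> vecs E" "\<And>m. nrm E (u m) \<le> 1"
      and x: "x \<in> vecs E" and lim: "\<And>i. ((\<lambda>m. u m i) \<longlongrightarrow> x i) U"
    have "F.nlim (\<lambda>m. R (u m)) (R x) U"
      by (rule weak_poly_nlim[OF Rw x u lim])
    moreover have "((\<lambda>m. nrm F (restr {m..} (R x))) \<longlongrightarrow> 0) U"
      using tendsto_mono[OF U F.restr_tail_tendsto[OF poly_mem[OF RP]]] .
    ultimately have *: "((\<lambda>m. nrm F (R (u m) - R x) + nrm F (restr {m..} (R x))) \<longlongrightarrow> 0 + 0) U"
      unfolding F.nlim_def by (rule tendsto_add)
    show "((\<lambda>m. nrm F (restr {m..} (R (u m)))) \<longlongrightarrow> 0) U"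
    proof (rule Lim_null_comparison[OF _ *[simplified]])
      have "nrm F (restr {m..} (R (u m))) \<le> nrm F (R (u m) - R x) + nrm F (restr {m..} (R x))" for m
      proof -
        have "restr {m..} (R (u m)) = restr {m..} (R (u m) - R x) + restr {m..} (R x)"
          unfolding restr_add[symmetric] by simp
        then have "nrm F (restr {m..} (R (u m))) \<le> nrm F (restr {m..} (R (u m) - R x)) + nrm F (restr {m..} (R x))"
          using F.nrm_add[of "restr {m..} (R (u m) - R x)" "restr {m..} (R x)"] poly_mem[OF RP] by simp
        then show ?thesis
          using F.nrm_restr_le[of "R (u m) - R x" "{m..}"] poly_mem[OF RP] by fastforce
      qed
      then show "\<forall>\<^sub>F m in U. norm (nrm F (restr {m..} (R (u m)))) \<le> nrm F (R (u m) - R x) + nrm F (restr {m..} (R x))"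
        using poly_mem[OF RP] by (simp add: F.nrm_ge_0)
    qed
  qed (use e in simp)
  have "\<forall>\<^sub>F m in sequentially. norm (nrm (Polys n) (cut {..<m} {..<m} R - R) - 0) < e"
    using 1 2
  proof eventually_elim
    case (elim m)
    have "nrm (Polys n) (cut {..<m} {..<m} R - R) \<le> e / 2"
    proof (rule nrm_poly_least)
      fix x assume x: "x \<in> vecs E" "nrm E x \<le> 1"
      have mem: "R (restr {..<m} x) \<in> vecs F" "R x \<in> vecs F" by (rule poly_mem[OF RP])+
      have "(cut {..<m} {..<m} R - R) x =
          restr {..<m} (R (restr {..<m} x) - R x) - restr {m..} (R x)"
        using x by (auto simp: cut_def fun_eq_iff)
      then have "nrm F ((cut {..<m} {..<m} R - R) x) \<le>
          nrm F (restr {..<m} (R (restr {..<m} x) - R x)) + nrm F (restr {m..} (R x))"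
        using F.nrm_diff[of "restr {..<m} (R (restr {..<m} x) - R x)" "restr {m..} (R x)"] mem by (simp only: F.restr_mem F.diff_vecs)
      moreover have "nrm F (restr {..<m} (R (restr {..<m} x) - R x)) \<le> e / 4"
        using F.nrm_restr_le[OF F.diff_vecs[OF mem], of "{..<m}"] elim(1) x by fastforce
      ultimately show "nrm F ((cut {..<m} {..<m} R - R) x) \<le> e / 2"
        using elim(2) x by fastforce
    qed
    moreover have "0 \<le> nrm (Polys n) (cut {..<m} {..<m} R - R)"
      by (intro Z.nrm_ge_0 Z.diff_vecs cut_mem(1) RP)
    ultimately show ?case using e by simp
  qed
  then show "\<exists>no. \<forall>m\<ge>no. norm (nrm (Polys n) (cut {..<m} {..<m} R - R) - 0) < e"
    by (simp add: eventually_sequentially)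
qed

text \<open>
  The gliding hump argument applies since \<^term>\<open>Q\<close> is almost additive on far apart blocks: it differs
  by a weakly continuous polynomial from one that ignores the first block.
\<close>

lemma coordinate_tail_small:
  assumes Q: "Q \<in> vecs (Polys n)" and n: "1 \<le> n" "real n < p"
    and lower: "\<And>k. 1 \<le> k \<Longrightarrow> k < n \<Longrightarrow> weak_polys k E F = vecs (Polys k)" and e: "0 < e"
  shows "\<exists>m. \<forall>m'\<ge>m. \<forall>x\<in>vecs E. nrm E x \<le> 1 \<longrightarrow> norm (Q (restr {m'..} x) i) \<le> e"
proof (rule E.gliding_hump[of "real n" "\<lambda>x. Q x i" "nrm (Polys n) Q"])
  interpret Z: normed_on "Polys n" by (rule normed_on_poly_space)
  have hom: "homogeneous_poly n E F Q" using Q vecs_poly_space by blast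
  have Q0: "Q 0 = 0"
    using homogeneous_poly_scl[OF hom E.zero_vecs, of 0] n(1) by (simp add: power_0_left)
  show "norm (Q x i) \<le> nrm (Polys n) Q * nrm E x powr real n" if x: "x \<in> vecs E" for x
  proof -
    have eq: "nrm E x powr real n = nrm E x ^ n"
      using n(1) E.nrm_ge_0[OF x] by (cases "nrm E x = 0") (auto simp: powr_realpow power_0_left)
    show ?thesis
      unfolding eq using F.coord_le[OF poly_mem[OF Q], of x i] nrm_poly_pow[OF Q x] by (rule order_trans)
  qed
  show "(\<lambda>L. Q (restr {..<L} x) i) \<longlonglongrightarrow> Q x i" if x: "x \<in> vecs E" for x
  proof -
    have "E.nlim (\<lambda>L. restr {..<L} x) x sequentially" unfolding E.nlim_def
    proof -
      have "restr {..<L} x - x = - restr {L..} x" for L by (auto simp: fun_eq_iff)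
      then have "nrm E (restr {..<L} x - x) = nrm E (restr {L..} x)" for L
        using E.nrm_minus[OF E.restr_mem[OF x]] by (simp only:)
      then show "(\<lambda>L. nrm E (restr {..<L} x - x)) \<longlonglongrightarrow> 0"
        using E.restr_tail_tendsto[OF x] by (simp only:)
    qed
    then have "F.nlim (\<lambda>L. Q (restr {..<L} x)) (Q x) sequentially"
      using x by (intro poly_space_continuous[OF Q]) auto
    then have "(\<lambda>L. Q (restr {..<L} x) i - Q x i) \<longlonglongrightarrow> 0"
      unfolding F.nlim_def
      by (rule Lim_null_comparison[rotated])
        (use F.coord_le[OF F.diff_vecs[OF poly_mem[OF Q] poly_mem[OF Q]], of _ _ i] in simp)
    then show ?thesis by (simp add: LIM_zero_iff)
  qed
  fix y L and e :: real
  assume y: "y \<in> vecs E" "restr {..<L} y = y" and e: "0 < e"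
  have y0: "y k = 0" if "L \<le> k" for k using fun_cong[OF y(2), of k] that by auto
  \<comment> \<open>The part of \<open>Q\<close> that involves the block carrying \<open>y\<close>.
    It is weakly continuous, hence insensitive to adding far tails.\<close>
  let ?W = "Q - cut {L..} UNIV Q"
  have W: "?W \<in> weak_polys n E F" by (rule head_weak[OF Q lower])
  then have WP: "?W \<in> vecs (Polys n)" and Ww: "weakly_continuous_on_bounded E F ?W"
    by (auto simp: weak_polys_def)
  have "\<forall>\<^sub>F m in sequentially. \<forall>z\<in>vecs E. nrm E z \<le> 1 \<longrightarrow> nrm F (?W (y + restr {m..} z) - ?W y) \<le> e"
  proof (rule E.uniform_on_ball[OF _ e])
    fix U u x
    assume U: "U \<le> sequentially" and u: "\<And>m. u m \<in> vecs E" "\<And>m. nrm E (u m) \<le> 1"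
      and lim: "\<And>k. ((\<lambda>m. u m k) \<longlongrightarrow> x k) U"
    have mem: "y + restr {m..} (u m) \<in> vecs E" for m using y u by simp
    have b: "nrm E (y + restr {m..} (u m)) \<le> nrm E y + 1" for m
      using E.nrm_add[OF y(1) E.restr_mem[OF u(1)], of "{m..}" m] E.nrm_restr_le[OF u(1), of "{m..}" m] u(2)[of m]
      by linarith
    have "((\<lambda>m. (y + restr {m..} (u m)) k) \<longlongrightarrow> y k) U" for k
    proof -
      have "((\<lambda>m. restr {m..} (u m) k) \<longlongrightarrow> 0) U" by (rule weak_restr_tail(1)[OF U lim])
      from tendsto_add[OF tendsto_const[of "y k"] this] show ?thesis by simp
    qed
    from weak_poly_nlim[OF Ww y(1) mem b this]
    show "((\<lambda>m. nrm F (?W (y + restr {m..} (u m)) - ?W y)) \<longlongrightarrow> 0) U"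
      unfolding F.nlim_def .
  qed
  then obtain m0 where m0: "\<And>m z. m0 \<le> m \<Longrightarrow> z \<in> vecs E \<Longrightarrow> nrm E z \<le> 1 \<Longrightarrow>
      nrm F (?W (y + restr {m..} z) - ?W y) \<le> e"
    unfolding eventually_sequentially by blast
  let ?m = "max m0 L"
  have "norm (Q (y + z) i - Q y i - Q z i) \<le> e"
    if z: "z \<in> vecs E" "nrm E z \<le> 1" "restr {?m..} z = z" for z
  proof -
    have z0: "z k = 0" if "k < ?m" for k using fun_cong[OF z(3), of k] that by (auto split: if_splits)
    have "restr {L..} (y + z) = z" using y0 z0 by (auto simp: fun_eq_iff not_le)
    moreover have "restr {L..} y = 0" using y0 by (auto simp: fun_eq_iff)
    \<comment> \<open>Dropping the first L coordinates turns y + z into z and y into 0, so the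
      increment of \<open>?W\<close> from y to y + z is exactly the defect of additivity of
      \<open>Q\<close>.\<close>
    ultimately have "?W (y + z) = Q (y + z) - Q z" "?W y = Q y"
      using y z Q0 by (simp_all add: cut_def restr_UNIV)
    then have eq: "(?W (y + z) - ?W y) i = Q (y + z) i - Q y i - Q z i" by simp
    have "nrm F (?W (y + z) - ?W y) \<le> e" using m0[of ?m z] z by (simp only: max.cobounded1)
    moreover have "norm ((?W (y + z) - ?W y) i) \<le> nrm F (?W (y + z) - ?W y)"
      by (intro F.coord_le F.diff_vecs poly_mem[OF WP])
    ultimately show ?thesis unfolding eq by (rule order_trans[rotated])
  qed
  then show "\<exists>m. \<forall>z\<in>vecs E. nrm E z \<le> 1 \<and> restr {m..} z = z \<longrightarrow> norm (Q (y + z) i - Q y i - Q z i) \<le> e"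
    by blast
qed (use n e in auto)

lemma nrm_finite_le: "nrm F (restr {..<l} y) \<le> (\<Sum>i<l. norm (y i))"
proof -
  have "nrm F (restr {..<l} y) \<le> (\<Sum>i<l. nrm F (scl F (y i) (unit_vec i)))"
    unfolding F.restr_lessThan_eq_sum by (rule F.nrm_sum) simp
  then show ?thesis by (simp add: F.nrm_scl)
qed

text \<open>After replacing \<open>R\<close> by a truncation with arguments and values in the first
  l coordinates, the two summands depend on disjoint blocks of x, whose p-th powers sum to at most
  1. It remains to compare the norms of the values with these powers.\<close>

lemma cut_sum_eventually_le:
  assumes R: "R \<in> weak_polys n E F" "nrm (Polys n) R \<le> 1"
    and Q: "Q \<in> vecs (Polys n)" "nrm (Polys n) Q \<le> 1"
    and n: "1 \<le> n" "p / q \<le> real n"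
    and lower: "\<And>k. 1 \<le> k \<Longrightarrow> k < n \<Longrightarrow> weak_polys k E F = vecs (Polys k)" and e: "0 < e"
  shows "\<forall>\<^sub>F m in sequentially. nrm (Polys n) (R + cut {m..} UNIV Q) \<le> 1 + e"
proof -
  interpret Z: normed_on "Polys n" by (rule normed_on_poly_space)
  have RP: "R \<in> vecs (Polys n)" using R by (auto simp: weak_polys_def)
  obtain l where l: "nrm (Polys n) (cut {..<l} {..<l} R - R) < e / 2"
    using order_tendstoD(2)[OF cut_approx[OF R(1)], of "e / 2"] e
    by (auto simp: eventually_sequentially)
  let ?R = "cut {..<l} {..<l} R"
  have RlP: "?R \<in> vecs (Polys n)" by (rule cut_mem(1)[OF RP])
  have parts: "nrm F (?R x) \<le> nrm E (restr {..<l} x) ^ n \<and> nrm F (Q (restr {m..} x)) \<le> nrm E (restr {m..} x) ^ n \<and>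
      nrm E (restr {..<l} x) powr p + nrm E (restr {m..} x) powr p \<le> 1"
    if x: "x \<in> vecs E" "nrm E x \<le> 1" and m: "l \<le> m" for x m
  proof (intro conjI)
    have "?R x = restr {..<l} (R (restr {..<l} x))" using x by (simp add: cut_def)
    then have "nrm F (?R x) \<le> nrm F (R (restr {..<l} x))"
      using F.nrm_restr_le[OF poly_mem[OF RP], of "{..<l}" "restr {..<l} x"] by (simp only:)
    also have "\<dots> \<le> nrm (Polys n) R * nrm E (restr {..<l} x) ^ n"
      using x by (intro nrm_poly_pow[OF RP]) simp
    also have "\<dots> \<le> 1 * nrm E (restr {..<l} x) ^ n"
      using R(2) x E.nrm_ge_0 by (intro mult_right_mono) auto
    finally show "nrm F (?R x) \<le> nrm E (restr {..<l} x) ^ n" by simp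
    have "nrm F (Q (restr {m..} x)) \<le> nrm (Polys n) Q * nrm E (restr {m..} x) ^ n"
      using x by (intro nrm_poly_pow[OF Q(1)]) simp
    also have "\<dots> \<le> 1 * nrm E (restr {m..} x) ^ n"
      using Q(2) x E.nrm_ge_0 by (intro mult_right_mono) auto
    finally show "nrm F (Q (restr {m..} x)) \<le> nrm E (restr {m..} x) ^ n" by simp
    have "nrm E (restr {m..} x) \<le> nrm E (restr {l..} x)"
      using x m by (intro E.solid(2)) auto
    then have "nrm E (restr {m..} x) powr p \<le> nrm E (restr {l..} x) powr p"
      using x E.p E.nrm_ge_0 by (intro powr_mono2) auto
    moreover have "nrm E x powr p \<le> 1" using x E.p E.nrm_ge_0 by (intro powr_le1) auto
    ultimately show "nrm E (restr {..<l} x) powr p + nrm E (restr {m..} x) powr p \<le> 1"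
      using E.restr_powr_split[OF x(1), of l] by linarith
  qed
  have small: "nrm E (restr A x) \<le> 1" "0 \<le> nrm E (restr A x)" if "x \<in> vecs E" "nrm E x \<le> 1" for x A
    using E.nrm_restr_le[OF that(1), of A] that E.nrm_ge_0[OF E.restr_mem[OF that(1)]] by auto
  have main: "\<forall>\<^sub>F m in sequentially. \<forall>x\<in>vecs E. nrm E x \<le> 1 \<longrightarrow> nrm F (?R x + Q (restr {m..} x)) \<le> 1 + e / 2"
  proof (cases "p \<le> real n")
    \<comment> \<open>For exponent n \<ge> p and norms at most 1, the two values have norms below
      the p-th powers of their blocks, so overlapping supports do no harm.\<close>
    case True
    have "nrm F (?R x + Q (restr {m..} x)) \<le> 1 + e / 2" if x: "x \<in> vecs E" "nrm E x \<le> 1" and m: "l \<le> m" for m x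
    proof -
      have pw: "nrm E (restr A x) ^ n \<le> nrm E (restr A x) powr p" for A
      proof (cases "nrm E (restr A x) = 0")
        case False
        then have "nrm E (restr A x) ^ n = nrm E (restr A x) powr real n"
          using small(2)[OF x, of A] by (simp add: powr_realpow)
        also have "\<dots> \<le> nrm E (restr A x) powr p"
          using True small[OF x] by (intro powr_mono') auto
        finally show ?thesis .
      qed (use n in \<open>simp add: power_0_left\<close>)
      have "nrm F (?R x + Q (restr {m..} x)) \<le> nrm F (?R x) + nrm F (Q (restr {m..} x))"
        by (intro F.nrm_add poly_mem[OF RlP] poly_mem[OF Q(1)])
      then show ?thesis using parts[OF x m] pw[of "{..<l}"] pw[of "{m..}"] e by linarith
    qed
    then show ?thesis unfolding eventually_sequentially by blast
  next
    case False
    \<comment> \<open>There are l coordinates to discard, with a total cost of at most e/2.\<close>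
    define e' where "e' = e / (2 * (real l + 1))"
    have e': "0 < e'" "real l * e' \<le> e / 2" using e by (auto simp: e'_def field_simps)
    have "\<forall>\<^sub>F m in sequentially. \<forall>x\<in>vecs E. nrm E x \<le> 1 \<longrightarrow> norm (Q (restr {m..} x) i) \<le> e'" for i
      using coordinate_tail_small[OF Q(1) n(1) _ lower e'(1), of i] False
      unfolding eventually_sequentially by auto
    then have "\<forall>\<^sub>F m in sequentially. \<forall>i\<in>{..<l}. \<forall>x\<in>vecs E. nrm E x \<le> 1 \<longrightarrow> norm (Q (restr {m..} x) i) \<le> e'"
      by (intro eventually_ball_finite) auto
    moreover have "\<forall>\<^sub>F m in sequentially. l \<le> m" by (rule eventually_ge_at_top)
    ultimately show ?thesis
    proof eventually_elim
      case (elim m)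
      show ?case
      proof (intro ballI impI)
        fix x assume x: "x \<in> vecs E" "nrm E x \<le> 1"
        let ?y = "Q (restr {m..} x)"
        have y: "?y \<in> vecs F" by (rule poly_mem[OF Q(1)])
        have pw: "(nrm E (restr A x) ^ n) powr q \<le> nrm E (restr A x) powr p" for A
        proof (cases "nrm E (restr A x) = 0")
          case False
          then have "(nrm E (restr A x) ^ n) powr q = nrm E (restr A x) powr (real n * q)"
            using small(2)[OF x, of A] by (simp add: powr_realpow[symmetric] powr_powr)
          also have "\<dots> \<le> nrm E (restr A x) powr p"
            using n(2) q small[OF x] by (intro powr_mono') (auto simp: field_simps)
          finally show ?thesis .
        qed (use n in \<open>simp add: power_0_left\<close>)
        \<comment> \<open>The bracket has disjoint supports, as needed for the upper q-estimate; the
          last term consists of the small first coordinates.\<close>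
        have "?R x + ?y = (?R x + restr {l..} ?y) + restr {..<l} ?y"
          by (auto simp: fun_eq_iff)
        moreover have mem: "?R x \<in> vecs F" "restr {l..} ?y \<in> vecs F" "restr {..<l} ?y \<in> vecs F"
          using y poly_mem[OF RlP] by auto
        ultimately have tri: "nrm F (?R x + ?y) \<le> nrm F (?R x + restr {l..} ?y) + nrm F (restr {..<l} ?y)"
          using F.nrm_add[of "?R x + restr {l..} ?y" "restr {..<l} ?y"] by (simp only: F.add_vecs)
        have "nrm F (restr {..<l} ?y) \<le> (\<Sum>i<l. norm (?y i))" by (rule nrm_finite_le)
        also have "\<dots> \<le> (\<Sum>i<l. e')" using elim(1) x by (intro sum_mono) auto
        also have "\<dots> \<le> e / 2" using e'(2) by simp
        finally have tail: "nrm F (restr {..<l} ?y) \<le> e / 2" .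
        have "nrm F (?R x + restr {l..} ?y) powr q \<le> nrm F (?R x) powr q + nrm F (restr {l..} ?y) powr q"
          using mem by (intro F.nrm_disjoint) (auto simp: cut_def)
        also have "nrm F (?R x) powr q \<le> (nrm E (restr {..<l} x) ^ n) powr q"
          using parts[OF x elim(2)] q F.nrm_ge_0[OF mem(1)] by (intro powr_mono2) auto
        also have "\<dots> \<le> nrm E (restr {..<l} x) powr p" by (rule pw)
        also have "nrm F (restr {l..} ?y) powr q \<le> (nrm E (restr {m..} x) ^ n) powr q"
          using parts[OF x elim(2)] q F.nrm_ge_0[OF mem(2)] F.nrm_restr_le[OF y, of "{l..}"]
          by (intro powr_mono2) linarith+
        also have "\<dots> \<le> nrm E (restr {m..} x) powr p" by (rule pw)
        finally have "nrm F (?R x + restr {l..} ?y) powr q \<le> 1"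
          using parts[OF x elim(2)] by linarith
        then have "nrm F (?R x + restr {l..} ?y) \<le> 1"
          using q by (smt (verit) gr_one_powr)
        then show "nrm F (?R x + ?y) \<le> 1 + e / 2" using tri tail by linarith
      qed
    qed
  qed
  then show ?thesis
  proof eventually_elim
    case (elim m)
    show ?case
    proof (rule nrm_poly_least)
      fix x assume x: "x \<in> vecs E" "nrm E x \<le> 1"
      have mem: "?R x \<in> vecs F" "R x \<in> vecs F" "Q (restr {m..} x) \<in> vecs F"
        by (rule poly_mem[OF RlP] poly_mem[OF RP] poly_mem[OF Q(1)])+
      have eq: "(R + cut {m..} UNIV Q) x = (?R x + Q (restr {m..} x)) - (?R - R) x"
        using x by (simp add: cut_def[of "{m..}"] restr_UNIV)
      have "nrm F ((?R x + Q (restr {m..} x)) - (?R - R) x) \<le>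
          nrm F (?R x + Q (restr {m..} x)) + nrm F ((?R - R) x)"
        using mem by (intro F.nrm_diff) auto
      moreover have "nrm F ((?R - R) x) \<le> e / 2"
        using nrm_poly_upper[OF Z.diff_vecs[OF RlP RP] x] l by linarith
      moreover have "nrm F (?R x + Q (restr {m..} x)) \<le> 1 + e / 2" using elim x by blast
      ultimately show "nrm F ((R + cut {m..} UNIV Q) x) \<le> 1 + e" unfolding eq by linarith
    qed
  qed
qed

theorem M_ideal_weak_polys:
  assumes n: "1 \<le> n" "p / q \<le> real n"
    and lower: "\<And>k. 1 \<le> k \<Longrightarrow> k < n \<Longrightarrow> weak_polys k E F = vecs (Polys k)"
  shows "M_ideal (Polys n) (weak_polys n E F)"
proof -
  interpret Z: normed_on "Polys n" by (rule normed_on_poly_space)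
  show ?thesis
  proof (rule Z.M_ideal_criterion[where S = "\<lambda>m. cut {..<m} {..<m}" and D = "\<lambda>m. cut {m..} UNIV"])
    show "banach_on (Polys n)" by (rule banach_on_poly_space[OF F.complete])
    show "weak_polys n E F \<subseteq> vecs (Polys n)" by (auto simp: weak_polys_def)
    show "module.subspace (scl (Polys n)) (weak_polys n E F)" by (rule subspace_weak_polys)
    show "closedin (ntop (Polys n)) (weak_polys n E F)" by (rule closedin_weak_polys)
    fix x m assume x: "x \<in> vecs (Polys n)"
    show "cut {..<m} {..<m} x \<in> weak_polys n E F" by (rule cut_finite_weak[OF x])
    show "nrm (Polys n) (cut {..<m} {..<m} x) \<le> nrm (Polys n) x" by (rule cut_mem(2)[OF x])
    show "cut {m..} UNIV x \<in> vecs (Polys n)" by (rule cut_mem(1)[OF x])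
    show "nrm (Polys n) (cut {m..} UNIV x) \<le> nrm (Polys n) x" by (rule cut_mem(2)[OF x])
    show "x - cut {m..} UNIV x \<in> weak_polys n E F" by (rule head_weak[OF x lower])
    show "cut {..<m} {..<m} (scl (Polys n) c x) = scl (Polys n) c (cut {..<m} {..<m} x)"
      "cut {m..} UNIV (scl (Polys n) c x) = scl (Polys n) c (cut {m..} UNIV x)" for c
      by (rule cut_scl)+
    show "cut {..<m} {..<m} (x + y) = cut {..<m} {..<m} x + cut {..<m} {..<m} y" for y
      by (rule cut_add)
  next
    fix R assume "R \<in> weak_polys n E F"
    then show "(\<lambda>m. nrm (Polys n) (cut {..<m} {..<m} R - R)) \<longlonglongrightarrow> 0" by (rule cut_approx)
  next
    fix R Q and e :: real
    assume "R \<in> weak_polys n E F" "nrm (Polys n) R \<le> 1" "Q \<in> vecs (Polys n)" "nrm (Polys n) Q \<le> 1" "0 < e"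
    then show "\<forall>\<^sub>F m in sequentially. nrm (Polys n) (R + cut {m..} UNIV Q) \<le> 1 + e"
      using cut_sum_eventually_le n lower by blast
  qed
qed

end

section \<open>Failure of the 2-ball property\<close>

context lp_lorentz
begin

lemma sum_le_nrm_powr:
  assumes "x \<in> vecs E" "finite S"
  shows "(\<Sum>i\<in>S. norm (x i) powr p) \<le> nrm E x powr p"
proof -
  obtain M where "S \<subseteq> {..<M}" using assms(2) finite_nat_iff_bounded by blast
  then have "(\<Sum>i\<in>S. norm (x i) powr p) \<le> (\<Sum>i<M. norm (x i) powr p)"
    by (intro sum_mono2) auto
  also have "\<dots> \<le> nrm E x powr p" using E.nballD[OF assms(1) order_refl, of id M] by simp
  finally show ?thesis .
qed

text \<open>One form for both test polynomials: slot i is read at the coordinate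
  \<open>\<phi> i j\<close>. The peak polynomial always reads coordinate 0, the mixed one in k - n
  slots, and in the others coordinate j.\<close>

lemma multilinear_on_prod:
  assumes "\<And>xs. length xs = k \<Longrightarrow> set xs \<subseteq> vecs E \<Longrightarrow> (\<lambda>j. c j * (\<Prod>i<k. (xs ! i) (\<phi> i j))) \<in> vecs F"
  shows "multilinear_on k E F (\<lambda>xs j. c j * (\<Prod>i<k. (xs ! i) (\<phi> i j)))"
  unfolding multilinear_on_def
proof (intro allI impI conjI ballI)
  fix xs assume xs: "length xs = k \<and> set xs \<subseteq> vecs E"
  then show "(\<lambda>j. c j * (\<Prod>i<k. (xs ! i) (\<phi> i j))) \<in> vecs F" using assms by blast
  have upd: "(\<Prod>i<k. (xs[m := a] ! i) (\<phi> i j)) = a (\<phi> m j) * (\<Prod>i\<in>{..<k} - {m}. (xs ! i) (\<phi> i j))"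
    if m: "m < k" for m a j
  proof -
    have "(\<Prod>i<k. (xs[m := a] ! i) (\<phi> i j)) =
        (xs[m := a] ! m) (\<phi> m j) * (\<Prod>i\<in>{..<k} - {m}. (xs[m := a] ! i) (\<phi> i j))"
      using m by (intro prod.remove) auto
    also have "(\<Prod>i\<in>{..<k} - {m}. (xs[m := a] ! i) (\<phi> i j)) = (\<Prod>i\<in>{..<k} - {m}. (xs ! i) (\<phi> i j))"
      by (intro prod.cong) auto
    finally show ?thesis using xs m by simp
  qed
  fix m a assume m: "m < k"
  show "(\<lambda>j. c j * (\<Prod>i<k. (xs[m := a + b] ! i) (\<phi> i j))) =
      (\<lambda>j. c j * (\<Prod>i<k. (xs[m := a] ! i) (\<phi> i j))) + (\<lambda>j. c j * (\<Prod>i<k. (xs[m := b] ! i) (\<phi> i j)))" for b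
    by (simp add: fun_eq_iff upd[OF m] algebra_simps)
  show "(\<lambda>j. c j * (\<Prod>i<k. (xs[m := scl E d a] ! i) (\<phi> i j))) =
      scl F d (\<lambda>j. c j * (\<Prod>i<k. (xs[m := a] ! i) (\<phi> i j)))" for d
    by (simp add: fun_eq_iff upd[OF m] E.scl_def F.scl_def algebra_simps)
qed

section \<open>The test polynomials and their norms\<close>

definition peak :: "nat \<Rightarrow> (nat \<Rightarrow> 'k) \<Rightarrow> nat \<Rightarrow> 'k" where
  "peak k x = (if x \<in> vecs E then (\<lambda>j. if j = 0 then x 0 ^ k else 0) else 0)"

lemma peak_mem: "peak k \<in> weak_polys k E F" "nrm (Polys k) (peak k) \<le> 1"
proof -
  have hom: "homogeneous_poly k E F (peak k)"
    unfolding homogeneous_poly_def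
  proof (intro exI conjI ballI)
    show "multilinear_on k E F (\<lambda>xs j. (if j = 0 then 1 else 0) * (\<Prod>i<k. (xs ! i) 0))"
      by (rule multilinear_on_prod) (rule F.finite_support_mem(1)[of "{0}"], auto)
    fix x assume "x \<in> vecs E"
    then show "peak k x = (\<lambda>j. (if j = 0 then 1 else 0) * (\<Prod>i<k. (replicate k x ! i) 0))"
      by (simp add: peak_def fun_eq_iff)
  qed
  have le: "nrm F (peak k x) \<le> 1" if x: "x \<in> vecs E" "nrm E x \<le> 1" for x
  proof -
    have "norm (x 0) \<le> 1" using E.coord_le[OF x(1), of 0] x(2) by simp
    then have "norm (x 0 ^ k) \<le> 1" by (simp add: norm_power power_le_one)
    moreover have "peak k x = restr {..<1} (\<lambda>j. x 0 ^ k)" using x by (auto simp: peak_def fun_eq_iff)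
    ultimately show ?thesis using nrm_finite_le[of 1 "\<lambda>j. x 0 ^ k"] by simp
  qed
  have P: "peak k \<in> vecs (Polys k)"
    unfolding vecs_poly_space using hom le by (auto simp: peak_def)
  \<comment> \<open>The peak depends on one coordinate only, hence is weakly continuous.\<close>
  have "cut {..<1} UNIV (peak k) = peak k"
    by (auto simp: fun_eq_iff cut_def peak_def)
  then show "peak k \<in> weak_polys k E F" using cut_finite_weak[OF P, of 1 UNIV] by simp
  show "nrm (Polys k) (peak k) \<le> 1" by (rule nrm_poly_least[OF le])
qed

text \<open>Boundedness of the diagonal polynomial from which the mixed one is built. Its constant
  is 1 if n q \<ge> p and depends on the weight if n q < p.\<close>

definition power_bounded :: "nat \<Rightarrow> real \<Rightarrow> bool" where
  "power_bounded n K \<longleftrightarrow>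
    (\<forall>x\<in>vecs E. (\<lambda>j. x j ^ n) \<in> vecs F \<and> nrm F (\<lambda>j. x j ^ n) \<le> K * nrm E x ^ n)"

lemma power_boundedI:
  assumes K: "0 \<le> K" and "\<And>x \<tau> N. x \<in> vecs E \<Longrightarrow> nrm E x \<le> 1 \<Longrightarrow> bij \<tau> \<Longrightarrow>
    (\<Sum>j<N. w j * (norm (x (\<tau> j)) ^ n) powr q) \<le> K powr q"
  shows "power_bounded n K"
proof -
  have ball: "(\<lambda>j. x j ^ n) \<in> vecs F \<and> nrm F (\<lambda>j. x j ^ n) \<le> K" if "x \<in> vecs E" "nrm E x \<le> 1" for x
    using F.nballI[of K "\<lambda>j. x j ^ n"] K assms(2)[OF that] by (auto simp: norm_power)
  show ?thesis unfolding power_bounded_def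
  proof
    fix x assume x: "x \<in> vecs E"
    show "(\<lambda>j. x j ^ n) \<in> vecs F \<and> nrm F (\<lambda>j. x j ^ n) \<le> K * nrm E x ^ n"
    proof (cases "x = 0")
      case True
      show ?thesis
      proof (cases "n = 0")
        case False
        then have "(\<lambda>j. x j ^ n) = 0" using True by (simp add: fun_eq_iff power_0_left)
        then show ?thesis using K True E.nrm_0 F.nrm_0 F.zero_vecs by (simp only:) simp
      qed (use ball[of x] True x in simp)
    next
      case False
      obtain u where u: "u \<in> vecs E" "nrm E u = 1" "scl E (of_real (nrm E x)) u = x"
        using E.normalize_nrm[OF x False] x E.scl_vecs by metis
      have "(\<lambda>j. x j ^ n) = scl F (of_real (nrm E x) ^ n) (\<lambda>j. u j ^ n)"
        unfolding F.scl_def by (subst u(3)[symmetric]) (simp add: E.scl_def power_mult_distrib)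
      moreover have "(\<lambda>j. u j ^ n) \<in> vecs F" "nrm F (\<lambda>j. u j ^ n) \<le> K" using ball u by auto
      ultimately show ?thesis
        using mult_right_mono[of "nrm F (\<lambda>j. u j ^ n)" K "nrm E x ^ n"] E.nrm_ge_0[OF x]
        by (simp add: F.nrm_scl norm_power mult.commute[of "nrm E x ^ n"])
    qed
  qed
qed

text \<open>Entries of a unit vector have modulus at most 1, so their powers of order n q \<ge> p
  are at most those of order p.\<close>

lemma power_bounded_1:
  assumes n: "p / q \<le> real n" "1 \<le> n"
  shows "power_bounded n 1"
proof (rule power_boundedI)
  fix x :: "nat \<Rightarrow> 'k" and \<tau> :: "nat \<Rightarrow> nat" and N assume x: "x \<in> vecs E" "nrm E x \<le> 1" and \<tau>: "bij \<tau>"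
  have "(\<Sum>j<N. w j * (norm (x (\<tau> j)) ^ n) powr q) \<le> (\<Sum>j<N. norm (x (\<tau> j)) powr p)"
  proof (rule sum_mono)
    fix j
    have le1: "norm (x (\<tau> j)) \<le> 1" using E.coord_le[OF x(1), of "\<tau> j"] x(2) by simp
    have "(norm (x (\<tau> j)) ^ n) powr q \<le> norm (x (\<tau> j)) powr p"
    proof (cases "x (\<tau> j) = 0")
      case False
      then have "(norm (x (\<tau> j)) ^ n) powr q = norm (x (\<tau> j)) powr (real n * q)"
        by (simp add: powr_realpow[symmetric] powr_powr)
      also have "\<dots> \<le> norm (x (\<tau> j)) powr p"
        using n q le1 by (intro powr_mono') (auto simp: field_simps)
      finally show ?thesis .
    qed (use n in \<open>simp add: power_0_left\<close>)
    moreover have "w j * (norm (x (\<tau> j)) ^ n) powr q \<le> (norm (x (\<tau> j)) ^ n) powr q"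
      using F.v by (simp add: mult_left_le_one_le)
    ultimately show "w j * (norm (x (\<tau> j)) ^ n) powr q \<le> norm (x (\<tau> j)) powr p" by linarith
  qed
  also have "\<dots> = (\<Sum>i\<in>\<tau> ` {..<N}. norm (x i) powr p)"
    using bij_is_inj[OF \<tau>] by (subst sum.reindex) (auto intro: inj_on_subset)
  also have "\<dots> \<le> nrm E x powr p" by (rule sum_le_nrm_powr[OF x(1)]) simp
  also have "\<dots> \<le> 1" using x E.p E.nrm_ge_0 by (intro powr_le1) auto
  finally show "(\<Sum>j<N. w j * (norm (x (\<tau> j)) ^ n) powr q) \<le> 1 powr q" by simp
qed simp

text \<open>Young's inequality with r = p/(n q) and its conjugate s separates the weight, summable
  to the power s, from the entries, whose powers of order n q r = p are summable in any
  order.\<close>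

lemma power_bounded_Young:
  assumes n: "1 \<le> n" "real n < p / q" and w: "w \<in> ell (conj_exp (ereal p / ereal (real n * q)))"
  shows "\<exists>K\<ge>0. power_bounded n K"
proof -
  define r where "r = p / (real n * q)"
  have nq: "0 < real n * q" "real n * q < p" using n q by (auto simp: field_simps)
  then have r: "1 < r" by (simp add: r_def)
  define s where "s = r / (r - 1)"
  have s: "1 < s" "1 / r + 1 / s = 1" using r by (auto simp: s_def field_simps)
  have "ereal p / ereal (real n * q) = ereal r" using nq n q by (simp add: r_def)
  moreover have "conj_exp (ereal r) = ereal s"
  proof -
    have "1 - inverse r = (r - 1) / r" using r by (simp add: field_simps)
    moreover have "1 - inverse (ereal r) = ereal (1 - inverse r)"
      using r by (simp add: one_ereal_def)
    ultimately show ?thesis using r by (simp add: conj_exp_def s_def)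
  qed
  ultimately have "summable (\<lambda>j. norm (w j) powr s)" using w by (simp add: ell_def)
  then have sw: "summable (\<lambda>j. w j powr s)" using F.v by simp
  define W where "W = (\<Sum>j. w j powr s)"
  have W: "0 \<le> W" unfolding W_def using sw by (intro suminf_nonneg) auto
  \<comment> \<open>\<open>W\<close> bounds the sum for the weight and 1 the sum for the unit
    vector. The constant is not optimal; \<open>c\<close> will absorb it.\<close>
  have "power_bounded n ((W + 1) powr (1 / q))"
  proof (rule power_boundedI)
    fix x :: "nat \<Rightarrow> 'k" and \<tau> :: "nat \<Rightarrow> nat" and N assume x: "x \<in> vecs E" "nrm E x \<le> 1" and \<tau>: "bij \<tau>"
    have "(\<Sum>j<N. w j * (norm (x (\<tau> j)) ^ n) powr q) \<le> (\<Sum>j<N. w j powr s + norm (x (\<tau> j)) powr p)"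
    proof (rule sum_mono)
      fix j
      let ?a = "(norm (x (\<tau> j)) ^ n) powr q"
      have a: "?a powr r = norm (x (\<tau> j)) powr p"
      proof (cases "x (\<tau> j) = 0")
        case False
        then have "?a powr r = norm (x (\<tau> j)) powr (real n * q * r)"
          by (simp add: powr_realpow[symmetric] powr_powr)
        moreover have "real n * q * r = p" using n q by (simp add: r_def)
        ultimately show ?thesis by (simp only:)
      qed (use n in \<open>simp add: power_0_left\<close>)
      have "w j * ?a \<le> w j powr s / s + ?a powr r / r"
        using s r F.v by (intro Youngs_inequality) auto
      also have "\<dots> \<le> w j powr s + ?a powr r"
        using s r by (intro add_mono) (auto simp: divide_le_eq mult_le_cancel_left1)
      finally show "w j * ?a \<le> w j powr s + norm (x (\<tau> j)) powr p" unfolding a .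
    qed
    also have "\<dots> = (\<Sum>j<N. w j powr s) + (\<Sum>j<N. norm (x (\<tau> j)) powr p)"
      by (rule sum.distrib)
    also have "(\<Sum>j<N. w j powr s) \<le> W" unfolding W_def using sw by (intro sum_le_suminf) auto
    also have "(\<Sum>j<N. norm (x (\<tau> j)) powr p) = (\<Sum>i\<in>\<tau> ` {..<N}. norm (x i) powr p)"
      using bij_is_inj[OF \<tau>] by (subst sum.reindex) (auto intro: inj_on_subset)
    also have "\<dots> \<le> nrm E x powr p" by (rule sum_le_nrm_powr[OF x(1)]) simp
    also have "\<dots> \<le> 1" using x E.p E.nrm_ge_0 by (intro powr_le1) auto
    finally show "(\<Sum>j<N. w j * (norm (x (\<tau> j)) ^ n) powr q) \<le> ((W + 1) powr (1 / q)) powr q"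
      using W q by (simp add: powr_powr)
  qed simp
  then show ?thesis by (intro exI[of _ "(W + 1) powr (1 / q)"]) simp
qed

text \<open>Restricting to the indices from 1 on keeps coordinate 0 of the value, for n \<ge> 1,
  free for the peak.\<close>

definition mixed :: "real \<Rightarrow> nat \<Rightarrow> nat \<Rightarrow> (nat \<Rightarrow> 'k) \<Rightarrow> nat \<Rightarrow> 'k" where
  "mixed c k n x = (if x \<in> vecs E then (\<lambda>j. of_real c * x 0 ^ (k - n) * restr {1..} x j ^ n) else 0)"

text \<open>With t the modulus of coordinate 0 and s the norm of the remaining coordinates, t and s
  obey the constraint in \<open>le\<close>, which therefore bounds the norm by 1.\<close>

lemma mixed_mem:
  assumes n: "1 \<le> n" "n \<le> k" and c: "0 \<le> c" and K: "power_bounded n K"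
    and le: "\<And>t s. 0 \<le> t \<Longrightarrow> 0 \<le> s \<Longrightarrow> t powr p + s powr p \<le> 1 \<Longrightarrow> c * K * t ^ (k - n) * s ^ n \<le> 1"
  shows "mixed c k n \<in> vecs (Polys k)" "nrm (Polys k) (mixed c k n) \<le> 1"
proof -
  define \<phi> where "\<phi> i j = (if i < k - n then 0 else j)" for i j :: nat
  have prod_\<phi>: "(\<Prod>i<k. y (\<phi> i j)) = y 0 ^ (k - n) * y j ^ n" for y :: "nat \<Rightarrow> 'b::comm_monoid_mult" and j
  proof -
    have "(\<Prod>i<k. y (\<phi> i j)) = (\<Prod>i<k. if i < k - n then y 0 else y j)"
      by (intro prod.cong) (auto simp: \<phi>_def)
    also have "\<dots> = (\<Prod>i\<in>{..<k} \<inter> {i. i < k - n}. y 0) * (\<Prod>i\<in>{..<k} \<inter> - {i. i < k - n}. y j)"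
      by (rule prod.If_cases) simp
    also have "{..<k} \<inter> {i. i < k - n} = {..<k - n}" by auto
    also have "{..<k} \<inter> - {i. i < k - n} = {k - n..<k}" using n by auto
    finally show ?thesis using n by simp
  qed
  let ?c = "\<lambda>j. if j = 0 then 0 else of_real c :: 'k"
  have hom: "homogeneous_poly k E F (mixed c k n)"
    unfolding homogeneous_poly_def
  proof (intro exI conjI ballI)
    show "multilinear_on k E F (\<lambda>xs j. ?c j * (\<Prod>i<k. (xs ! i) (\<phi> i j)))"
    proof (rule multilinear_on_prod)
      fix xs :: "(nat \<Rightarrow> 'k) list" assume xs: "length xs = k" "set xs \<subseteq> vecs E"
      \<comment> \<open>The sum of the moduli of all slots dominates each of them. A product over
        different vectors is thus reduced to the power of a single vector, to which
        \<open>power_bounded\<close> applies.\<close>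
      define y :: "nat \<Rightarrow> 'k" where "y = (\<Sum>i<k. (\<lambda>j. of_real (norm ((xs ! i) j))))"
      have yE: "y \<in> vecs E"
        unfolding y_def
      proof (rule E.sum_vecs)
        fix i assume "i \<in> {..<k}"
        then have "xs ! i \<in> vecs E" using xs by auto
        then show "(\<lambda>j. of_real (norm ((xs ! i) j))) \<in> vecs E"
          by (rule E.solid(1)) simp
      qed
      have yn: "norm (y j) = (\<Sum>i<k. norm ((xs ! i) j))" for j
      proof -
        have "y j = of_real (\<Sum>i<k. norm ((xs ! i) j))" by (simp add: y_def sum_fun_apply)
        then show ?thesis by (simp only: norm_of_real abs_of_nonneg sum_nonneg norm_ge_zero)
      qed
      have xy: "norm ((xs ! i) j) \<le> norm (y j)" if "i < k" for i j
        unfolding yn using that by (intro member_le_sum[of i "{..<k}" "\<lambda>i. norm ((xs ! i) j)"]) auto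
      let ?z = "scl F (of_real c * y 0 ^ (k - n)) (\<lambda>j. y j ^ n)"
      have "?z \<in> vecs F" using K yE unfolding power_bounded_def by (intro F.scl_vecs) blast
      then show "(\<lambda>j. ?c j * (\<Prod>i<k. (xs ! i) (\<phi> i j))) \<in> vecs F"
      proof (rule F.solid(1))
        fix j
        have "norm (?c j * (\<Prod>i<k. (xs ! i) (\<phi> i j))) = norm (?c j) * (\<Prod>i<k. norm ((xs ! i) (\<phi> i j)))"
          by (simp only: norm_mult prod_norm)
        also have "\<dots> \<le> c * (\<Prod>i<k. norm (y (\<phi> i j)))"
          using c xy by (intro mult_mono prod_mono prod_nonneg) auto
        also have "\<dots> = norm (?z j)"
          using c prod_\<phi>[of "\<lambda>j. norm (y j)"] by (simp add: F.scl_def norm_mult norm_power)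
        finally show "norm (?c j * (\<Prod>i<k. (xs ! i) (\<phi> i j))) \<le> norm (?z j)" .
      qed
    qed
    fix x assume x: "x \<in> vecs E"
    show "mixed c k n x = (\<lambda>j. ?c j * (\<Prod>i<k. (replicate k x ! i) (\<phi> i j)))"
    proof
      fix j
      have "(\<Prod>i<k. (replicate k x ! i) (\<phi> i j)) = (\<Prod>i<k. x (\<phi> i j))" by (intro prod.cong) auto
      then show "mixed c k n x j = ?c j * (\<Prod>i<k. (replicate k x ! i) (\<phi> i j))"
        using x n by (simp add: mixed_def prod_\<phi> power_0_left)
    qed
  qed
  have bound: "nrm F (mixed c k n x) \<le> 1" if x: "x \<in> vecs E" "nrm E x \<le> 1" for x
  proof -
    let ?y = "\<lambda>j. restr {1..} x j ^ n"
    have y: "?y \<in> vecs F" "nrm F ?y \<le> K * nrm E (restr {1..} x) ^ n"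
      using K E.restr_mem[OF x(1), of "{1..}"] unfolding power_bounded_def by blast+
    have "mixed c k n x = scl F (of_real c * x 0 ^ (k - n)) ?y"
      using x by (simp add: mixed_def F.scl_def)
    then have "nrm F (mixed c k n x) = c * norm (x 0) ^ (k - n) * nrm F ?y"
      using y c by (simp add: F.nrm_scl norm_mult norm_power)
    also have "\<dots> \<le> c * norm (x 0) ^ (k - n) * (K * nrm E (restr {1..} x) ^ n)"
      using y c by (intro mult_left_mono) auto
    also have "\<dots> = c * K * norm (x 0) ^ (k - n) * nrm E (restr {1..} x) ^ n" by simp
    also have "\<dots> \<le> 1"
    proof (rule le)
      have "norm (x 0) powr p \<le> nrm E (restr {..<1} x) powr p"
        using E.coord_le[OF E.restr_mem[OF x(1)], of "{..<1}" 0] E.p by (intro powr_mono2) auto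
      then show "norm (x 0) powr p + nrm E (restr {1..} x) powr p \<le> 1"
        using E.restr_powr_split[OF x(1), of 1] powr_le1[of p "nrm E x"] x E.p E.nrm_ge_0[OF x(1)] by linarith
    qed (use E.nrm_ge_0[OF E.restr_mem[OF x(1)]] in auto)
    finally show ?thesis .
  qed
  show "mixed c k n \<in> vecs (Polys k)"
    unfolding vecs_poly_space using hom bound by (auto simp: mixed_def)
  show "nrm (Polys k) (mixed c k n) \<le> 1" by (rule nrm_poly_least[OF bound])
qed

text \<open>
  The 2-ball property for the unit balls around \<open>Q \<plusminus> P\<close>, with \<open>P\<close> the peak polynomial and \<open>Q\<close> the
  mixed one, provides a weakly continuous \<open>R\<close> near both. On \<open>t e\<^sub>0 + s e\<^sub>j\<close> with large \<open>j\<close>, the map \<open>R\<close>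
  is nearly \<open>R(t e\<^sub>0)\<close>, which for one of the signs does not help in the coordinate \<open>0\<close>.
\<close>

lemma semi_M_ideal_imp:
  assumes n: "1 \<le> n" "n \<le> k" and c: "0 \<le> c" and K: "power_bounded n K"
    and le: "\<And>t s. 0 \<le> t \<Longrightarrow> 0 \<le> s \<Longrightarrow> t powr p + s powr p \<le> 1 \<Longrightarrow> c * K * t ^ (k - n) * s ^ n \<le> 1"
    and semi: "semi_M_ideal (Polys k) (weak_polys k E F)"
    and ts: "0 \<le> t" "0 \<le> s" "t powr p + s powr p \<le> 1"
  shows "(t ^ k) powr q + w 1 * (c * t ^ (k - n) * s ^ n) powr q \<le> 1"
    and "(c * t ^ (k - n) * s ^ n) powr q + w 1 * (t ^ k) powr q \<le> 1"
proof -
  interpret Z: normed_on "Polys k" by (rule normed_on_poly_space)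
  let ?P = "peak k" and ?Q = "mixed c k n"
  let ?b = "c * t ^ (k - n) * s ^ n"
  have Q: "?Q \<in> vecs (Polys k)" "nrm (Polys k) ?Q \<le> 1" using mixed_mem[OF n c K le] by auto
  have Pw: "?P \<in> weak_polys k E F" and Pn: "nrm (Polys k) ?P \<le> 1" using peak_mem by auto
  then have P: "?P \<in> vecs (Polys k)" by (auto simp: weak_polys_def)
  have mPw: "- ?P \<in> weak_polys k E F" by (rule Z.subspace_neg[OF subspace_weak_polys Pw])
  have main: "(t ^ k) powr q + w 1 * ?b powr q \<le> (1 + e) powr q \<and>
      ?b powr q + w 1 * (t ^ k) powr q \<le> (1 + e) powr q" if e: "0 < e" for e
  proof -
    \<comment> \<open>The balls meet in \<open>?Q\<close> because the peak has norm at most 1, and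
      they meet the subspace in plus and minus the peak because \<open>?Q\<close> has norm at most
      1.\<close>
    have "?Q \<in> ncball (Polys k) (?Q + ?P) 1 \<inter> ncball (Polys k) (?Q - ?P) 1"
      "?P \<in> ncball (Polys k) (?Q + ?P) 1 \<inter> weak_polys k E F"
      "- ?P \<in> ncball (Polys k) (?Q - ?P) 1 \<inter> weak_polys k E F"
      using Q P Pn Pw mPw Z.nrm_minus[OF P] by auto
    then have ne: "ncball (Polys k) (?Q + ?P) 1 \<inter> ncball (Polys k) (?Q - ?P) 1 \<noteq> {} \<and>
        ncball (Polys k) (?Q + ?P) 1 \<inter> weak_polys k E F \<noteq> {} \<and>
        ncball (Polys k) (?Q - ?P) 1 \<inter> weak_polys k E F \<noteq> {}" by blast
    have "ncball (Polys k) (?Q + ?P) (1 + e) \<inter> ncball (Polys k) (?Q - ?P) (1 + e) \<inter> weak_polys k E F \<noteq> {}"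
      using semi[unfolded semi_M_ideal_def, rule_format, OF Z.add_vecs[OF Q(1) P] Z.diff_vecs[OF Q(1) P] zero_less_one zero_less_one ne e] .
    then obtain R where R: "R \<in> weak_polys k E F" "nrm (Polys k) (?Q + ?P - R) \<le> 1 + e"
      "nrm (Polys k) (?Q - ?P - R) \<le> 1 + e" by auto
    have RP: "R \<in> vecs (Polys k)" and Rw: "weakly_continuous_on_bounded E F R"
      using R(1) by (auto simp: weak_polys_def)
    define \<rho> where "\<rho> = R (unit_vec 0) 0"
    \<comment> \<open>The scalars 1 and -1 have distance 2, so one of them is at least 1 away from
      \<open>\<rho>\<close>; that sign is kept as \<open>\<sigma>\<close>.\<close>
    have "2 \<le> norm (1 - \<rho>) + norm (- 1 - \<rho>)"
      using norm_triangle_ineq4[of "1 - \<rho>" "- 1 - \<rho>"] by simp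
    then have "1 \<le> norm (1 - \<rho>) \<or> 1 \<le> norm (- 1 - \<rho>)" by linarith
    then obtain \<sigma> :: 'k where \<sigma>: "1 \<le> norm (\<sigma> - \<rho>)"
      and near: "\<And>x. x \<in> vecs E \<Longrightarrow> nrm E x \<le> 1 \<Longrightarrow> nrm F (\<lambda>i. ?Q x i + \<sigma> * ?P x i - R x i) \<le> 1 + e"
    proof
      assume 1: "1 \<le> norm (1 - \<rho>)"
      show thesis
      proof (rule that[OF 1])
        fix x assume "x \<in> vecs E" "nrm E x \<le> 1"
        then have "nrm F ((?Q + ?P - R) x) \<le> 1 + e"
          using nrm_poly_upper[OF Z.diff_vecs[OF Z.add_vecs[OF Q(1) P] RP]] R(2) order_trans by blast
        moreover have "(?Q + ?P - R) x = (\<lambda>i. ?Q x i + 1 * ?P x i - R x i)" by (simp add: fun_eq_iff)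
        ultimately show "nrm F (\<lambda>i. ?Q x i + 1 * ?P x i - R x i) \<le> 1 + e" by (simp only:)
      qed
    next
      assume 1: "1 \<le> norm (- 1 - \<rho>)"
      show thesis
      proof (rule that[OF 1])
        fix x assume "x \<in> vecs E" "nrm E x \<le> 1"
        then have "nrm F ((?Q - ?P - R) x) \<le> 1 + e"
          using nrm_poly_upper[OF Z.diff_vecs[OF Z.diff_vecs[OF Q(1) P] RP]] R(3) order_trans by blast
        moreover have "(?Q - ?P - R) x = (\<lambda>i. ?Q x i + - 1 * ?P x i - R x i)" by (simp add: fun_eq_iff)
        ultimately show "nrm F (\<lambda>i. ?Q x i + - 1 * ?P x i - R x i) \<le> 1 + e" by (simp only:)
      qed
    qed
    \<comment> \<open>The second entry sits at \<open>Suc j\<close>, never at 0. For growing j these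
      vectors converge weakly to \<open>y0\<close>, without norm convergence unless s = 0.\<close>
    define y :: "nat \<Rightarrow> nat \<Rightarrow> 'k" where
      "y j i = (if i = 0 then of_real t else if i = Suc j then of_real s else 0)" for j i
    define y0 :: "nat \<Rightarrow> 'k" where "y0 = scl E (of_real t) (unit_vec 0)"
    have yE: "y j \<in> vecs E" "nrm E (y j) \<le> 1" for j
    proof -
      have "nrm E (y j) powr p \<le> (\<Sum>i\<in>{0, Suc j}. norm (y j i) powr p)"
        by (rule E.finite_support_mem(2)) (auto simp: y_def)
      also have "\<dots> \<le> 1" using ts by (simp add: y_def)
      finally have "nrm E (y j) powr p \<le> 1" .
      then show "nrm E (y j) \<le> 1" using E.p by (smt (verit) gr_one_powr)
      show "y j \<in> vecs E" by (rule E.finite_support_mem(1)[of "{0, Suc j}"]) (auto simp: y_def)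
    qed
    have y0E: "y0 \<in> vecs E" unfolding y0_def by simp
    have ylim: "(\<lambda>j. y j i) \<longlonglongrightarrow> y0 i" for i
    proof (rule tendsto_eventually)
      show "\<forall>\<^sub>F j in sequentially. y j i = y0 i"
        using eventually_ge_at_top[of i]
        by eventually_elim (auto simp: y_def y0_def E.scl_def unit_vec_def)
    qed
    have Rlim: "(\<lambda>j. nrm F (R (y j) - R y0)) \<longlonglongrightarrow> 0"
      using weak_poly_nlim[OF Rw y0E yE ylim] unfolding F.nlim_def .
    have "homogeneous_poly k E F R" using RP vecs_poly_space by blast
    then have "R y0 = scl F (of_real t ^ k) (R (unit_vec 0))"
      unfolding y0_def by (intro homogeneous_poly_scl) auto
    then have Ry0: "R y0 0 = of_real t ^ k * \<rho>" by (simp add: F.scl_def \<rho>_def)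
    have Rd: "R (y j) - R y0 \<in> vecs F" for j using poly_mem[OF RP] by simp
    have lim0: "(\<lambda>j. R (y j) 0) \<longlonglongrightarrow> R y0 0"
    proof -
      have "(\<lambda>j. R (y j) 0 - R y0 0) \<longlonglongrightarrow> 0"
        by (rule Lim_null_comparison[OF _ Rlim]) (use F.coord_le[OF Rd, of _ 0] in simp)
      then show ?thesis by (simp add: LIM_zero_iff)
    qed
    \<comment> \<open>The coordinate moves with j: \<open>R (y j)\<close> is close in norm to the
      fixed value \<open>R y0\<close>, whose coordinates tend to 0.\<close>
    have limj: "(\<lambda>j. R (y j) (Suc j)) \<longlonglongrightarrow> 0"
    proof (rule Lim_null_comparison)
      have "(\<lambda>j. norm (R y0 (Suc j))) \<longlonglongrightarrow> 0"
        using tendsto_norm_zero[OF LIMSEQ_Suc[OF F.coords_tendsto_0[OF poly_mem[OF RP]]]] .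
      from tendsto_add[OF Rlim this]
      show "(\<lambda>j. nrm F (R (y j) - R y0) + norm (R y0 (Suc j))) \<longlonglongrightarrow> 0" by simp
      have "norm (R (y j) (Suc j)) \<le> nrm F (R (y j) - R y0) + norm (R y0 (Suc j))" for j
        using F.coord_le[OF Rd, of j "Suc j"] norm_triangle_ineq[of "R (y j) (Suc j) - R y0 (Suc j)" "R y0 (Suc j)"]
        by simp
      then show "\<forall>\<^sub>F j in sequentially. norm (R (y j) (Suc j)) \<le> nrm F (R (y j) - R y0) + norm (R y0 (Suc j))"
        by simp
    qed
    define d where "d j = (\<lambda>i. ?Q (y j) i + \<sigma> * ?P (y j) i - R (y j) i)" for j
    have dF: "d j \<in> vecs F" "nrm F (d j) \<le> 1 + e" for j
    proof -
      have "d j = ?Q (y j) + scl F \<sigma> (?P (y j)) - R (y j)" by (simp add: d_def F.scl_def fun_eq_iff)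
      moreover have "\<dots> \<in> vecs F"
        by (intro F.diff_vecs F.add_vecs F.scl_vecs poly_mem[OF RP] poly_mem[OF Q(1)] poly_mem[OF P])
      ultimately show "d j \<in> vecs F" by (simp only:)
      show "nrm F (d j) \<le> 1 + e" unfolding d_def by (rule near[OF yE])
    qed
    have d0: "d j 0 = \<sigma> * of_real t ^ k - R (y j) 0" for j
      using yE n by (simp add: d_def mixed_def peak_def y_def power_0_left)
    have dj: "d j (Suc j) = of_real ?b - R (y j) (Suc j)" for j
      using yE by (simp add: d_def mixed_def peak_def y_def)
    have l0: "(\<lambda>j. norm (d j 0)) \<longlonglongrightarrow> t ^ k * norm (\<sigma> - \<rho>)"
    proof -
      have "(\<lambda>j. norm (d j 0)) \<longlonglongrightarrow> norm (\<sigma> * of_real t ^ k - R y0 0)"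
        unfolding d0 by (intro tendsto_norm tendsto_diff tendsto_const lim0)
      moreover have "\<sigma> * of_real t ^ k - R y0 0 = of_real t ^ k * (\<sigma> - \<rho>)"
        unfolding Ry0 by (simp add: algebra_simps)
      ultimately show ?thesis using ts(1) by (simp add: norm_mult norm_power)
    qed
    have lj: "(\<lambda>j. norm (d j (Suc j))) \<longlonglongrightarrow> ?b"
    proof -
      have "(\<lambda>j. norm (d j (Suc j))) \<longlonglongrightarrow> norm (of_real ?b - 0 :: 'k)"
        unfolding dj by (intro tendsto_norm tendsto_diff tendsto_const limj)
      then show ?thesis using ts c by (simp only: diff_0_right norm_of_real) simp
    qed
    have q0: "0 < q" using q by simp
    have pe: "nrm F (d j) powr q \<le> (1 + e) powr q" for j
      using dF q F.nrm_ge_0 by (intro powr_mono2) auto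
    have "norm (d j 0) powr q + w 1 * norm (d j (Suc j)) powr q \<le> (1 + e) powr q" for j
      using F.two_coords_le[OF dF(1)[of j], of 0 "Suc j"] pe[of j] by simp
    moreover have "(\<lambda>j. norm (d j 0) powr q + w 1 * norm (d j (Suc j)) powr q) \<longlonglongrightarrow>
        (t ^ k * norm (\<sigma> - \<rho>)) powr q + w 1 * ?b powr q"
      using l0 lj q0 by (intro tendsto_add tendsto_mult tendsto_const tendsto_powr') auto
    ultimately have 1: "(t ^ k * norm (\<sigma> - \<rho>)) powr q + w 1 * ?b powr q \<le> (1 + e) powr q"
      by (intro LIMSEQ_le_const2) auto
    have "norm (d j (Suc j)) powr q + w 1 * norm (d j 0) powr q \<le> (1 + e) powr q" for j
      using F.two_coords_le[OF dF(1)[of j], of "Suc j" 0] pe[of j] by simp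
    moreover have "(\<lambda>j. norm (d j (Suc j)) powr q + w 1 * norm (d j 0) powr q) \<longlonglongrightarrow>
        ?b powr q + w 1 * (t ^ k * norm (\<sigma> - \<rho>)) powr q"
      using l0 lj q0 by (intro tendsto_add tendsto_mult tendsto_const tendsto_powr') auto
    ultimately have 2: "?b powr q + w 1 * (t ^ k * norm (\<sigma> - \<rho>)) powr q \<le> (1 + e) powr q"
      by (intro LIMSEQ_le_const2) auto
    have "t ^ k \<le> t ^ k * norm (\<sigma> - \<rho>)" using \<sigma> ts(1) by (simp add: mult_le_cancel_left1)
    then have 3: "(t ^ k) powr q \<le> (t ^ k * norm (\<sigma> - \<rho>)) powr q" using ts(1) q by (intro powr_mono2) auto
    then have "w 1 * (t ^ k) powr q \<le> w 1 * (t ^ k * norm (\<sigma> - \<rho>)) powr q" using F.v by (intro mult_left_mono)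
    then show ?thesis using 1 2 3 by linarith
  qed
  have lim: "(\<lambda>m. (1 + 1 / real (Suc m)) powr q) \<longlonglongrightarrow> 1" by real_asymp
  show "(t ^ k) powr q + w 1 * ?b powr q \<le> 1"
    by (rule LIMSEQ_le_const[OF lim]) (use main[of "1 / real (Suc _)"] in auto)
  show "?b powr q + w 1 * (t ^ k) powr q \<le> 1"
    by (rule LIMSEQ_le_const[OF lim]) (use main[of "1 / real (Suc _)"] in auto)
qed

section \<open>Points at which the necessary inequalities fail\<close>

lemma not_semi_M_ideal_above:
  assumes n: "1 \<le> n" "p / q \<le> real n" and k: "n < k"
  shows "\<not> semi_M_ideal (Polys k) (weak_polys k E F)"
proof
  assume semi: "semi_M_ideal (Polys k) (weak_polys k E F)"
  \<comment> \<open>The size of the mixed polynomial with constant c = 1 along the arc where the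
    p-th powers of t and s sum to 1. The choice c = 1/max f makes the bound 1 attained.\<close>
  define f where "f t = t ^ (k - n) * ((1 - t powr p) powr (1 / p)) ^ n" for t :: real
  have p0: "0 < p" using E.p by simp
  have "continuous_on {0..1} f"
    unfolding f_def using p0
    by (intro continuous_intros continuous_on_powr') (auto intro: powr_le1)
  then obtain t where t: "t \<in> {0..1}" "\<And>u. u \<in> {0..1} \<Longrightarrow> f u \<le> f t"
    using continuous_attains_sup[of "{0..1::real}" f] by auto
  have "(1 / 2 :: real) powr p < 1" using powr_less_mono2[OF p0, of "1 / 2" 1] by simp
  then have "0 < f (1 / 2)" unfolding f_def using p0 by (intro mult_pos_pos zero_less_power) simp_all
  with t(2)[of "1 / 2"] have M: "0 < f t" by simp
  \<comment> \<open>Here k > n is decisive: the factor \<open>t ^ (k - n)\<close> vanishes at 0, so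
    the maximum is at a positive t.\<close>
  have t0: "0 < t"
  proof (rule ccontr)
    assume "\<not> 0 < t"
    with t(1) have "t = 0" by simp
    with k have "f t = 0" by (simp add: f_def)
    with M show False by simp
  qed
  let ?c = "1 / f t" and ?s = "(1 - t powr p) powr (1 / p)"
  have tp: "t powr p \<le> 1" using t(1) p0 by (intro powr_le1) auto
  \<comment> \<open>The moving coordinate takes the position of weight 1, where it already
    contributes 1; the peak adds a positive amount in the second position.\<close>
  have "(?c * t ^ (k - n) * ?s ^ n) powr q + w 1 * (t ^ k) powr q \<le> 1"
  proof (rule semi_M_ideal_imp(2)[OF n(1) _ _ power_bounded_1[OF n(2,1)] _ semi])
    fix u s :: real assume us: "0 \<le> u" "0 \<le> s" "u powr p + s powr p \<le> 1"
    have "u powr p \<le> 1" using us powr_ge_zero[of s p] by linarith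
    then have u1: "u \<le> 1" using p0 by (smt (verit) gr_one_powr)
    have "(s powr p) powr (1 / p) \<le> (1 - u powr p) powr (1 / p)"
      using us p0 by (intro powr_mono2) auto
    then have "s \<le> (1 - u powr p) powr (1 / p)" using us p0 by (simp add: powr_powr)
    then have "u ^ (k - n) * s ^ n \<le> f u"
      unfolding f_def using us by (intro mult_left_mono power_mono) auto
    also have "\<dots> \<le> f t" using us u1 by (intro t(2)) auto
    finally show "?c * 1 * u ^ (k - n) * s ^ n \<le> 1" using M by (simp add: field_simps)
  next
    show "t powr p + ?s powr p \<le> 1" using p0 tp by (simp add: powr_powr)
  qed (use k M t0 in auto)
  moreover have eq: "?c * t ^ (k - n) * ?s ^ n = 1"
    unfolding mult.assoc f_def[of t, symmetric] using M by simp
  moreover have "0 < w 1 * (t ^ k) powr q"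
    using lorentz_weight_pos[OF F.w] t0 by simp
  ultimately show False unfolding eq powr_one_eq_one by linarith
qed

lemma not_semi_M_ideal_below:
  assumes n: "1 \<le> n" "real n < p / q" and w: "w \<in> ell (conj_exp (ereal p / ereal (real n * q)))"
    and k: "n \<le> k"
  shows "\<not> semi_M_ideal (Polys k) (weak_polys k E F)"
proof
  assume semi: "semi_M_ideal (Polys k) (weak_polys k E F)"
  obtain K where K: "0 \<le> K" "power_bounded n K" using power_bounded_Young[OF n w] by blast
  \<comment> \<open>The summand 1 allows K = 0 and still gives c K \<le> 1.\<close>
  define c where "c = 1 / (K + 1)"
  have c: "0 < c" "c * K \<le> 1" using K(1) by (auto simp: c_def field_simps)
  have p0: "0 < p" using E.p by simp
  have le: "c * K * t ^ (k - n) * s ^ n \<le> 1" if "0 \<le> t" "0 \<le> s" "t powr p + s powr p \<le> 1" for t s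
  proof -
    have "t powr p \<le> 1" "s powr p \<le> 1" using that powr_ge_zero[of s p] powr_ge_zero[of t p] by linarith+
    then have "t \<le> 1" "s \<le> 1" using p0 by (smt (verit) gr_one_powr)+
    then have "t ^ (k - n) * s ^ n \<le> 1"
      using that by (intro mult_le_one power_le_one) auto
    then have "c * K * (t ^ (k - n) * s ^ n) \<le> 1"
      using that by (intro mult_le_one[OF c(2)]) auto
    then show ?thesis by (simp only: mult.assoc)
  qed
  define \<theta> where "\<theta> = real n * q / p"
  have \<theta>: "0 < \<theta>" "\<theta> < 1" using n q p0 by (auto simp: \<theta>_def field_simps)
  define A where "A = w 1 * c powr q"
  have A: "0 < A" using lorentz_weight_pos[OF F.w] c by (simp add: A_def)
  \<comment> \<open>The arc is parametrised by u, the p-th power of s. Now the peak takes the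
    position of weight 1 and the moving coordinate that of weight \<open>w 1\<close>.\<close>
  have ineq: "(1 - u) powr (real k * q / p) + A * ((1 - u) powr (real (k - n) * q / p) * u powr \<theta>) \<le> 1"
    if u: "0 < u" "u < 1" for u
  proof -
    let ?t = "(1 - u) powr (1 / p)" and ?s = "u powr (1 / p)"
    have "(?t ^ k) powr q + w 1 * (c * ?t ^ (k - n) * ?s ^ n) powr q \<le> 1"
      by (rule semi_M_ideal_imp(1)[OF n(1) k _ K(2) le semi]) (use c u p0 in \<open>auto simp: powr_powr\<close>)
    moreover have "(?t ^ m) powr q = (1 - u) powr (real m * q / p)" for m
      using u by (simp add: powr_realpow[symmetric] powr_powr)
    moreover have "(?s ^ n) powr q = u powr \<theta>"
      using u by (simp add: powr_realpow[symmetric] powr_powr \<theta>_def)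
    ultimately show ?thesis using u c by (simp add: powr_mult A_def mult.assoc)
  qed
  define a b where "a = real k * q / p" and "b = real (k - n) * q / p"
  have "a > 0" "b \<ge> 0" using k n q p0 by (auto simp: a_def b_def)
  \<comment> \<open>Near u = 0 the first term loses an amount of order u, while the second is of
    order u to the power \<open>\<theta>\<close> < 1 and wins.\<close>
  have "\<forall>\<^sub>F u in at_right 0. 1 < (1 - u) powr a + A * ((1 - u) powr b * u powr \<theta>)"
    using \<theta> A \<open>a > 0\<close> by real_asymp
  moreover have "\<forall>\<^sub>F u in at_right (0::real). 0 < u \<and> u < 1"
    by (simp add: eventually_at_right_field) (metis zero_less_one)
  ultimately have "\<forall>\<^sub>F u in at_right (0::real). False"
  proof eventually_elim
    case (elim u)
    then show ?case using ineq[of u] unfolding a_def b_def by linarith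
  qed
  then show False by (simp add: trivial_limit_at_right_real)
qed

end

section \<open>The two regimes at the critical degree\<close>

theorem theorem3p9:
  fixes p q :: real and w :: "nat \<Rightarrow> real" and n :: nat
    and E F :: "('k::real_or_complex, nat \<Rightarrow> 'k) nspace"
  assumes "1 < p" and "1 < q" and "lorentz_weight w"
    and "E = lp_space p" and "F = lorentz_space w q"
    and "n = critical_degree E F"
  shows "(p / q \<le> real n \<and> real n < p / q + 1 \<and>
          w \<notin> ell (conj_exp (ereal p / ereal ((real n - 1) * q))) \<longrightarrow>
            M_ideal (poly_space n E F) (weak_polys n E F) \<and>
            (\<forall>k>n. \<not> semi_M_ideal (poly_space k E F) (weak_polys k E F)))
       \<and>
         (real n < p / q \<and>
          w \<in> ell (conj_exp (ereal p / ereal (real n * q)))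
              - ell (conj_exp (ereal p / ereal ((real n - 1) * q))) \<longrightarrow>
            (\<forall>k\<ge>n. \<not> semi_M_ideal (poly_space k E F) (weak_polys k E F)))"
proof -
  interpret lp_lorentz p E w q F
    using assms(1-5) by unfold_locales auto
  \<comment> \<open>Minimality of the critical degree: in all smaller positive degrees every
    polynomial is weakly continuous.\<close>
  have lower: "weak_polys k E F = vecs (poly_space k E F)" if "1 \<le> k" "k < n" for k
    using not_less_Least[of k "\<lambda>k. 1 \<le> k \<and> weak_polys k E F \<noteq> vecs (poly_space k E F)"] that
    unfolding assms(6) critical_degree_def by blast
  show ?thesis
  proof (rule conjI; rule impI; elim conjE)
    assume n: "p / q \<le> real n"
    have "0 < p / q" using assms(1,2) by simp
    with n have "1 \<le> n" by (cases n) auto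
    then show "M_ideal (poly_space n E F) (weak_polys n E F) \<and>
        (\<forall>k>n. \<not> semi_M_ideal (poly_space k E F) (weak_polys k E F))"
      using M_ideal_weak_polys[OF _ n lower] not_semi_M_ideal_above[OF _ n] by blast
  next
    assume n: "real n < p / q"
      and "w \<in> ell (conj_exp (ereal p / ereal (real n * q))) - ell (conj_exp (ereal p / ereal ((real n - 1) * q)))"
    then have w: "w \<in> ell (conj_exp (ereal p / ereal (real n * q)))" by blast
    \<comment> \<open>For n = 0 the quotient reads as \<infinity> with conjugate 1, and a Lorentz
      weight is not summable.\<close>
    have "n \<noteq> 0"
    proof
      assume "n = 0"
      then have "conj_exp (ereal p / ereal (real n * q)) = 1"
        using assms(1) by (simp add: conj_exp_def divide_ereal_def zero_ereal_def[symmetric])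
      with w assms(3) show False by (simp add: lorentz_weight_def)
    qed
    then show "\<forall>k\<ge>n. \<not> semi_M_ideal (poly_space k E F) (weak_polys k E F)"
      using not_semi_M_ideal_below[OF _ n w] by simp
  qed
qed

end
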